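(* Let $F:=(5,\{01,12,23,30,04\})$ be the graph on $\{0,1,2,3,4\}$ that is the $4$-cycle with a pendant edge. Then every sequence of graphs $(G_n)_{n\in\mathbb{N}}$ of growing orders with $\lambda_F(G_n)=\lambda_F+o(1)$ as $n\to\infty$ consists, up to $o(v(G_n)^2)$ edits in each $G_n$, of balanced bipartite $5/6$-quasirandom graphs. That is, one can change $o(v(G_n)^2)$ adjacencies in each $G_n$ so that the resulting graphs are bipartite with parts of sizes $(1/2+o(1))v(G_n)$ and form a $5/6$-quasirandom sequence.
   Context: Graphs are finite and simple; $v(G)$ is the number of vertices of $G$; $ij$ abbreviates $\{i,j\}$, and $(m,E)$ denotes the graph with vertex set $\{0,\dots,m-1\}$ and edge set $E$. "Growing orders" means that $v(G_n)$ is strictly increasing in $n$. Inducibility: for a graph $F$ with $\kappa$ vertices and a graph $G$ with $n\ge\kappa$ vertices, $\lambda_F(G)$ is the number of $\kappa$-subsets of $V(G)$ that induce a subgraph isomorphic to $F$, divided by $\binom{n}{\kappa}$. Further, $\lambda_F(n):=\max\{\lambda_F(G): G\text{ is an } n\text{-vertex graph}\}$ and $\lambda_F:=\lim_{n\to\infty}\lambda_F(n)$ (the limit exists). An edit is a change of the adjacency of one pair of vertices. A sequence of growing bipartite graphs $(G_n)_{n\in\mathbb{N}}$ with almost equal parts (balanced) is $c$-quasirandom if for every bipartite graph $F'$ (with given bipartition) the bipartite non-induced homomorphism density of $F'$ in $G_n$, i.e. the probability that a uniformly random part-preserving map $V(F')\to V(G_n)$ sends every edge of $F'$ to an edge of $G_n$,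 is $c^{|E(F')|}+o(1)$ as $n\to\infty$. *)

theory Defs
  imports Complex_Main "HOL-Library.FuncSet" "HOL-Library.Landau_Symbols"
begin

type_synonym 'a graph = "'a set \<times> 'a set set"

abbreviation vertex_set :: "'a graph \<Rightarrow> 'a set" where "vertex_set \<equiv> fst"

abbreviation edge_set :: "'a graph \<Rightarrow> 'a set set" where "edge_set \<equiv> snd"

definition simple_graph :: "'a graph \<Rightarrow> bool" where
  "simple_graph G \<longleftrightarrow> finite (vertex_set G) \<and> (\<forall>e\<in>edge_set G. e \<subseteq> vertex_set G \<and> card e = 2)"

abbreviation num_verts :: "'a graph \<Rightarrow> nat" where "num_verts G \<equiv> card (vertex_set G)"

definition induced :: "'a graph \<Rightarrow> 'a set \<Rightarrow> 'a graph" where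
  "induced G S = (S, {e \<in> edge_set G. e \<subseteq> S})"

definition isomorphic :: "'a graph \<Rightarrow> 'b graph \<Rightarrow> bool" where
  "isomorphic G H \<longleftrightarrow>
    (\<exists>f. bij_betw f (vertex_set G) (vertex_set H) \<and>
         (\<forall>u\<in>vertex_set G. \<forall>v\<in>vertex_set G. {u, v} \<in> edge_set G \<longleftrightarrow> {f u, f v} \<in> edge_set H))"

definition induced_density :: "'b graph \<Rightarrow> 'a graph \<Rightarrow> real" where
  "induced_density F G =
    real (card {S. S \<subseteq> vertex_set G \<and> card S = num_verts F \<and> isomorphic (induced G S) F})
      / real (num_verts G choose num_verts F)"

text \<open>
  Every finite graph is isomorphic to one with vertices in the natural numbers. The set below is
  finite and nonempty, and its elements are all 0 when n is smaller than the number of vertices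
  of F (division by zero), which does not affect the limit.
\<close>
definition max_induced_density :: "'b graph \<Rightarrow> nat \<Rightarrow> real" where
  "max_induced_density F n =
    Max {induced_density F G | G :: nat graph. simple_graph G \<and> num_verts G = n}"

definition inducibility :: "'b graph \<Rightarrow> real" where
  "inducibility F = lim (max_induced_density F)"

definition C4_pendant :: "nat graph" where
  "C4_pendant = ({0..<5}, {{0, 1}, {1, 2}, {2, 3}, {3, 0}, {0, 4}})"

text \<open>Meaningful for graphs on the same vertex set.\<close>
definition edits :: "'a graph \<Rightarrow> 'a graph \<Rightarrow> nat" where
  "edits G H = card ((edge_set G - edge_set H) \<union> (edge_set H - edge_set G))"

definition bipartite_with :: "'a graph \<Rightarrow> 'a set \<Rightarrow> 'a set \<Rightarrow> bool" where
  "bipartite_with G A B \<longleftrightarrow>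
    simple_graph G \<and> A \<union> B = vertex_set G \<and> A \<inter> B = {} \<and>
    (\<forall>e\<in>edge_set G. \<exists>a\<in>A. \<exists>b\<in>B. e = {a, b})"

definition part_maps ::
    "'b set \<Rightarrow> 'b set \<Rightarrow> 'a set \<Rightarrow> 'a set \<Rightarrow> ('b \<Rightarrow> 'a) set" where
  "part_maps X Y A B = {f \<in> (X \<union> Y) \<rightarrow>\<^sub>E (A \<union> B). f ` X \<subseteq> A \<and> f ` Y \<subseteq> B}"

definition bip_hom_density ::
    "'b graph \<Rightarrow> 'b set \<Rightarrow> 'b set \<Rightarrow> 'a graph \<Rightarrow> 'a set \<Rightarrow> 'a set \<Rightarrow> real" where
  "bip_hom_density F X Y G A B =
    real (card {f \<in> part_maps X Y A B. \<forall>e\<in>edge_set F. f ` e \<in> edge_set G})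
      / real (card (part_maps X Y A B))"

definition balanced_bipartite_seq ::
    "(nat \<Rightarrow> 'a graph) \<Rightarrow> (nat \<Rightarrow> 'a set) \<Rightarrow> (nat \<Rightarrow> 'a set) \<Rightarrow> bool" where
  "balanced_bipartite_seq G A B \<longleftrightarrow>
    strict_mono (\<lambda>n. num_verts (G n)) \<and>
    (\<forall>n. bipartite_with (G n) (A n) (B n)) \<and>
    (\<lambda>n. real (card (A n)) / real (num_verts (G n))) \<longlonglongrightarrow> 1 / 2 \<and>
    (\<lambda>n. real (card (B n)) / real (num_verts (G n))) \<longlonglongrightarrow> 1 / 2"

text \<open>
  X goes to A and Y to B; the other orientation is covered since the quantification includes
  the pair Y, X as well.
\<close>
definition quasirandom ::
    "real \<Rightarrow> (nat \<Rightarrow> 'a graph) \<Rightarrow> (nat \<Rightarrow> 'a set) \<Rightarrow> (nat \<Rightarrow> 'a set) \<Rightarrow> bool" where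
  "quasirandom c G A B \<longleftrightarrow>
    balanced_bipartite_seq G A B \<and>
    (\<forall>(F :: nat graph) X Y. bipartite_with F X Y \<longrightarrow>
      (\<lambda>n. bip_hom_density F X Y (G n) (A n) (B n)) \<longlonglongrightarrow> c ^ card (edge_set F))"

end

(* Let F be the 4-cycle with a pendant edge and lambda = 15625/62208 the density of F in a balanced
   bipartite 5/6-quasirandom graph. The upper bound is a flag algebra computation on five vertices:
   for a triple of vertices and its type (no edge, one edge, path), a positive semidefinite quadratic
   form in the densities of the neighbourhood patterns on the triple is subtracted, and the resulting
   inequality holds for each of the 1024 labelled graphs on five vertices separately. Averaging over
   all 5-tuples bounds the density of F. If the density is close to lambda, then all nonnegative
   terms that were dropped are small. Three of them suffice for stability: there are few triangles,
   almost all positive codegrees are close to 25n/72, and almost all vertices of positive degree have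
   degree close to 5n/12. Fixing a typical vertex u, let A be the set of vertices that have large
   codegree with u. Two adjacent vertices of A would have many common neighbours in N(u), so A spans
   few edges, and counting edges shows that |A| is about n/2 and that the complement B spans few edges as
   well. The second moment of the codegrees inside A then bounds the cut norm of the bipartite
   graph minus 5/6, and replacing the edges of F' one at a time gives all homomorphism densities.
   The matching lower bound for lambda averages over random bipartite graphs. *)

theory Submission
  imports Defs "HOL-Analysis.Convex" "HOL-Combinatorics.Multiset_Permutations" "HOL-Real_Asymp.Real_Asymp"
begin

section \<open>A flag algebra certificate on five vertices\<close>

text \<open>F is \<open>K_{2,3}\<close> minus one edge, which explains 5/6: on five vertices split
  2-3 between the parts, F appears exactly when one of the six cross pairs is missing. With edge
  density c this has probability 6 c^5 (1 - c), maximal at c = 5/6 with value (5/6)^5, and 20 of the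
  32 splits are 2-3, so the density is 5/8 (5/6)^5. For a tight bound every subtracted square must
  vanish in the limit object, so only linear forms with mean zero there are available. Sums run over
  all n^5 tuples, repetitions included, and not over 5-sets: the quadratic forms then factor into
  genuine squares for each finite graph, and no lower-order error has to be carried along. The
  obstacle in the stability part is that the retained squares carry the weights deg^2 and codeg, so
  they say nothing about isolated vertices or pairs of codegree zero. Hence the number of edges is
  bounded below through the number of copies, u is chosen by degree-weighted averaging, and codegree
  zero is excluded on most pairs inside A by a lower bound on the average codegree.\<close>

text \<open>
  The matrices below are an exact rounding of a numerical solution of the semidefinite program, scaled
  to integers so that \<open>15625/62208\<close> becomes \<open>38281250\<close> for the sum over the ten splits of five
  vertices into a triple and a pair. They act on linear forms in the pattern \<open>(p, q, r)\<close> of adjacencies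
  of a vertex to the triple whose averages vanish in the extremal graphs, where the relative degree is
  \<open>5/12\<close> and the relative codegree is \<open>0\<close> or \<open>25/72\<close>. In the edge type the first two
  vertices of the triple are adjacent, in the path type the first one is the centre; \<open>bil_path_anti\<close>
  acts on the forms that change sign when the two leaves of the path are exchanged.
\<close>

definition bil_edge :: "int \<Rightarrow> int \<Rightarrow> int \<Rightarrow> int \<Rightarrow> int \<Rightarrow> int \<Rightarrow> int \<Rightarrow> int \<Rightarrow> int \<Rightarrow> int \<Rightarrow> int" where
  "bil_edge x0 x1 x2 x3 x4 y0 y1 y2 y3 y4 =
     x0 * (1879200 * y0 + 990000 * y1 - 14908320 * y2 - 299420 * y3 + 33350400 * y4) +
     x1 * (990000 * y0 + 635625 * y1 - 8100000 * y2 - 164250 * y3 + 18185040 * y4) +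
     x2 * (- 14908320 * y0 - 8100000 * y1 + 124908480 * y2 + 2485440 * y3 - 278458560 * y4) +
     x3 * (- 299420 * y0 - 164250 * y1 + 2485440 * y2 + 49600 * y3 - 5546880 * y4) +
     x4 * (33350400 * y0 + 18185040 * y1 - 278458560 * y2 - 5546880 * y3 + 621120960 * y4)"

definition bil_path :: "int \<Rightarrow> int \<Rightarrow> int \<Rightarrow> int \<Rightarrow> int \<Rightarrow> int \<Rightarrow> int \<Rightarrow> int \<Rightarrow> int" where
  "bil_path x0 x1 x2 x3 y0 y1 y2 y3 =
     x0 * (686475 * y0 + 468000 * y1 + 24154 * y2 - 4326480 * y3) +
     x1 * (468000 * y0 + 1277130 * y1 - 67994 * y2 - 4566240 * y3) +
     x2 * (24154 * y0 - 67994 * y1 + 12000 * y2 - 24840 * y3) +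
     x3 * (- 4326480 * y0 - 4566240 * y1 - 24840 * y2 + 30170880 * y3)"

definition bil_path_anti :: "int \<Rightarrow> int \<Rightarrow> int \<Rightarrow> int \<Rightarrow> int" where
  "bil_path_anti x0 x1 y0 y1 = x0 * (45343800 * y0 - 32685120 * y1) + x1 * (25168320 * y1 - 32685120 * y0)"

text \<open>An independent triple of the limit object lies in one part or is split 2-1. The mean of
  this form is 1000 - 1500 + 675 - 175 = 0 in the first case and 0 - 500 + 675 - 175 = 0 in the
  second, so a single form covers both.\<close>

definition lin_empty :: "bool \<Rightarrow> bool \<Rightarrow> bool \<Rightarrow> int" where
  "lin_empty p q r = 3456 * of_bool (p \<and> q \<and> r) - 1440 * (of_bool (p \<and> q) + of_bool (p \<and> r) + of_bool (q \<and> r))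
     + 540 * (of_bool p + of_bool q + of_bool r) - 175"

definition form_empty :: "bool \<Rightarrow> bool \<Rightarrow> bool \<Rightarrow> bool \<Rightarrow> bool \<Rightarrow> bool \<Rightarrow> int" where
  "form_empty p q r p' q' r' = 125 * lin_empty p q r * lin_empty p' q' r'"

definition form_edge :: "bool \<Rightarrow> bool \<Rightarrow> bool \<Rightarrow> bool \<Rightarrow> bool \<Rightarrow> bool \<Rightarrow> int" where
  "form_edge p q r p' q' r' = bil_edge
     (6 * of_bool p + 6 * of_bool q - 5) (12 * of_bool r - 5) (of_bool (p \<and> q)) (72 * (of_bool (p \<and> r) + of_bool (q \<and> r)) - 25) (of_bool (p \<and> q \<and> r))
     (6 * of_bool p' + 6 * of_bool q' - 5) (12 * of_bool r' - 5) (of_bool (p' \<and> q')) (72 * (of_bool (p' \<and> r') + of_bool (q' \<and> r')) - 25) (of_bool (p' \<and> q' \<and> r'))"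

definition form_path :: "bool \<Rightarrow> bool \<Rightarrow> bool \<Rightarrow> bool \<Rightarrow> bool \<Rightarrow> bool \<Rightarrow> int" where
  "form_path p q r p' q' r' = bil_path
     (12 * of_bool p - 5) (6 * of_bool q + 6 * of_bool r - 5) (72 * of_bool (q \<and> r) - 25) (of_bool (p \<and> q) + of_bool (p \<and> r))
     (12 * of_bool p' - 5) (6 * of_bool q' + 6 * of_bool r' - 5) (72 * of_bool (q' \<and> r') - 25) (of_bool (p' \<and> q') + of_bool (p' \<and> r'))
   + bil_path_anti (of_bool q - of_bool r) (of_bool (p \<and> q) - of_bool (p \<and> r))
     (of_bool q' - of_bool r') (of_bool (p' \<and> q') - of_bool (p' \<and> r'))"

text \<open>\<open>a\<close>, \<open>b\<close>, \<open>c\<close> are the adjacencies of the pairs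
  12, 13, 23 inside the triple; the two blocks of three describe the remaining two vertices.
  Patterns are reordered so that the ends of the edge, or the centre of the path, come first.
  Triangles, absent from the extremal graphs, get the zero form.\<close>

definition type_form :: "bool \<Rightarrow> bool \<Rightarrow> bool \<Rightarrow> bool \<Rightarrow> bool \<Rightarrow> bool \<Rightarrow> bool \<Rightarrow> bool \<Rightarrow> bool \<Rightarrow> int" where
  "type_form a b c p q r p' q' r' =
    (if a then if b then if c then 0 else form_path p q r p' q' r'
               else if c then form_path q p r q' p' r' else form_edge p q r p' q' r'
     else if b then if c then form_path r p q r' p' q' else form_edge p r q p' r' q'
          else if c then form_edge q r p q' r' p' else form_empty p q r p' q' r')"

definition split_sum :: "bool \<Rightarrow> bool \<Rightarrow> bool \<Rightarrow> bool \<Rightarrow> bool \<Rightarrow> bool \<Rightarrow> bool \<Rightarrow> bool \<Rightarrow> bool \<Rightarrow> bool \<Rightarrow> int" where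
  "split_sum e01 e02 e03 e04 e12 e13 e14 e23 e24 e34 =
     type_form e01 e02 e12 e03 e13 e23 e04 e14 e24 + type_form e01 e03 e13 e02 e12 e23 e04 e14 e34 +
     type_form e01 e04 e14 e02 e12 e24 e03 e13 e34 + type_form e02 e03 e23 e01 e12 e13 e04 e24 e34 +
     type_form e02 e04 e24 e01 e12 e14 e03 e23 e34 + type_form e03 e04 e34 e01 e13 e14 e02 e23 e24 +
     type_form e12 e13 e23 e01 e02 e03 e14 e24 e34 + type_form e12 e14 e24 e01 e02 e04 e13 e23 e34 +
     type_form e13 e14 e34 e01 e03 e04 e12 e23 e24 + type_form e23 e24 e34 e02 e03 e04 e12 e13 e14"

text \<open>The values are tabulated so that the 1024 cases of \<open>split_sum_le\<close> become table lookups.\<close>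

lemma form_empty_table:
  "form_empty False False False False False False = 3828125"
  "form_empty False False False False False True = -7984375"
  "form_empty False False False False True False = -7984375"
  "form_empty False False False False True True = 11703125"
  "form_empty False False False True False False = -7984375"
  "form_empty False False False True False True = 11703125"
  "form_empty False False False True True False = 11703125"
  "form_empty False False False True True True = -12709375"
  "form_empty False False True False False False = -7984375"
  "form_empty False False True False False True = 16653125"
  "form_empty False False True False True False = 16653125"
  "form_empty False False True False True True = -24409375"
  "form_empty False False True True False False = 16653125"
  "form_empty False False True True False True = -24409375"
  "form_empty False False True True True False = -24409375"
  "form_empty False False True True True True = 26508125"
  "form_empty False True False False False False = -7984375"
  "form_empty False True False False False True = 16653125"
  "form_empty False True False False True False = 16653125"
  "form_empty False True False False True True = -24409375"
  "form_empty False True False True False False = 16653125"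
  "form_empty False True False True False True = -24409375"
  "form_empty False True False True True False = -24409375"
  "form_empty False True False True True True = 26508125"
  "form_empty False True True False False False = 11703125"
  "form_empty False True True False False True = -24409375"
  "form_empty False True True False True False = -24409375"
  "form_empty False True True False True True = 35778125"
  "form_empty False True True True False False = -24409375"
  "form_empty False True True True False True = 35778125"
  "form_empty False True True True True False = 35778125"
  "form_empty False True True True True True = -38854375"
  "form_empty True False False False False False = -7984375"
  "form_empty True False False False False True = 16653125"
  "form_empty True False False False True False = 16653125"
  "form_empty True False False False True True = -24409375"
  "form_empty True False False True False False = 16653125"
  "form_empty True False False True False True = -24409375"
  "form_empty True False False True True False = -24409375"
  "form_empty True False False True True True = 26508125"
  "form_empty True False True False False False = 11703125"
  "form_empty True False True False False True = -24409375"
  "form_empty True False True False True False = -24409375"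
  "form_empty True False True False True True = 35778125"
  "form_empty True False True True False False = -24409375"
  "form_empty True False True True False True = 35778125"
  "form_empty True False True True True False = 35778125"
  "form_empty True False True True True True = -38854375"
  "form_empty True True False False False False = 11703125"
  "form_empty True True False False False True = -24409375"
  "form_empty True True False False True False = -24409375"
  "form_empty True True False False True True = 35778125"
  "form_empty True True False True False False = -24409375"
  "form_empty True True False True False True = 35778125"
  "form_empty True True False True True False = 35778125"
  "form_empty True True False True True True = -38854375"
  "form_empty True True True False False False = -12709375"
  "form_empty True True True False False True = 26508125"
  "form_empty True True True False True False = 26508125"
  "form_empty True True True False True True = -38854375"
  "form_empty True True True True False False = 26508125"
  "form_empty True True True True False True = -38854375"
  "form_empty True True True True True False = -38854375"
  "form_empty True True True True True True = 42195125"
  by (simp_all add: form_empty_def lin_empty_def bil_edge_def bil_path_def bil_path_anti_def)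

lemma form_edge_table:
  "form_edge False False False False False False = 27453125"
  "form_edge False False False False False True = -20809375"
  "form_edge False False False False True False = -13709875"
  "form_edge False False False False True True = 15668825"
  "form_edge False False False True False False = -13709875"
  "form_edge False False False True False True = 15668825"
  "form_edge False False False True True False = -1967275"
  "form_edge False False False True True True = -13952575"
  "form_edge False False True False False False = -20809375"
  "form_edge False False True False False True = 22458125"
  "form_edge False False True False True False = 9307625"
  "form_edge False False True False True True = -11695675"
  "form_edge False False True True False False = 9307625"
  "form_edge False False True True False True = -11695675"
  "form_edge False False True True True False = -4869775"
  "form_edge False False True True True True = 9071405"
  "form_edge False True False False False False = -13709875"
  "form_edge False True False False False True = 9307625"
  "form_edge False True False False True False = 12778325"
  "form_edge False True False False True True = -15912415"
  "form_edge False True False True False False = 12778325"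
  "form_edge False True False True False True = -15912415"
  "form_edge False True False True True False = 2722205"
  "form_edge False True False True True True = 3420425"
  "form_edge False True True False False False = 15668825"
  "form_edge False True True False False True = -11695675"
  "form_edge False True True False True False = -15912415"
  "form_edge False True True False True True = 20229245"
  "form_edge False True True True False False = -15912415"
  "form_edge False True True True False True = 20229245"
  "form_edge False True True True True False = -2286295"
  "form_edge False True True True True True = -2696155"
  "form_edge True False False False False False = -13709875"
  "form_edge True False False False False True = 9307625"
  "form_edge True False False False True False = 12778325"
  "form_edge True False False False True True = -15912415"
  "form_edge True False False True False False = 12778325"
  "form_edge True False False True False True = -15912415"
  "form_edge True False False True True False = 2722205"
  "form_edge True False False True True True = 3420425"
  "form_edge True False True False False False = 15668825"
  "form_edge True False True False False True = -11695675"
  "form_edge True False True False True False = -15912415"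
  "form_edge True False True False True True = 20229245"
  "form_edge True False True True False False = -15912415"
  "form_edge True False True True False True = 20229245"
  "form_edge True False True True True False = -2286295"
  "form_edge True False True True True True = -2696155"
  "form_edge True True False False False False = -1967275"
  "form_edge True True False False False True = -4869775"
  "form_edge True True False False True False = 2722205"
  "form_edge True True False False True True = -2286295"
  "form_edge True True False True False False = 2722205"
  "form_edge True True False True False True = -2286295"
  "form_edge True True False True True False = 6325925"
  "form_edge True True False True True True = 1952465"
  "form_edge True True True False False False = -13952575"
  "form_edge True True True False False True = 9071405"
  "form_edge True True True False True False = 3420425"
  "form_edge True True True False True True = -2696155"
  "form_edge True True True True False False = 3420425"
  "form_edge True True True True False True = -2696155"
  "form_edge True True True True True False = 1952465"
  "form_edge True True True True True True = 10027085"
  by (simp_all add: form_edge_def lin_empty_def bil_edge_def bil_path_def bil_path_anti_def)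

lemma form_path_table:
  "form_path False False False False False False = 69030125"
  "form_path False False False False False True = 26875325"
  "form_path False False False False True False = 26875325"
  "form_path False False False False True True = -21097075"
  "form_path False False False True False False = -7484575"
  "form_path False False False True False True = -4554775"
  "form_path False False False True True False = -4554775"
  "form_path False False False True True True = -7442575"
  "form_path False False True False False False = 26875325"
  "form_path False False True False False True = 76041005"
  "form_path False False True False True False = -14646595"
  "form_path False False True False True True = -671923"
  "form_path False False True True False False = -15943375"
  "form_path False False True True False True = 18224345"
  "form_path False False True True True False = -7093015"
  "form_path False False True True True True = -8116303"
  "form_path False True False False False False = 26875325"
  "form_path False True False False False True = -14646595"
  "form_path False True False False True False = 76041005"
  "form_path False True False False True True = -671923"
  "form_path False True False True False False = -15943375"
  "form_path False True False True False True = -7093015"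
  "form_path False True False True True False = 18224345"
  "form_path False True False True True True = -8116303"
  "form_path False True True False False False = -21097075"
  "form_path False True True False False True = -671923"
  "form_path False True True False True False = -671923"
  "form_path False True True False True True = 17396813"
  "form_path False True True True False False = -9350719"
  "form_path False True True True False True = -424327"
  "form_path False True True True True False = -424327"
  "form_path False True True True True True = 6145649"
  "form_path True False False False False False = -7484575"
  "form_path True False False False False True = -15943375"
  "form_path True False False False True False = -15943375"
  "form_path True False False False True True = -9350719"
  "form_path True False False True False False = 14853125"
  "form_path True False False True False True = -438835"
  "form_path True False False True True False = -438835"
  "form_path True False False True True True = -679339"
  "form_path True False True False False False = -4554775"
  "form_path True False True False False True = 18224345"
  "form_path True False True False True False = -7093015"
  "form_path True False True False True True = -424327"
  "form_path True False True True False False = -438835"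
  "form_path True False True True False True = 10763765"
  "form_path True False True True True False = 480005"
  "form_path True False True True True True = -4427827"
  "form_path True True False False False False = -4554775"
  "form_path True True False False False True = -7093015"
  "form_path True True False False True False = 18224345"
  "form_path True True False False True True = -424327"
  "form_path True True False True False False = -438835"
  "form_path True True False True False True = 480005"
  "form_path True True False True True False = 10763765"
  "form_path True True False True True True = -4427827"
  "form_path True True True False False False = -7442575"
  "form_path True True True False False True = -8116303"
  "form_path True True True False True False = -8116303"
  "form_path True True True False True True = 6145649"
  "form_path True True True True False False = -679339"
  "form_path True True True True False True = -4427827"
  "form_path True True True True True False = -4427827"
  "form_path True True True True True True = 6759365"
  by (simp_all add: form_path_def lin_empty_def bil_edge_def bil_path_def bil_path_anti_def)
text \<open>The triangle term records strictness: all values are integers, so a graph with a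
  triangle on the first three vertices stays at least 1 below the bound. Summed over all tuples,
  this slack bounds the number of triangles.\<close>

lemma split_sum_le:
  "split_sum e01 e02 e03 e04 e12 e13 e14 e23 e24 e34 + of_bool (e01 \<and> e02 \<and> e12) \<le> 38281250"
  unfolding split_sum_def
  by (cases e01; cases e02; cases e03; cases e04; cases e12; cases e13; cases e14; cases e23; cases e24; cases e34;
     simp only: type_form_def form_empty_table form_edge_table form_path_table if_True if_False simp_thms of_bool_eq; simp)

lemma C4_pendant_edge:
  "{i, j} \<in> edge_set C4_pendant \<longleftrightarrow>
     i = 0 \<and> j = 1 \<or> i = 1 \<and> j = 0 \<or> i = 1 \<and> j = 2 \<or> i = 2 \<and> j = 1 \<or> i = 2 \<and> j = 3 \<or> i = 3 \<and> j = 2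
     \<or> i = 3 \<and> j = 0 \<or> i = 0 \<and> j = 3 \<or> i = 0 \<and> j = 4 \<or> i = 4 \<and> j = 0"
  by (auto simp: C4_pendant_def doubleton_eq_iff)

text \<open>The value is \<open>38281250 - 152409600\<close>: the certificate is tight at the graph itself.\<close>

lemma split_sum_C4_pendant:
  fixes p0 p1 p2 p3 p4 :: nat
  assumes "distinct [p0, p1, p2, p3, p4]" and "set [p0, p1, p2, p3, p4] \<subseteq> {0..<5}"
  defines "e \<equiv> \<lambda>i j. {i, j} \<in> edge_set C4_pendant"
  shows "split_sum (e p0 p1) (e p0 p2) (e p0 p3) (e p0 p4) (e p1 p2) (e p1 p3) (e p1 p4) (e p2 p3) (e p2 p4) (e p3 p4)
    = - 114128350 \<and> \<not> (e p0 p1 \<and> e p0 p2 \<and> e p1 p2)"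
proof -
  define Q where "Q p0 p1 p2 p3 p4 \<longleftrightarrow>
    split_sum (e p0 p1) (e p0 p2) (e p0 p3) (e p0 p4) (e p1 p2) (e p1 p3) (e p1 p4) (e p2 p3) (e p2 p4) (e p3 p4)
      = - 114128350 \<and> \<not> (e p0 p1 \<and> e p0 p2 \<and> e p1 p2)" for p0 p1 p2 p3 p4
  have e_eqs: "e 0 1" "\<not> e 0 2" "e 0 3" "e 0 4" "e 1 0" "e 1 2" "\<not> e 1 3" "\<not> e 1 4" "\<not> e 2 0" "e 2 1" "e 2 3" "\<not> e 2 4" "e 3 0" "\<not> e 3 1" "e 3 2" "\<not> e 3 4" "e 4 0" "\<not> e 4 1" "\<not> e 4 2" "\<not> e 4 3"
    by (simp_all add: e_def C4_pendant_edge)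
  \<comment> \<open>The first call expands the quantifiers into the 120 orderings while
    \<open>Q\<close> is still opaque; the second evaluates each of them with the tables.\<close>
  have Q: "\<forall>p0\<in>{0, 1, 2, 3, 4}. \<forall>p1\<in>{0, 1, 2, 3, 4}. p0 \<noteq> p1 \<longrightarrow> (\<forall>p2\<in>{0, 1, 2, 3, 4}. p0 \<noteq> p2 \<and> p1 \<noteq> p2 \<longrightarrow>
    (\<forall>p3\<in>{0, 1, 2, 3, 4}. p0 \<noteq> p3 \<and> p1 \<noteq> p3 \<and> p2 \<noteq> p3 \<longrightarrow>
    (\<forall>p4\<in>{0, 1, 2, 3, 4}. p0 \<noteq> p4 \<and> p1 \<noteq> p4 \<and> p2 \<noteq> p4 \<and> p3 \<noteq> p4 \<longrightarrow> Q p0 p1 p2 p3 p4)))"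
    by (simp del: One_nat_def)
      (simp del: One_nat_def add: Q_def e_eqs split_sum_def type_form_def form_empty_table form_edge_table form_path_table)
  have "set [p0, p1, p2, p3, p4] \<subseteq> {0, 1, 2, 3, 4}" using assms(2) by (auto simp del: One_nat_def)
  with assms(1) have "Q p0 p1 p2 p3 p4" by (intro Q[rule_format]) (simp_all del: One_nat_def)
  then show ?thesis by (simp add: Q_def)
qed

section \<open>Positive semidefiniteness by explicit sums of squares\<close>

lemma bil_edge_nonneg: "bil_edge x0 x1 x2 x3 x4 x0 x1 x2 x3 x4 \<ge> 0"
proof -
  \<comment> \<open>An LDL decomposition with pivots in the order x2, x4, x3, x1, x0; the factor on
    the left clears the denominators.\<close>
  have "65762650823178364 * bil_edge x0 x1 x2 x3 x4 x0 x1 x2 x3 x4 =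
      1091722777724480 * (86742 * x2 - 193374 * x4 + 1726 * x3 - 5625 * x1 - 10353 * x0)\<^sup>2
      + 37417381335 * (787776 * x4 - 13580 * x3 + 284911 * x1 + 257174 * x0)\<^sup>2
      + 2468267705 * (32468 * x3 - 717255 * x1 - 644846 * x0)\<^sup>2
      + 45050940 * (8092681 * x1 - 6460506 * x0)\<^sup>2 + 1183853021455635876400 * x0\<^sup>2"
    by (simp add: bil_edge_def power2_eq_square algebra_simps)
  also have "\<dots> \<ge> 0" by simp
  finally show ?thesis by simp
qed

text \<open>The matrix remains positive semidefinite after 1 is subtracted from two diagonal
  entries. Their coordinates are the degree of the centre and the codegree of the leaves, so the two
  squares kept are the degree and codegree information on which stability rests.\<close>

lemma bil_path_ge: "bil_path x0 x1 x2 x3 x0 x1 x2 x3 \<ge> x0\<^sup>2 + x2\<^sup>2"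
proof -
  have "136286724874185247980 * (bil_path x0 x1 x2 x3 x0 x1 x2 x3 - x0\<^sup>2 - x2\<^sup>2) =
      5268816683280357525 * (27936 * x3 - 4228 * x1 - 4006 * x0 - 23 * x2)\<^sup>2
      + 24715920602 * (56846670 * x1 - 18119130 * x0 - 6960083 * x2)\<^sup>2
      + 1455 * (24715920602 * x0 - 8635013521 * x2)\<^sup>2 + 326720080220829728257462 * x2\<^sup>2"
    by (simp add: bil_path_def power2_eq_square algebra_simps)
  also have "\<dots> \<ge> 0" by simp
  finally show ?thesis by simp
qed

lemma bil_path_anti_nonneg: "bil_path_anti x0 x1 x0 x1 \<ge> 0"
proof -
  have "311 * bil_path_anti x0 x1 x0 x1 = 72 * (13995 * x0 - 10088 * x1)\<^sup>2 + 500069952 * x1\<^sup>2"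
    by (simp add: bil_path_anti_def power2_eq_square algebra_simps)
  also have "\<dots> \<ge> 0" by simp
  finally show ?thesis by simp
qed

text \<open>\<open>w\<close> and \<open>v\<close> range independently, \<open>w = v\<close>
  included, so by bilinearity the double sum is the form at one total vector. Semidefiniteness thus
  applies without a correction for the diagonal.\<close>

lemma sum_bil_edge:
  "(\<Sum>w\<in>V. \<Sum>v\<in>V. bil_edge (f0 w) (f1 w) (f2 w) (f3 w) (f4 w) (f0 v) (f1 v) (f2 v) (f3 v) (f4 v)) =
   bil_edge (sum f0 V) (sum f1 V) (sum f2 V) (sum f3 V) (sum f4 V) (sum f0 V) (sum f1 V) (sum f2 V) (sum f3 V) (sum f4 V)"
  by (simp add: bil_edge_def sum.distrib sum_subtractf sum_negf flip: sum_distrib_left sum_distrib_right)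

lemma sum_bil_path:
  "(\<Sum>w\<in>V. \<Sum>v\<in>V. bil_path (f0 w) (f1 w) (f2 w) (f3 w) (f0 v) (f1 v) (f2 v) (f3 v)) =
   bil_path (sum f0 V) (sum f1 V) (sum f2 V) (sum f3 V) (sum f0 V) (sum f1 V) (sum f2 V) (sum f3 V)"
  by (simp add: bil_path_def sum.distrib sum_subtractf sum_negf flip: sum_distrib_left sum_distrib_right)

lemma sum_bil_path_anti:
  "(\<Sum>w\<in>V. \<Sum>v\<in>V. bil_path_anti (f0 w) (f1 w) (f0 v) (f1 v)) = bil_path_anti (sum f0 V) (sum f1 V) (sum f0 V) (sum f1 V)"
  by (simp add: bil_path_anti_def sum.distrib sum_subtractf flip: sum_distrib_left sum_distrib_right)

lemma sum_form_empty_nonneg: "(\<Sum>w\<in>V. \<Sum>v\<in>V. form_empty (a w) (b w) (c w) (a v) (b v) (c v)) \<ge> 0"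
proof -
  have "(\<Sum>w\<in>V. \<Sum>v\<in>V. form_empty (a w) (b w) (c w) (a v) (b v) (c v)) = 125 * (\<Sum>w\<in>V. lin_empty (a w) (b w) (c w))\<^sup>2"
    by (simp add: form_empty_def power2_eq_square sum_product mult.assoc flip: sum_distrib_left)
  then show ?thesis by simp
qed

lemma sum_form_edge_nonneg: "(\<Sum>w\<in>V. \<Sum>v\<in>V. form_edge (a w) (b w) (c w) (a v) (b v) (c v)) \<ge> 0"
  unfolding form_edge_def sum_bil_edge by (rule bil_edge_nonneg)

lemma sum_form_path_ge:
  "(\<Sum>w\<in>V. \<Sum>v\<in>V. form_path (a w) (b w) (c w) (a v) (b v) (c v)) \<ge>
     (\<Sum>w\<in>V. 12 * of_bool (a w) - 5)\<^sup>2 + (\<Sum>w\<in>V. 72 * of_bool (b w \<and> c w) - 25)\<^sup>2"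
  unfolding form_path_def sum.distrib sum_bil_path sum_bil_path_anti
  by (rule order.trans[OF bil_path_ge add_increasing2[OF bil_path_anti_nonneg order.refl]])

lemma sum_type_form_nonneg:
  "(\<Sum>w\<in>V. \<Sum>v\<in>V. type_form a b c (f w) (g w) (h w) (f v) (g v) (h v)) \<ge> 0"
proof -
  have P: "(\<Sum>w\<in>V. \<Sum>v\<in>V. form_path (f w) (g w) (h w) (f v) (g v) (h v)) \<ge> 0" for f g h
    by (rule order.trans[OF _ sum_form_path_ge]) simp
  show ?thesis
    unfolding type_form_def by (cases a; cases b; cases c; simp add: P sum_form_edge_nonneg sum_form_empty_nonneg)
qed

section \<open>Averaging over ordered 5-tuples\<close>

lemma sum5_permute:
  fixes h :: "'a \<Rightarrow> 'a \<Rightarrow> 'a \<Rightarrow> 'a \<Rightarrow> 'a \<Rightarrow> int"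
  shows "(\<Sum>x\<in>V. \<Sum>y\<in>V. \<Sum>z\<in>V. \<Sum>w\<in>V. \<Sum>v\<in>V. h y x z w v) = (\<Sum>x\<in>V. \<Sum>y\<in>V. \<Sum>z\<in>V. \<Sum>w\<in>V. \<Sum>v\<in>V. h x y z w v)"
    "(\<Sum>x\<in>V. \<Sum>y\<in>V. \<Sum>z\<in>V. \<Sum>w\<in>V. \<Sum>v\<in>V. h x z y w v) = (\<Sum>x\<in>V. \<Sum>y\<in>V. \<Sum>z\<in>V. \<Sum>w\<in>V. \<Sum>v\<in>V. h x y z w v)"
    "(\<Sum>x\<in>V. \<Sum>y\<in>V. \<Sum>z\<in>V. \<Sum>w\<in>V. \<Sum>v\<in>V. h x y w z v) = (\<Sum>x\<in>V. \<Sum>y\<in>V. \<Sum>z\<in>V. \<Sum>w\<in>V. \<Sum>v\<in>V. h x y z w v)"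
    "(\<Sum>x\<in>V. \<Sum>y\<in>V. \<Sum>z\<in>V. \<Sum>w\<in>V. \<Sum>v\<in>V. h x y z v w) = (\<Sum>x\<in>V. \<Sum>y\<in>V. \<Sum>z\<in>V. \<Sum>w\<in>V. \<Sum>v\<in>V. h x y z w v)"
proof -
  note sw = sum.swap[where A = V and B = V]
  show "(\<Sum>x\<in>V. \<Sum>y\<in>V. \<Sum>z\<in>V. \<Sum>w\<in>V. \<Sum>v\<in>V. h y x z w v) = (\<Sum>x\<in>V. \<Sum>y\<in>V. \<Sum>z\<in>V. \<Sum>w\<in>V. \<Sum>v\<in>V. h x y z w v)"
    by (rule sw)
  show "(\<Sum>x\<in>V. \<Sum>y\<in>V. \<Sum>z\<in>V. \<Sum>w\<in>V. \<Sum>v\<in>V. h x z y w v) = (\<Sum>x\<in>V. \<Sum>y\<in>V. \<Sum>z\<in>V. \<Sum>w\<in>V. \<Sum>v\<in>V. h x y z w v)"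
    by (rule sum.cong[OF refl], rule sw)
  show "(\<Sum>x\<in>V. \<Sum>y\<in>V. \<Sum>z\<in>V. \<Sum>w\<in>V. \<Sum>v\<in>V. h x y w z v) = (\<Sum>x\<in>V. \<Sum>y\<in>V. \<Sum>z\<in>V. \<Sum>w\<in>V. \<Sum>v\<in>V. h x y z w v)"
    by (rule sum.cong[OF refl], rule sum.cong[OF refl], rule sw)
  show "(\<Sum>x\<in>V. \<Sum>y\<in>V. \<Sum>z\<in>V. \<Sum>w\<in>V. \<Sum>v\<in>V. h x y z v w) = (\<Sum>x\<in>V. \<Sum>y\<in>V. \<Sum>z\<in>V. \<Sum>w\<in>V. \<Sum>v\<in>V. h x y z w v)"
    by (rule sum.cong[OF refl], rule sum.cong[OF refl], rule sum.cong[OF refl], rule sw)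
qed

text \<open>The ten summands are one function of a triple and a pair with the five names permuted.
  All names range over \<open>V\<close>, so adjacent transpositions bring each summand back to the
  standard order.\<close>

lemma sum_split_sum:
  fixes A :: "'a \<Rightarrow> 'a \<Rightarrow> bool"
  assumes sym: "\<And>x y. A x y \<longleftrightarrow> A y x"
  shows "(\<Sum>x\<in>V. \<Sum>y\<in>V. \<Sum>z\<in>V. \<Sum>w\<in>V. \<Sum>v\<in>V.
      split_sum (A x y) (A x z) (A x w) (A x v) (A y z) (A y w) (A y v) (A z w) (A z v) (A w v)) =
    10 * (\<Sum>x\<in>V. \<Sum>y\<in>V. \<Sum>z\<in>V. \<Sum>w\<in>V. \<Sum>v\<in>V.
      type_form (A x y) (A x z) (A y z) (A w x) (A w y) (A w z) (A v x) (A v y) (A v z))"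
    (is "_ = 10 * ?R")
proof -
  define f where "f x y z w v = type_form (A x y) (A x z) (A y z) (A w x) (A w y) (A w z) (A v x) (A v y) (A v z)" for x y z w v
  let ?S = "\<lambda>h. \<Sum>x\<in>V. \<Sum>y\<in>V. \<Sum>z\<in>V. \<Sum>w\<in>V. \<Sum>v\<in>V. (h x y z w v :: int)"
  have e: "split_sum (A x y) (A x z) (A x w) (A x v) (A y z) (A y w) (A y v) (A z w) (A z v) (A w v) =
     f x y z w v + f x y w z v + f x y v z w + f x z w y v + f x z v y w + f x w v y z +
     f y z w x v + f y z v x w + f y w v x z + f z w v x y" for x y z w v
    unfolding split_sum_def f_def
    by (simp only: sym[of y x] sym[of z x] sym[of w x] sym[of v x] sym[of z y] sym[of w y] sym[of v y]
       sym[of w z] sym[of v z] sym[of v w])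
  have 1: "?S (\<lambda>x y z w v. f x y w z v) = ?S f" by (rule sum5_permute(3))
  have 2: "?S (\<lambda>x y z w v. f x y v z w) = ?S f"
    using sum5_permute(4)[of "\<lambda>x y z w v. f x y w z v" V] 1 by simp
  have 3: "?S (\<lambda>x y z w v. f x z w y v) = ?S f"
    using sum5_permute(2)[of "\<lambda>x y z w v. f x y w z v" V] 1 by simp
  have 4: "?S (\<lambda>x y z w v. f x z v y w) = ?S f"
    using sum5_permute(2)[of "\<lambda>x y z w v. f x y v z w" V] 2 by simp
  have 5: "?S (\<lambda>x y z w v. f x w v y z) = ?S f"
    using sum5_permute(3)[of "\<lambda>x y z w v. f x z v y w" V] 4 by simp
  have 6: "?S (\<lambda>x y z w v. f y z w x v) = ?S f"
    using sum5_permute(1)[of "\<lambda>x y z w v. f x z w y v" V] 3 by simp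
  have 7: "?S (\<lambda>x y z w v. f y z v x w) = ?S f"
    using sum5_permute(1)[of "\<lambda>x y z w v. f x z v y w" V] 4 by simp
  have 8: "?S (\<lambda>x y z w v. f y w v x z) = ?S f"
    using sum5_permute(1)[of "\<lambda>x y z w v. f x w v y z" V] 5 by simp
  have 9: "?S (\<lambda>x y z w v. f z w v x y) = ?S f"
    using sum5_permute(2)[of "\<lambda>x y z w v. f y w v x z" V] 8 by simp
  have "?S (\<lambda>x y z w v. split_sum (A x y) (A x z) (A x w) (A x v) (A y z) (A y w) (A y v) (A z w) (A z v) (A w v)) = 10 * ?S f"
    unfolding e by (simp only: sum.distrib 1 2 3 4 5 6 7 8 9)
  then show ?thesis by (simp add: f_def)
qed

section \<open>The inequality for finite graphs\<close>

text \<open>Tuples with repeated vertices are included: they also induce a pattern on five indices.\<close>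

lemma certificate_sum:
  fixes A :: "'a \<Rightarrow> 'a \<Rightarrow> bool"
  assumes sym: "\<And>x y. A x y \<longleftrightarrow> A y x" and fin: "finite V"
    and B: "\<And>x y z w v. B x y z w v \<Longrightarrow> split_sum (A x y) (A x z) (A x w) (A x v) (A y z) (A y w) (A y v) (A z w) (A z v) (A w v)
         = - 114128350 \<and> \<not> (A x y \<and> A x z \<and> A y z)"
  shows "10 * (\<Sum>x\<in>V. \<Sum>y\<in>V. \<Sum>z\<in>V. of_bool (A x y \<and> A x z \<and> \<not> A y z) *
      ((\<Sum>w\<in>V. 12 * of_bool (A w x) - 5)\<^sup>2 + (\<Sum>w\<in>V. 72 * of_bool (A w y \<and> A w z) - 25)\<^sup>2))
    + (\<Sum>x\<in>V. \<Sum>y\<in>V. \<Sum>z\<in>V. of_bool (A x y \<and> A x z \<and> A y z)) * int (card V) ^ 2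
    + 152409600 * (\<Sum>x\<in>V. \<Sum>y\<in>V. \<Sum>z\<in>V. \<Sum>w\<in>V. \<Sum>v\<in>V. of_bool (B x y z w v)) \<le> 38281250 * int (card V) ^ 5"
    (is "10 * ?P + ?T * _ + _ * ?B \<le> _")
proof -
  define h where "h x y z w v = split_sum (A x y) (A x z) (A x w) (A x v) (A y z) (A y w) (A y v) (A z w) (A z v) (A w v)" for x y z w v
  let ?S = "\<lambda>h. \<Sum>x\<in>V. \<Sum>y\<in>V. \<Sum>z\<in>V. \<Sum>w\<in>V. \<Sum>v\<in>V. (h x y z w v :: int)"
  have "h x y z w v + of_bool (A x y \<and> A x z \<and> A y z) + 152409600 * of_bool (B x y z w v) \<le> 38281250" for x y z w v
    using split_sum_le[of "A x y" "A x z" "A x w" "A x v" "A y z" "A y w" "A y v" "A z w" "A z v" "A w v"] B[of x y z w v]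
    by (cases "B x y z w v") (auto simp: h_def)
  then have "?S (\<lambda>x y z w v. h x y z w v + of_bool (A x y \<and> A x z \<and> A y z) + 152409600 * of_bool (B x y z w v))
      \<le> ?S (\<lambda>x y z w v. 38281250)"
    by (intro sum_mono)
  then have "?S h + ?S (\<lambda>x y z w v. of_bool (A x y \<and> A x z \<and> A y z)) + 152409600 * ?B \<le> ?S (\<lambda>x y z w v. 38281250)"
    by (simp only: sum.distrib sum_distrib_left)
  moreover have "?S (\<lambda>x y z w v. of_bool (A x y \<and> A x z \<and> A y z)) = ?T * int (card V) ^ 2"
    by (simp add: sum_distrib_right power2_eq_square mult.commute[of "of_bool _"] mult.assoc)
  moreover have "?S (\<lambda>x y z w v. 38281250) = 38281250 * int (card V) ^ 5"
    by (simp add: eval_nat_numeral)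
  moreover have "10 * ?P \<le> ?S h"
    unfolding h_def sum_split_sum[OF sym]
  proof (intro mult_left_mono sum_mono)
    fix x y z assume "x \<in> V" "y \<in> V" "z \<in> V"
    show "of_bool (A x y \<and> A x z \<and> \<not> A y z) *
      ((\<Sum>w\<in>V. 12 * of_bool (A w x) - 5)\<^sup>2 + (\<Sum>w\<in>V. 72 * of_bool (A w y \<and> A w z) - 25)\<^sup>2) \<le>
      (\<Sum>w\<in>V. \<Sum>v\<in>V. type_form (A x y) (A x z) (A y z) (A w x) (A w y) (A w z) (A v x) (A v y) (A v z))"
    proof (cases "A x y \<and> A x z \<and> \<not> A y z")
      case True
      then show ?thesis
        using sum_form_path_ge[of "\<lambda>w. A w x" V "\<lambda>w. A w y" "\<lambda>w. A w z"] by (simp add: type_form_def)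
    qed (auto simp: sum_type_form_nonneg)
  qed simp
  ultimately show ?thesis by linarith
qed

section \<open>Degrees, codegrees and copies in a graph\<close>

abbreviation adj :: "'a graph \<Rightarrow> 'a \<Rightarrow> 'a \<Rightarrow> bool" where
  "adj G u v \<equiv> {u, v} \<in> edge_set G"

definition deg :: "'a graph \<Rightarrow> 'a \<Rightarrow> real" where
  "deg G x = (\<Sum>w\<in>vertex_set G. of_bool (adj G w x))"

definition codeg :: "'a graph \<Rightarrow> 'a \<Rightarrow> 'a \<Rightarrow> real" where
  "codeg G x y = (\<Sum>w\<in>vertex_set G. of_bool (adj G w x \<and> adj G w y))"

lemma length_5: "length xs = 5 \<Longrightarrow> xs = [xs ! 0, xs ! 1, xs ! 2, xs ! 3, xs ! 4]"
  by (rule nth_equalityI) (auto simp: less_Suc_eq eval_nat_numeral)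

text \<open>Each 5-set yields 5! = 120 orderings, and an ordering determines its set. This passes
  from the subsets counted by the induced density to the tuples summed by the certificate.\<close>

lemma card_copies_le:
  fixes G :: "'a graph"
  assumes "simple_graph G"
  defines "V \<equiv> vertex_set G"
  shows "120 * int (card {S. S \<subseteq> V \<and> card S = 5 \<and> P S}) \<le>
    (\<Sum>x\<in>V. \<Sum>y\<in>V. \<Sum>z\<in>V. \<Sum>w\<in>V. \<Sum>v\<in>V. of_bool (distinct [x, y, z, w, v] \<and> P (set [x, y, z, w, v])))"
proof -
  have fin: "finite V" using assms by (simp add: simple_graph_def)
  let ?C = "{S. S \<subseteq> V \<and> card S = 5 \<and> P S}"
  let ?T = "{(x, y, z, w, v). x \<in> V \<and> y \<in> V \<and> z \<in> V \<and> w \<in> V \<and> v \<in> V \<and> distinct [x, y, z, w, v] \<and> P (set [x, y, z, w, v])}"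
  have finC: "finite ?C" using fin by simp
  have fS: "finite S" if "S \<in> ?C" for S using that fin finite_subset by blast
  have "card (\<Union>S\<in>?C. permutations_of_set S) = (\<Sum>S\<in>?C. card (permutations_of_set S))"
    by (rule card_UN_disjoint[OF finC]) (auto dest: permutations_of_setD)
  also have "\<dots> = (\<Sum>S\<in>?C. 120)"
  proof (rule sum.cong[OF refl])
    fix S assume S: "S \<in> ?C"
    have "(fact 5 :: nat) = 120" by (simp add: fact_numeral)
    with S fS[OF S] show "card (permutations_of_set S) = 120" by simp
  qed
  finally have "120 * card ?C = card (\<Union>S\<in>?C. permutations_of_set S)" by simp
  also have "\<dots> \<le> card ?T"
  proof (rule card_inj_on_le[where f = "\<lambda>xs. (xs ! 0, xs ! 1, xs ! 2, xs ! 3, xs ! 4)"])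
    have L: "xs = [xs ! 0, xs ! 1, xs ! 2, xs ! 3, xs ! 4]" "distinct xs" "set xs \<subseteq> V" "P (set xs)"
      if xs: "xs \<in> (\<Union>S\<in>?C. permutations_of_set S)" for xs
    proof -
      from xs obtain S where S: "S \<in> ?C" "xs \<in> permutations_of_set S" by blast
      then show "distinct xs" "set xs \<subseteq> V" "P (set xs)" by (auto dest: permutations_of_setD)
      from S have "length xs = 5" using distinct_card[of xs] by (simp add: permutations_of_set_def)
      then show "xs = [xs ! 0, xs ! 1, xs ! 2, xs ! 3, xs ! 4]" by (rule length_5)
    qed
    show "inj_on (\<lambda>xs. (xs ! 0, xs ! 1, xs ! 2, xs ! 3, xs ! 4)) (\<Union>S\<in>?C. permutations_of_set S)"
    proof (rule inj_onI)
      fix xs ys assume xs: "xs \<in> (\<Union>S\<in>?C. permutations_of_set S)" "ys \<in> (\<Union>S\<in>?C. permutations_of_set S)"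
        and eq: "(xs ! 0, xs ! 1, xs ! 2, xs ! 3, xs ! 4) = (ys ! 0, ys ! 1, ys ! 2, ys ! 3, ys ! 4)"
      show "xs = ys" by (subst L(1)[OF xs(1)], subst L(1)[OF xs(2)]) (use eq in simp)
    qed
    show "(\<lambda>xs. (xs ! 0, xs ! 1, xs ! 2, xs ! 3, xs ! 4)) ` (\<Union>S\<in>?C. permutations_of_set S) \<subseteq> ?T"
    proof (rule image_subsetI)
      fix xs assume xs: "xs \<in> (\<Union>S\<in>?C. permutations_of_set S)"
      define a b c d e where "a = xs ! 0" and "b = xs ! 1" and "c = xs ! 2" and "d = xs ! 3" and "e = xs ! 4"
      then have "xs = [a, b, c, d, e]" using L(1)[OF xs] by (simp only:)
      then have "distinct [a, b, c, d, e]" "set [a, b, c, d, e] \<subseteq> V" "P (set [a, b, c, d, e])"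
        using L(2-4)[OF xs] by simp_all
      then have "(a, b, c, d, e) \<in> ?T" by simp
      then show "(xs ! 0, xs ! 1, xs ! 2, xs ! 3, xs ! 4) \<in> ?T" by (simp only: a_def b_def c_def d_def e_def)
    qed
    show "finite ?T" by (rule finite_subset[of _ "V \<times> V \<times> V \<times> V \<times> V"]) (use fin in auto)
  qed
  also have "int (card ?T) = (\<Sum>t\<in>V \<times> V \<times> V \<times> V \<times> V. of_bool (t \<in> ?T))"
    using fin by (simp add: of_bool_def sum.If_cases) (intro arg_cong[where f = card]; auto)
  also have "\<dots> = (\<Sum>x\<in>V. \<Sum>y\<in>V. \<Sum>z\<in>V. \<Sum>w\<in>V. \<Sum>v\<in>V. of_bool (distinct [x, y, z, w, v] \<and> P (set [x, y, z, w, v])))"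
    by (simp add: sum.cartesian_product' case_prod_unfold)
  finally show ?thesis by (simp add: of_nat_mult flip: of_nat_le_iff)
qed

abbreviation copies :: "'a graph \<Rightarrow> nat" where
  "copies G \<equiv> card {S. S \<subseteq> vertex_set G \<and> card S = num_verts C4_pendant \<and> isomorphic (induced G S) C4_pendant}"

definition triangles :: "'a graph \<Rightarrow> real" where
  "triangles G = (\<Sum>x\<in>vertex_set G. \<Sum>y\<in>vertex_set G. \<Sum>z\<in>vertex_set G. of_bool (adj G x y \<and> adj G x z \<and> adj G y z))"

text \<open>The slack of the certificate. A copy is counted by 120 tuples, hence 18289152000 = 120 *
  152409600; and 38281250 / 152409600 = 15625/62208, so for growing orders \<open>defect\<close> is
  o(n^5) exactly when the density of F tends to this value.\<close>

definition defect :: "'a graph \<Rightarrow> real" where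
  "defect G = 38281250 * real (num_verts G) ^ 5 - 18289152000 * real (copies G)"

lemma adj_commute: "adj G x y \<longleftrightarrow> adj G y x"
  by (simp add: insert_commute)

lemma isomorphic_induced_C4_pendantE:
  assumes "isomorphic (induced G S) C4_pendant"
  obtains f where "bij_betw f S {0..<5}"
    and "\<forall>a\<in>S. \<forall>b\<in>S. adj G a b \<longleftrightarrow> {f a, f b} \<in> edge_set C4_pendant"
proof -
  from assms obtain f where f: "bij_betw f (vertex_set (induced G S)) (vertex_set C4_pendant)"
    and *: "\<forall>a\<in>vertex_set (induced G S). \<forall>b\<in>vertex_set (induced G S).
      {a, b} \<in> edge_set (induced G S) \<longleftrightarrow> {f a, f b} \<in> edge_set C4_pendant"
    unfolding isomorphic_def by blast
  show thesis
  proof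
    show "bij_betw f S {0..<5}" using f unfolding induced_def fst_conv C4_pendant_def by simp
    show "\<forall>a\<in>S. \<forall>b\<in>S. adj G a b \<longleftrightarrow> {f a, f b} \<in> edge_set C4_pendant"
      using * unfolding induced_def fst_conv snd_conv by blast
  qed
qed

lemma split_sum_copy:
  assumes "distinct [x, y, z, w, v]" and "isomorphic (induced G (set [x, y, z, w, v])) C4_pendant"
  shows "split_sum (adj G x y) (adj G x z) (adj G x w) (adj G x v) (adj G y z) (adj G y w) (adj G y v) (adj G z w) (adj G z v) (adj G w v)
         = - 114128350 \<and> \<not> (adj G x y \<and> adj G x z \<and> adj G y z)"
proof -
  let ?S = "set [x, y, z, w, v]"
  obtain f where f: "bij_betw f ?S {0..<5}"
    and iso: "\<forall>a\<in>?S. \<forall>b\<in>?S. adj G a b \<longleftrightarrow> {f a, f b} \<in> edge_set C4_pendant"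
    by (rule isomorphic_induced_C4_pendantE[OF assms(2)])
  have "distinct (map f [x, y, z, w, v])" "set (map f [x, y, z, w, v]) \<subseteq> {0..<5}"
    using f assms(1) by (simp_all only: distinct_map bij_betw_def set_map simp_thms order.refl)
  then have "split_sum ({f x, f y} \<in> edge_set C4_pendant) ({f x, f z} \<in> edge_set C4_pendant) ({f x, f w} \<in> edge_set C4_pendant)
      ({f x, f v} \<in> edge_set C4_pendant) ({f y, f z} \<in> edge_set C4_pendant) ({f y, f w} \<in> edge_set C4_pendant)
      ({f y, f v} \<in> edge_set C4_pendant) ({f z, f w} \<in> edge_set C4_pendant) ({f z, f v} \<in> edge_set C4_pendant)
      ({f w, f v} \<in> edge_set C4_pendant) = - 114128350 \<and>
      \<not> ({f x, f y} \<in> edge_set C4_pendant \<and> {f x, f z} \<in> edge_set C4_pendant \<and> {f y, f z} \<in> edge_set C4_pendant)"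
    unfolding list.map by (rule split_sum_C4_pendant)
  moreover have "adj G x y \<longleftrightarrow> {f x, f y} \<in> edge_set C4_pendant" "adj G x z \<longleftrightarrow> {f x, f z} \<in> edge_set C4_pendant"
    "adj G x w \<longleftrightarrow> {f x, f w} \<in> edge_set C4_pendant" "adj G x v \<longleftrightarrow> {f x, f v} \<in> edge_set C4_pendant"
    "adj G y z \<longleftrightarrow> {f y, f z} \<in> edge_set C4_pendant" "adj G y w \<longleftrightarrow> {f y, f w} \<in> edge_set C4_pendant"
    "adj G y v \<longleftrightarrow> {f y, f v} \<in> edge_set C4_pendant" "adj G z w \<longleftrightarrow> {f z, f w} \<in> edge_set C4_pendant"
    "adj G z v \<longleftrightarrow> {f z, f v} \<in> edge_set C4_pendant" "adj G w v \<longleftrightarrow> {f w, f v} \<in> edge_set C4_pendant"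
    by (rule iso[rule_format]; simp)+
  ultimately show ?thesis by (simp only: simp_thms)
qed

lemma sum_of_bool_bounds: "0 \<le> (\<Sum>x\<in>A. of_bool (P x) :: real)" "(\<Sum>x\<in>A. of_bool (P x)) \<le> real (card A)"
  using sum_bounded_above[of A "\<lambda>x. of_bool (P x) :: real" 1] by (auto intro: sum_nonneg)

lemma triangles_nonneg: "triangles G \<ge> 0"
  unfolding triangles_def by (intro sum_nonneg) simp

text \<open>The certificate controls the deviations on induced paths only. The missing pairs of
  adjacent neighbours \<open>y\<close>, \<open>z\<close> of \<open>x\<close> form triangles, and the
  triangle term pays for them. Once all pairs of neighbours are allowed, the sums factor: deg^2
  counts the pairs of leaves at a centre, codeg counts the centres of a pair of leaves.\<close>

lemma defect_ge:
  assumes G: "simple_graph G"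
  shows "real (num_verts G) ^ 2 * triangles G \<le> defect G"
    and "(\<Sum>x\<in>vertex_set G. deg G x ^ 2 * (12 * deg G x - 5 * real (num_verts G)) ^ 2) +
      (\<Sum>y\<in>vertex_set G. \<Sum>z\<in>vertex_set G. codeg G y z * (72 * codeg G y z - 25 * real (num_verts G)) ^ 2)
      \<le> 2259 * defect G"
proof -
  define V where "V = vertex_set G"
  define n where "n = real (num_verts G)"
  have fin: "finite V" using G by (simp add: simple_graph_def V_def)
  let ?d = "deg G" and ?c = "codeg G" and ?A = "adj G"
  define g where "g x y z = (12 * ?d x - 5 * n)\<^sup>2 + (72 * ?c y z - 25 * n)\<^sup>2" for x y z
  define P where "P = (\<Sum>x\<in>V. \<Sum>y\<in>V. \<Sum>z\<in>V. of_bool (?A x y \<and> ?A x z \<and> \<not> ?A y z) * g x y z)"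
  have deg: "of_int (\<Sum>w\<in>V. 12 * of_bool (?A w x) - 5) = 12 * ?d x - 5 * n" for x
    by (simp add: deg_def codeg_def V_def n_def sum_subtractf sum_distrib_left)
  have codeg: "of_int (\<Sum>w\<in>V. 72 * of_bool (?A w y \<and> ?A w z) - 25) = 72 * ?c y z - 25 * n" for y z
    by (simp add: deg_def codeg_def V_def n_def sum_subtractf sum_distrib_left)
  let ?B = "\<lambda>x y z w v. distinct [x, y, z, w, v] \<and> isomorphic (induced G (set [x, y, z, w, v])) C4_pendant"
  define Pi where "Pi = (\<Sum>x\<in>V. \<Sum>y\<in>V. \<Sum>z\<in>V. of_bool (?A x y \<and> ?A x z \<and> \<not> ?A y z) *
      ((\<Sum>w\<in>V. 12 * of_bool (?A w x) - 5)\<^sup>2 + (\<Sum>w\<in>V. 72 * of_bool (?A w y \<and> ?A w z) - 25)\<^sup>2) :: int)"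
  define Ti where "Ti = (\<Sum>x\<in>V. \<Sum>y\<in>V. \<Sum>z\<in>V. of_bool (?A x y \<and> ?A x z \<and> ?A y z) :: int)"
  define Bi where "Bi = (\<Sum>x\<in>V. \<Sum>y\<in>V. \<Sum>z\<in>V. \<Sum>w\<in>V. \<Sum>v\<in>V. of_bool (?B x y z w v) :: int)"
  have "120 * int (copies G) \<le> Bi"
    using card_copies_le[OF G, of "\<lambda>S. isomorphic (induced G S) C4_pendant"] by (simp add: V_def Bi_def C4_pendant_def)
  moreover have "10 * Pi + Ti * int (card V) ^ 2 + 152409600 * Bi \<le> 38281250 * int (card V) ^ 5"
    unfolding Pi_def Ti_def Bi_def by (rule certificate_sum[OF adj_commute fin split_sum_copy]; blast)
  ultimately have "10 * Pi + Ti * int (card V) ^ 2 + 18289152000 * int (copies G) \<le> 38281250 * int (card V) ^ 5"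
    by linarith
  then have "real_of_int (10 * Pi + Ti * int (card V) ^ 2 + 18289152000 * int (copies G))
      \<le> real_of_int (38281250 * int (card V) ^ 5)" by (simp only: of_int_le_iff)
  moreover have "real_of_int Pi = P"
    unfolding Pi_def P_def g_def of_int_sum[of _ V] of_int_mult of_int_add of_int_power of_int_of_bool
      deg[unfolded of_int_sum] codeg[unfolded of_int_sum] ..
  moreover have "real_of_int Ti = triangles G"
    unfolding Ti_def triangles_def V_def of_int_sum of_int_of_bool ..
  ultimately have main: "10 * P + n\<^sup>2 * triangles G \<le> defect G"
    by (simp add: defect_def n_def V_def mult.commute)
  have P0: "P \<ge> 0" unfolding P_def g_def by (intro sum_nonneg) simp
  with main show T: "real (num_verts G) ^ 2 * triangles G \<le> defect G" by (simp add: n_def)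
  \<comment> \<open>2258 = 7^2 + 47^2 comes from the largest possible values of |12 deg - 5n| and
    |72 codeg - 25n|. One further defect accounts for the induced paths, which gives 2259.\<close>
  have g: "g x y z \<le> 2258 * n\<^sup>2" for x y z
  proof -
    have "\<bar>12 * ?d x - 5 * n\<bar> \<le> 7 * n" using sum_of_bool_bounds[of "\<lambda>w. ?A w x" "vertex_set G"] by (simp add: deg_def n_def abs_le_iff)
    from power_mono[OF this abs_ge_zero, of 2] have 1: "(12 * ?d x - 5 * n)\<^sup>2 \<le> (7 * n)\<^sup>2" by (simp only: power2_abs)
    have "\<bar>72 * ?c y z - 25 * n\<bar> \<le> 47 * n" using sum_of_bool_bounds[of "\<lambda>w. ?A w y \<and> ?A w z" "vertex_set G"] by (simp add: codeg_def n_def abs_le_iff)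
    from power_mono[OF this abs_ge_zero, of 2] have "(72 * ?c y z - 25 * n)\<^sup>2 \<le> (47 * n)\<^sup>2" by (simp only: power2_abs)
    with 1 show ?thesis by (simp add: g_def power_mult_distrib)
  qed
  have "(\<Sum>x\<in>V. \<Sum>y\<in>V. \<Sum>z\<in>V. of_bool (?A x y \<and> ?A x z) * g x y z) \<le>
      (\<Sum>x\<in>V. \<Sum>y\<in>V. \<Sum>z\<in>V. of_bool (?A x y \<and> ?A x z \<and> \<not> ?A y z) * g x y z
        + 2258 * n\<^sup>2 * of_bool (?A x y \<and> ?A x z \<and> ?A y z))"
    by (intro sum_mono) (use g in auto)
  also have "\<dots> = P + 2258 * n\<^sup>2 * triangles G"
    by (simp only: sum.distrib P_def triangles_def V_def sum_distrib_left)
  also have "\<dots> \<le> 2259 * defect G"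
  proof -
    have "0 \<le> n\<^sup>2 * triangles G" using triangles_nonneg[of G] by simp
    with main P0 show ?thesis unfolding mult.assoc by linarith
  qed
  finally have "(\<Sum>x\<in>V. \<Sum>y\<in>V. \<Sum>z\<in>V. of_bool (?A x y \<and> ?A x z) * g x y z) \<le> 2259 * defect G" .
  moreover have "(\<Sum>x\<in>V. \<Sum>y\<in>V. \<Sum>z\<in>V. of_bool (?A x y \<and> ?A x z) * g x y z) =
     (\<Sum>x\<in>V. ?d x ^ 2 * (12 * ?d x - 5 * n)\<^sup>2) + (\<Sum>y\<in>V. \<Sum>z\<in>V. ?c y z * (72 * ?c y z - 25 * n)\<^sup>2)"
  proof -
    have "(\<Sum>x\<in>V. \<Sum>y\<in>V. \<Sum>z\<in>V. of_bool (?A x y \<and> ?A x z) * g x y z) =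
       (\<Sum>x\<in>V. \<Sum>y\<in>V. \<Sum>z\<in>V. of_bool (?A x y \<and> ?A x z) * (12 * ?d x - 5 * n)\<^sup>2) +
       (\<Sum>x\<in>V. \<Sum>y\<in>V. \<Sum>z\<in>V. of_bool (?A x y \<and> ?A x z) * (72 * ?c y z - 25 * n)\<^sup>2)"
      by (simp only: g_def distrib_left sum.distrib)
    also have "(\<Sum>x\<in>V. \<Sum>y\<in>V. \<Sum>z\<in>V. of_bool (?A x y \<and> ?A x z) * (12 * ?d x - 5 * n)\<^sup>2) =
       (\<Sum>x\<in>V. ?d x ^ 2 * (12 * ?d x - 5 * n)\<^sup>2)"
    proof (rule sum.cong[OF refl])
      fix x
      have "(\<Sum>y\<in>V. \<Sum>z\<in>V. of_bool (?A x y \<and> ?A x z) * (12 * ?d x - 5 * n)\<^sup>2) =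
          (\<Sum>y\<in>V. \<Sum>z\<in>V. of_bool (?A y x) * of_bool (?A z x)) * (12 * ?d x - 5 * n)\<^sup>2"
        by (simp only: sum_distrib_right of_bool_conj insert_commute[of x])
      then show "(\<Sum>y\<in>V. \<Sum>z\<in>V. of_bool (?A x y \<and> ?A x z) * (12 * ?d x - 5 * n)\<^sup>2) = ?d x ^ 2 * (12 * ?d x - 5 * n)\<^sup>2"
        by (simp only: deg_def power2_eq_square[of "sum _ _"] sum_product V_def)
    qed
    also have "(\<Sum>x\<in>V. \<Sum>y\<in>V. \<Sum>z\<in>V. of_bool (?A x y \<and> ?A x z) * (72 * ?c y z - 25 * n)\<^sup>2) =
       (\<Sum>y\<in>V. \<Sum>z\<in>V. \<Sum>x\<in>V. of_bool (?A x y \<and> ?A x z) * (72 * ?c y z - 25 * n)\<^sup>2)"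
      by (rule trans[OF sum.swap sum.cong[OF refl sum.swap]])
    also have "\<dots> = (\<Sum>y\<in>V. \<Sum>z\<in>V. ?c y z * (72 * ?c y z - 25 * n)\<^sup>2)"
      by (simp only: codeg_def[of G] V_def sum_distrib_right)
    finally show ?thesis .
  qed
  ultimately show "(\<Sum>x\<in>vertex_set G. deg G x ^ 2 * (12 * deg G x - 5 * real (num_verts G)) ^ 2) +
      (\<Sum>y\<in>vertex_set G. \<Sum>z\<in>vertex_set G. codeg G y z * (72 * codeg G y z - 25 * real (num_verts G)) ^ 2)
      \<le> 2259 * defect G"
    by (simp add: V_def n_def)
qed

section \<open>The value of the inducibility\<close>

lemma binomial_over_power_tendsto:
  assumes "(\<lambda>n. real (f n) / real n) \<longlonglongrightarrow> a"
  shows "(\<lambda>n. real (f n choose k) / real n ^ k) \<longlonglongrightarrow> a ^ k / fact k"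
proof -
  have "(\<lambda>n. (\<Prod>i<k. real (f n) / real n - real i / real n) / fact k) \<longlonglongrightarrow> (\<Prod>i<k. a - 0) / fact k"
    by (intro tendsto_intros assms lim_const_over_n) simp
  moreover have "(\<Prod>i<k. real (f n) / real n - real i / real n) / fact k = real (f n choose k) / real n ^ k" for n
    by (simp add: binomial_gbinomial gbinomial_prod_rev prod_dividef atLeast0LessThan flip: diff_divide_distrib)
  ultimately show ?thesis by simp
qed

lemma isomorphic_C4_pendantI:
  assumes G: "simple_graph G" and d: "distinct [a, b, c, d, e]"
    and "adj G a b" "adj G b c" "adj G c d" "adj G d a" "adj G a e"
      "\<not> adj G a c" "\<not> adj G b d" "\<not> adj G b e" "\<not> adj G c e" "\<not> adj G d e"
  shows "isomorphic (induced G {a, b, c, d, e}) C4_pendant"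
proof -
  let ?S = "{a, b, c, d, e}"
  define f where "f = (\<lambda>_. 4 :: nat)(a := 0, b := 1, c := 2, d := 3)"
  have f: "f a = 0" "f b = 1" "f c = 2" "f d = 3" "f e = 4" using d by (auto simp: f_def)
  have irrefl: "{u} \<notin> edge_set G" for u using G by (auto simp: simple_graph_def)
  have "bij_betw f ?S {0..<5}"
    by (rule bij_betw_imageI) (use f in \<open>auto simp: inj_on_def\<close>)
  moreover have "adj G u v \<longleftrightarrow> {f u, f v} \<in> edge_set C4_pendant" if "u \<in> ?S" "v \<in> ?S" for u v
    using that unfolding C4_pendant_edge
    by (elim insertE emptyE; simp only: f; simp add: assms(3-) irrefl insert_commute assms(3-)[unfolded insert_commute[of _ "_"]])
  ultimately show ?thesis
    unfolding isomorphic_def by (intro exI[of _ f]) (auto simp: induced_def C4_pendant_def)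
qed

text \<open>There are infinitely many graphs of order \<open>n\<close> on natural numbers, but their
  densities are quotients of a number of subsets by one fixed binomial coefficient. This finiteness
  is what gives \<open>Max\<close> its meaning.\<close>

lemma finite_induced_density:
  "finite {induced_density F G | G :: nat graph. simple_graph G \<and> num_verts G = n}"
proof (rule finite_subset)
  show "{induced_density F G | G :: nat graph. simple_graph G \<and> num_verts G = n} \<subseteq>
      (\<lambda>k. real k / real (n choose num_verts F)) ` {..2 ^ n}"
  proof safe
    fix G :: "nat graph" assume G: "simple_graph G" "n = num_verts G"
    then have "finite (vertex_set G)" by (simp add: simple_graph_def)
    then have "card {S. S \<subseteq> vertex_set G \<and> card S = num_verts F \<and> isomorphic (induced G S) F} \<le> card (Pow (vertex_set G))"
      by (intro card_mono) auto
    then show "induced_density F G \<in> (\<lambda>k. real k / real (num_verts G choose num_verts F)) ` {..2 ^ num_verts G}"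
      using \<open>finite (vertex_set G)\<close> by (auto simp: induced_density_def card_Pow)
  qed
qed simp

text \<open>Nonnegativity of the defect, rewritten. The factor 120 binom(n,5) / n^5 tends to 1;
  below five vertices both sides are 0 by division by zero.\<close>

lemma induced_density_le:
  assumes "simple_graph G"
  shows "induced_density C4_pendant G \<le> 15625 / 62208 / (120 * (real (num_verts G choose 5) / real (num_verts G) ^ 5))"
proof -
  let ?n = "real (num_verts G)"
  have "0 \<le> defect G"
    using defect_ge(1)[OF assms] triangles_nonneg[of G] by (meson mult_nonneg_nonneg order.trans zero_le_power of_nat_0_le_iff)
  then have "real (copies G) \<le> 15625 / 62208 * ?n ^ 5 / 120"
    by (simp add: defect_def)
  then have "real (copies G) / real (num_verts G choose 5) \<le> (15625 / 62208 * ?n ^ 5 / 120) / real (num_verts G choose 5)"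
    by (rule divide_right_mono) simp
  moreover have "induced_density C4_pendant G = real (copies G) / real (num_verts G choose 5)"
    by (simp add: induced_density_def C4_pendant_def)
  ultimately show ?thesis by simp
qed

text \<open>\<open>g\<close> rolls a die with faces 0 to 5 for each cross pair, and face 0 deletes
  the edge. Counting functions uniformly then models edge probability 5/6 without a probability
  space.\<close>

definition cross_graph :: "'a set \<Rightarrow> 'a set \<Rightarrow> ('a \<times> 'a \<Rightarrow> nat) \<Rightarrow> 'a graph" where
  "cross_graph A B g = (A \<union> B, {{x, y} | x y. x \<in> A \<and> y \<in> B \<and> g (x, y) \<noteq> 0})"

lemma vertex_set_cross_graph [simp]: "vertex_set (cross_graph A B g) = A \<union> B"
  by (simp add: cross_graph_def)

lemma num_verts_C4_pendant [simp]: "num_verts C4_pendant = 5"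
  by (simp add: C4_pendant_def)

lemma adj_cross_graph:
  assumes "A \<inter> B = {}"
  shows "x \<in> A \<Longrightarrow> y \<in> B \<Longrightarrow> adj (cross_graph A B g) x y \<longleftrightarrow> g (x, y) \<noteq> 0"
    and "x \<in> A \<Longrightarrow> y \<in> A \<Longrightarrow> \<not> adj (cross_graph A B g) x y"
    and "x \<in> B \<Longrightarrow> y \<in> B \<Longrightarrow> \<not> adj (cross_graph A B g) x y"
  using assms by (auto simp: cross_graph_def doubleton_eq_iff)

lemma simple_cross_graph:
  assumes "finite A" "finite B" "A \<inter> B = {}"
  shows "simple_graph (cross_graph A B g)"
  using assms by (auto simp: simple_graph_def cross_graph_def card_insert_if)

text \<open>Let \<open>x\<close> be the end of the missing pair on the side of two vertices,
  \<open>y\<close> the other end, \<open>a\<close> the second vertex next to \<open>x\<close>, and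
  \<open>b\<close>, \<open>d\<close> the two vertices next to \<open>y\<close>. Then a, b, x, d is
  an induced 4-cycle and \<open>y\<close> hangs on \<open>a\<close>. If the sides have sizes 3 and
  2, the roles of \<open>x\<close> and \<open>y\<close> are exchanged.\<close>

lemma cross_graph_copy:
  assumes fin: "finite A" "finite B" and disj: "A \<inter> B = {}"
    and S: "S \<subseteq> A \<union> B" "card (S \<inter> A) = 2 \<and> card (S \<inter> B) = 3 \<or> card (S \<inter> A) = 3 \<and> card (S \<inter> B) = 2"
    and e: "e \<in> (S \<inter> A) \<times> (S \<inter> B)" "g e = 0" "\<forall>j\<in>(S \<inter> A) \<times> (S \<inter> B) - {e}. g j \<noteq> 0"
  shows "isomorphic (induced (cross_graph A B g) S) C4_pendant"
proof -
  obtain x y where xy: "e = (x, y)" "x \<in> S \<inter> A" "y \<in> S \<inter> B" using e(1) by auto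
  note adj = adj_cross_graph[OF disj, of _ _ g]
  have g0: "g (x, y) = 0" using e(2) xy by simp
  have g1: "g (u, w) \<noteq> 0" if "u \<in> S \<inter> A" "w \<in> S \<inter> B" "u \<noteq> x \<or> w \<noteq> y" for u w
    using e(3) xy that by auto
  let ?H = "cross_graph A B g"
  have AB: "adj ?H u w" "adj ?H w u" if "u \<in> S \<inter> A" "w \<in> S \<inter> B" "u \<noteq> x \<or> w \<noteq> y" for u w
    using adj(1)[of u w] g1[OF that] that adj_commute[of w u ?H] by blast+
  have xy': "\<not> adj ?H x y" "\<not> adj ?H y x" using adj(1)[of x y] g0 xy adj_commute[of y x ?H] by blast+
  have AA: "\<not> adj ?H u w" if "u \<in> S \<inter> A" "w \<in> S \<inter> A" for u w using adj(2)[of u w] that by blast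
  have BB: "\<not> adj ?H u w" if "u \<in> S \<inter> B" "w \<in> S \<inter> B" for u w using adj(3)[of u w] that by blast
  have Sf: "S = (S \<inter> A) \<union> (S \<inter> B)" using S(1) by auto
  note G = simple_cross_graph[OF fin disj, of g]
  from S(2) show ?thesis
  proof
    assume c: "card (S \<inter> A) = 2 \<and> card (S \<inter> B) = 3"
    then have "card (S \<inter> A - {x}) = 1" "card (S \<inter> B - {y}) = 2" using xy fin by simp_all
    then obtain a b d where abd: "S \<inter> A - {x} = {a}" "S \<inter> B - {y} = {b, d}" "b \<noteq> d"
      by (auto simp: card_1_singleton_iff card_2_iff)
    have m: "a \<in> S \<inter> A" "b \<in> S \<inter> B" "d \<in> S \<inter> B" "a \<noteq> x" "b \<noteq> y" "d \<noteq> y" using abd by auto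
    have "S = {a, b, x, d, y}" using Sf abd xy by auto
    moreover have "isomorphic (induced (cross_graph A B g) {a, b, x, d, y}) C4_pendant"
    proof (rule isomorphic_C4_pendantI[OF G])
      show "distinct [a, b, x, d, y]" using m xy abd(3) disj by auto
      show "adj ?H a b" by (rule AB(1)) (use m xy in simp_all)
      show "adj ?H b x" by (rule AB(2)) (use m xy in simp_all)
      show "adj ?H x d" by (rule AB(1)) (use m xy in simp_all)
      show "adj ?H d a" by (rule AB(2)) (use m xy in simp_all)
      show "adj ?H a y" by (rule AB(1)) (use m xy in simp_all)
      show "\<not> adj ?H a x" by (rule AA) (use m xy in simp_all)
      show "\<not> adj ?H b d" "\<not> adj ?H b y" "\<not> adj ?H d y" by (rule BB; use m xy in simp)+
    qed (rule xy')
    ultimately show ?thesis by simp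
  next
    assume c: "card (S \<inter> A) = 3 \<and> card (S \<inter> B) = 2"
    then have "card (S \<inter> B - {y}) = 1" "card (S \<inter> A - {x}) = 2" using xy fin by simp_all
    then obtain a b d where abd: "S \<inter> B - {y} = {a}" "S \<inter> A - {x} = {b, d}" "b \<noteq> d"
      by (auto simp: card_1_singleton_iff card_2_iff)
    have m: "a \<in> S \<inter> B" "b \<in> S \<inter> A" "d \<in> S \<inter> A" "a \<noteq> y" "b \<noteq> x" "d \<noteq> x" using abd by auto
    have "S = {a, b, y, d, x}" using Sf abd xy by auto
    moreover have "isomorphic (induced (cross_graph A B g) {a, b, y, d, x}) C4_pendant"
    proof (rule isomorphic_C4_pendantI[OF G])
      show "distinct [a, b, y, d, x]" using m xy abd(3) disj by auto
      show "adj ?H a b" by (rule AB(2)) (use m xy in simp_all)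
      show "adj ?H b y" by (rule AB(1)) (use m xy in simp_all)
      show "adj ?H y d" by (rule AB(2)) (use m xy in simp_all)
      show "adj ?H d a" by (rule AB(1)) (use m xy in simp_all)
      show "adj ?H a x" by (rule AB(2)) (use m xy in simp_all)
      show "\<not> adj ?H a y" by (rule BB) (use m xy in simp_all)
      show "\<not> adj ?H b d" "\<not> adj ?H b x" "\<not> adj ?H d x" by (rule AA; use m xy in simp)+
    qed (rule xy')
    ultimately show ?thesis by simp
  qed
qed

lemma card_split_sets:
  assumes "finite A" "finite B" "A \<inter> B = {}"
  shows "card {S. S \<subseteq> A \<union> B \<and> card (S \<inter> A) = i \<and> card (S \<inter> B) = j} = (card A choose i) * (card B choose j)"
proof -
  have "bij_betw (\<lambda>(S, T). S \<union> T) ({S. S \<subseteq> A \<and> card S = i} \<times> {T. T \<subseteq> B \<and> card T = j})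
      {S. S \<subseteq> A \<union> B \<and> card (S \<inter> A) = i \<and> card (S \<inter> B) = j}"
  proof (rule bij_betw_byWitness[where f' = "\<lambda>S. (S \<inter> A, S \<inter> B)"])
    have "(S \<union> T) \<inter> A = S" "(S \<union> T) \<inter> B = T" if "S \<subseteq> A" "T \<subseteq> B" for S T using that assms(3) by auto
    then show "\<forall>x\<in>{S. S \<subseteq> A \<and> card S = i} \<times> {T. T \<subseteq> B \<and> card T = j}. (\<lambda>S. (S \<inter> A, S \<inter> B)) ((\<lambda>(S, T). S \<union> T) x) = x"
      "(\<lambda>(S, T). S \<union> T) ` ({S. S \<subseteq> A \<and> card S = i} \<times> {T. T \<subseteq> B \<and> card T = j})
        \<subseteq> {S. S \<subseteq> A \<union> B \<and> card (S \<inter> A) = i \<and> card (S \<inter> B) = j}"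
      by auto
  qed auto
  then have "card {S. S \<subseteq> A \<union> B \<and> card (S \<inter> A) = i \<and> card (S \<inter> B) = j}
      = card ({S. S \<subseteq> A \<and> card S = i} \<times> {T. T \<subseteq> B \<and> card T = j})"
    by (simp add: bij_betw_same_card)
  then show ?thesis using assms by (simp add: n_subsets card_cartesian_product)
qed

text \<open>A first-moment argument by double counting. For a fixed 2-3 split the functions with
  exactly one zero on the six cross pairs number 6 * 5^5 * 6^(|I| - 6), which is the fraction
  (5/6)^5 of all 6^|I|; some function reaches the average.\<close>

lemma exists_dense_cross_graph:
  assumes fin: "finite A" "finite B" and disj: "A \<inter> B = {}"
  shows "\<exists>g. (5 / 6) ^ 5 * real ((card A choose 2) * (card B choose 3) + (card A choose 3) * (card B choose 2))
    \<le> real (copies (cross_graph A B g))"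
proof -
  define I where "I = A \<times> B"
  define Om where "Om = PiE I (\<lambda>_. {0..<6 :: nat})"
  define F where "F = {S. S \<subseteq> A \<union> B \<and> (card (S \<inter> A) = 2 \<and> card (S \<inter> B) = 3 \<or> card (S \<inter> A) = 3 \<and> card (S \<inter> B) = 2)}"
  define J where "J S = (S \<inter> A) \<times> (S \<inter> B)" for S
  define E where "E S = {g \<in> Om. isomorphic (induced (cross_graph A B g) S) C4_pendant}" for S
  have finI: "finite I" using fin by (simp add: I_def)
  have finOm: "finite Om" unfolding Om_def by (rule finite_PiE[OF finI]) simp
  have finF: "finite F" using fin by (auto simp: F_def)
  have "card F = card {S. S \<subseteq> A \<union> B \<and> card (S \<inter> A) = 2 \<and> card (S \<inter> B) = 3}
      + card {S. S \<subseteq> A \<union> B \<and> card (S \<inter> A) = 3 \<and> card (S \<inter> B) = 2}"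
    by (subst card_Un_disjoint[symmetric]) (use fin in \<open>auto simp: F_def intro!: arg_cong[where f = card]\<close>)
  then have cF: "card F = (card A choose 2) * (card B choose 3) + (card A choose 3) * (card B choose 2)"
    by (simp add: card_split_sets[OF assms])
  have E: "6 * (5 ^ 5 * 6 ^ (card I - 6)) \<le> card (E S)" if S: "S \<in> F" for S
  proof -
    have JI: "J S \<subseteq> I" by (auto simp: J_def I_def)
    have cJ: "card (J S) = 6" using S by (auto simp: F_def J_def card_cartesian_product)
    have finJ: "finite (J S)" using JI finI finite_subset by blast
    define M where "M e = PiE I (\<lambda>j. if j = e then {0} else if j \<in> J S then {1..<6} else {0..<6 :: nat})" for e
    have cM: "card (M e) = 5 ^ 5 * 6 ^ (card I - 6)" if e: "e \<in> J S" for e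
    proof -
      have "card (M e) = (\<Prod>j\<in>I. card (if j = e then {0} else if j \<in> J S then {1..<6} else {0..<6 :: nat}))"
        unfolding M_def by (rule card_PiE[OF finI])
      also have "\<dots> = (\<Prod>j\<in>I - J S. card (if j = e then {0} else if j \<in> J S then {1..<6} else {0..<6 :: nat})) *
           (\<Prod>j\<in>J S. card (if j = e then {0} else if j \<in> J S then {1..<6} else {0..<6 :: nat}))"
        by (rule prod.subset_diff[OF JI finI])
      also have "(\<Prod>j\<in>I - J S. card (if j = e then {0} else if j \<in> J S then {1..<6} else {0..<6 :: nat})) = (\<Prod>j\<in>I - J S. 6)"
        by (rule prod.cong) (use e in auto)
      also have "\<dots> = 6 ^ (card I - 6)" by (simp add: card_Diff_subset[OF finJ JI] cJ)
      also have "(\<Prod>j\<in>J S. card (if j = e then {0} else if j \<in> J S then {1..<6} else {0..<6 :: nat})) =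
          (\<Prod>j\<in>J S - {e}. card (if j = e then {0} else if j \<in> J S then {1..<6} else {0..<6 :: nat}))"
        by (subst prod.remove[OF finJ e]) simp
      also have "\<dots> = (\<Prod>j\<in>J S - {e}. 5)" by (rule prod.cong) auto
      also have "\<dots> = 5 ^ 5" using e by (simp add: cJ finJ)
      finally show ?thesis by simp
    qed
    have "card (\<Union>e\<in>J S. M e) = (\<Sum>e\<in>J S. card (M e))"
    proof (rule card_UN_disjoint[OF finJ])
      show "\<forall>e\<in>J S. finite (M e)" using finI by (auto simp: M_def intro!: finite_PiE)
      have "M e \<inter> M e' = {}" if "e \<in> J S" "e' \<in> J S" "e \<noteq> e'" for e e'
      proof -
        have "g e = 0" "g e \<noteq> 0" if "g \<in> M e" "g \<in> M e'" for g
          using PiE_mem[OF that(1)[unfolded M_def], of e] PiE_mem[OF that(2)[unfolded M_def], of e]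
            \<open>e \<in> J S\<close> \<open>e \<noteq> e'\<close> JI by auto
        then show ?thesis by blast
      qed
      then show "\<forall>e\<in>J S. \<forall>e'\<in>J S. e \<noteq> e' \<longrightarrow> M e \<inter> M e' = {}" by blast
    qed
    also have "\<dots> = 6 * (5 ^ 5 * 6 ^ (card I - 6))" by (simp add: cM cJ)
    finally have cU: "card (\<Union>e\<in>J S. M e) = 6 * (5 ^ 5 * 6 ^ (card I - 6))" .
    have "(\<Union>e\<in>J S. M e) \<subseteq> E S"
    proof (rule UN_least, rule subsetI)
      fix e g assume e: "e \<in> J S" and g: "g \<in> M e"
      have 1: "g e = 0" using PiE_mem[OF g[unfolded M_def], of e] e JI by auto
      have 2: "g j \<noteq> 0" if "j \<in> J S - {e}" for j using PiE_mem[OF g[unfolded M_def], of j] that JI by auto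
      have "g \<in> Om" using g unfolding M_def Om_def by (rule set_mp[OF PiE_mono, rotated]) auto
      moreover have "isomorphic (induced (cross_graph A B g) S) C4_pendant"
        by (rule cross_graph_copy[OF fin disj, where e = e]) (use S e 1 2 in \<open>auto simp: F_def J_def\<close>)
      ultimately show "g \<in> E S" by (simp add: E_def)
    qed
    then have "card (\<Union>e\<in>J S. M e) \<le> card (E S)"
      by (rule card_mono[rotated]) (use finOm in \<open>simp add: E_def\<close>)
    then show ?thesis by (simp only: cU)
  qed
  have copies: "(\<Sum>S\<in>F. of_bool (g \<in> E S)) \<le> copies (cross_graph A B g)" if "g \<in> Om" for g
  proof -
    have "(\<Sum>S\<in>F. of_bool (g \<in> E S)) = card {S \<in> F. g \<in> E S}"
      by (simp add: finF sum.If_cases Int_def of_bool_def)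
    also have "\<dots> \<le> copies (cross_graph A B g)"
    proof (rule card_mono)
      show "finite {S. S \<subseteq> vertex_set (cross_graph A B g) \<and> card S = num_verts C4_pendant \<and>
          isomorphic (induced (cross_graph A B g) S) C4_pendant}"
        using fin by (simp add: vertex_set_cross_graph)
      have "card S = 5" if "S \<in> F" for S
      proof -
        have "card S = card (S \<inter> A) + card (S \<inter> B)"
        proof -
          have "S = (S \<inter> A) \<union> (S \<inter> B)" using that by (auto simp: F_def)
          moreover have "card ((S \<inter> A) \<union> (S \<inter> B)) = card (S \<inter> A) + card (S \<inter> B)"
            by (rule card_Un_disjoint) (use fin disj in auto)
          ultimately show ?thesis by metis
        qed
        then show ?thesis using that by (auto simp: F_def)
      qed
      note c5 = this
      have "S \<subseteq> A \<union> B" if "S \<in> F" for S using that by (simp add: F_def)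
      then show "{S \<in> F. g \<in> E S} \<subseteq> {S. S \<subseteq> vertex_set (cross_graph A B g) \<and> card S = num_verts C4_pendant \<and>
          isomorphic (induced (cross_graph A B g) S) C4_pendant}"
        unfolding vertex_set_cross_graph num_verts_C4_pendant E_def using c5 by blast
    qed
    finally show ?thesis .
  qed
  show ?thesis
  proof (rule ccontr)
    assume "\<not> ?thesis"
    then have less: "real (copies (cross_graph A B g)) < (5 / 6) ^ 5 * real (card F)" for g
      by (auto simp: cF not_le)
    have Om_ne: "Om \<noteq> {}" by (auto simp: Om_def PiE_eq_empty_iff)
    have cOm: "card Om = 6 ^ card I" unfolding Om_def by (subst card_PiE[OF finI]) simp
    \<comment> \<open>A number of copies is nonnegative and lies below the bound, so
      \<open>F\<close> is nonempty. A member of \<open>F\<close> has six cross pairs inside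
      \<open>I\<close>, which makes the truncated subtraction \<open>card I - 6\<close>
      exact.\<close>
    have "0 < (5 / 6) ^ 5 * real (card F)" using less[of undefined] by (meson le_less_trans of_nat_0_le_iff)
    then obtain S where S: "S \<in> F" by (cases "F = {}") auto
    have "card (J S) \<le> card I" by (rule card_mono[OF finI]) (auto simp: J_def I_def)
    moreover have "card (J S) = 6" using S by (auto simp: F_def J_def card_cartesian_product)
    ultimately have I6: "(6 :: real) ^ card I = 6 ^ 6 * 6 ^ (card I - 6)"
      by (metis le_add_diff_inverse power_add)
    have "(\<Sum>S\<in>F. 6 * (5 ^ 5 * 6 ^ (card I - 6))) \<le> (\<Sum>S\<in>F. card (E S))"
      by (rule sum_mono) (rule E)
    also have "\<dots> = (\<Sum>S\<in>F. \<Sum>g\<in>Om. of_bool (g \<in> E S))"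
    proof (rule sum.cong[OF refl])
      fix S
      have "Om \<inter> {g. g \<in> E S} = E S" by (auto simp: E_def)
      then show "card (E S) = (\<Sum>g\<in>Om. of_bool (g \<in> E S))"
        using finOm by (simp add: of_bool_def sum.If_cases)
    qed
    also have "\<dots> = (\<Sum>g\<in>Om. \<Sum>S\<in>F. of_bool (g \<in> E S))" by (rule sum.swap)
    also have "\<dots> \<le> (\<Sum>g\<in>Om. copies (cross_graph A B g))" by (rule sum_mono) (rule copies)
    finally have "card F * (6 * (5 ^ 5 * 6 ^ (card I - 6))) \<le> (\<Sum>g\<in>Om. copies (cross_graph A B g))" by simp
    from of_nat_mono[OF this, where ?'a = real]
    have "real (card F * (6 * (5 ^ 5 * 6 ^ (card I - 6)))) \<le> (\<Sum>g\<in>Om. real (copies (cross_graph A B g)))"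
      by (simp only: of_nat_sum)
    also have "\<dots> < (\<Sum>g\<in>Om. (5 / 6) ^ 5 * real (card F))"
      by (rule sum_strict_mono[OF finOm Om_ne]) (rule less)
    also have "\<dots> = (5 / 6) ^ 5 * real (card F) * (6 ^ 6 * 6 ^ (card I - 6))" by (simp add: cOm I6)
    finally show False by (simp add: power_divide)
  qed
qed

section \<open>Convergence of the maximum density\<close>

lemma half_tendsto:
  "(\<lambda>n. real (n div 2) / real n) \<longlonglongrightarrow> 1 / 2" "(\<lambda>n. real (n - n div 2) / real n) \<longlonglongrightarrow> 1 / 2"
proof -
  have low: "(\<lambda>n. 1 / 2 - 1 / (2 * real n)) \<longlonglongrightarrow> 1 / 2" and up: "(\<lambda>n. 1 / 2 + 1 / (2 * real n)) \<longlonglongrightarrow> 1 / 2"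
    by real_asymp+
  have bounds: "1 / 2 - 1 / (2 * real n) \<le> real (n div 2) / real n"
    "real (n div 2) / real n \<le> 1 / 2 + 1 / (2 * real n)"
    "1 / 2 - 1 / (2 * real n) \<le> real (n - n div 2) / real n"
    "real (n - n div 2) / real n \<le> 1 / 2 + 1 / (2 * real n)" if "n > 0" for n
  proof -
    have d: "1 / 2 - 1 / (2 * real n) = (real n / 2 - 1 / 2) / real n" "1 / 2 + 1 / (2 * real n) = (real n / 2 + 1 / 2) / real n"
      using that by (simp_all add: field_simps)
    have "2 * (n div 2) \<le> n" "n \<le> 2 * (n div 2) + 1" by linarith+
    then have "real n / 2 - 1 / 2 \<le> real (n div 2)" "real (n div 2) \<le> real n / 2 + 1 / 2"
      "real n / 2 - 1 / 2 \<le> real (n - n div 2)" "real (n - n div 2) \<le> real n / 2 + 1 / 2"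
      by (simp_all add: of_nat_diff)
    then show "1 / 2 - 1 / (2 * real n) \<le> real (n div 2) / real n" "real (n div 2) / real n \<le> 1 / 2 + 1 / (2 * real n)"
      "1 / 2 - 1 / (2 * real n) \<le> real (n - n div 2) / real n" "real (n - n div 2) / real n \<le> 1 / 2 + 1 / (2 * real n)"
      unfolding d by (auto intro: divide_right_mono)
  qed
  show "(\<lambda>n. real (n div 2) / real n) \<longlonglongrightarrow> 1 / 2" "(\<lambda>n. real (n - n div 2) / real n) \<longlonglongrightarrow> 1 / 2"
    by (rule tendsto_sandwich[OF _ _ low up]; rule eventually_sequentiallyI[of 1]; rule bounds; simp)+
qed

lemma max_induced_density_bounds:
  "max_induced_density C4_pendant n \<le> 15625 / 62208 / (120 * (real (n choose 5) / real n ^ 5))"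
  "(5 / 6) ^ 5 * real ((n div 2 choose 2) * ((n - n div 2) choose 3) + (n div 2 choose 3) * ((n - n div 2) choose 2))
     / real (n choose 5) \<le> max_induced_density C4_pendant n"
proof -
  let ?D = "{induced_density C4_pendant G | G :: nat graph. simple_graph G \<and> num_verts G = n}"
  have "({0..<n}, {}) \<in> {G :: nat graph. simple_graph G \<and> num_verts G = n}" by (simp add: simple_graph_def)
  then have "?D \<noteq> {}" by blast
  then show "max_induced_density C4_pendant n \<le> 15625 / 62208 / (120 * (real (n choose 5) / real n ^ 5))"
    unfolding max_induced_density_def
    by (subst Max_le_iff[OF finite_induced_density]) (use induced_density_le in blast)+
  let ?A = "{0..<n div 2}" and ?B = "{n div 2..<n}"
  obtain g where g: "(5 / 6) ^ 5 * real ((card ?A choose 2) * (card ?B choose 3) + (card ?A choose 3) * (card ?B choose 2))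
      \<le> real (copies (cross_graph ?A ?B g))"
    using exists_dense_cross_graph[of ?A ?B] by auto
  have c: "card (?A \<union> ?B) = n" by (subst ivl_disj_un) auto
  have "induced_density C4_pendant (cross_graph ?A ?B g) \<in> ?D"
  proof (rule CollectI, rule exI[of _ "cross_graph ?A ?B g"], intro conjI refl)
    show "simple_graph (cross_graph ?A ?B g)" by (rule simple_cross_graph) auto
    show "num_verts (cross_graph ?A ?B g) = n" unfolding vertex_set_cross_graph by (rule c)
  qed
  then have "induced_density C4_pendant (cross_graph ?A ?B g) \<le> max_induced_density C4_pendant n"
    unfolding max_induced_density_def by (rule Max_ge[OF finite_induced_density])
  moreover have "induced_density C4_pendant (cross_graph ?A ?B g) = real (copies (cross_graph ?A ?B g)) / real (n choose 5)"
    by (simp only: induced_density_def vertex_set_cross_graph num_verts_C4_pendant c)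
  ultimately show "(5 / 6) ^ 5 * real ((n div 2 choose 2) * ((n - n div 2) choose 3) + (n div 2 choose 3) * ((n - n div 2) choose 2))
     / real (n choose 5) \<le> max_induced_density C4_pendant n"
    using divide_right_mono[OF g, of "real (n choose 5)"] by simp
qed

text \<open>\<open>lim\<close> is informative only for a convergent sequence, so the two bounds have
  to prove convergence as well as identify the limit. The lower bound tends to 5/8 (5/6)^5, where
  5/8 is the limiting share of 2-3 splits.\<close>

lemma inducibility_C4_pendant: "inducibility C4_pendant = 15625 / 62208"
proof -
  have c: "(\<lambda>n. real (n choose 5) / real n ^ 5) \<longlonglongrightarrow> 1 ^ 5 / fact 5"
    by (rule binomial_over_power_tendsto) real_asymp
  have "(\<lambda>n. 15625 / 62208 / (120 * (real (n choose 5) / real n ^ 5))) \<longlonglongrightarrow> 15625 / 62208 / (120 * (1 ^ 5 / fact 5))"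
    by (intro tendsto_intros c) simp
  then have up: "(\<lambda>n. 15625 / 62208 / (120 * (real (n choose 5) / real n ^ 5))) \<longlonglongrightarrow> 15625 / 62208"
    by (simp add: fact_numeral)
  let ?a = "\<lambda>n k. real (n div 2 choose k) / real n ^ k" and ?b = "\<lambda>n k. real ((n - n div 2) choose k) / real n ^ k"
  have a: "(\<lambda>n. ?a n k) \<longlonglongrightarrow> (1 / 2) ^ k / fact k" "(\<lambda>n. ?b n k) \<longlonglongrightarrow> (1 / 2) ^ k / fact k" for k
    by (intro binomial_over_power_tendsto half_tendsto)+
  have "(\<lambda>n. (5 / 6) ^ 5 * (?a n 2 * ?b n 3 + ?a n 3 * ?b n 2) / (real (n choose 5) / real n ^ 5)) \<longlonglongrightarrow>
     (5 / 6) ^ 5 * ((1 / 2) ^ 2 / fact 2 * ((1 / 2) ^ 3 / fact 3) + (1 / 2) ^ 3 / fact 3 * ((1 / 2) ^ 2 / fact 2)) / (1 ^ 5 / fact 5)"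
    by (intro tendsto_intros a c) simp
  then have "(\<lambda>n. (5 / 6) ^ 5 * (?a n 2 * ?b n 3 + ?a n 3 * ?b n 2) / (real (n choose 5) / real n ^ 5)) \<longlonglongrightarrow> 15625 / 62208"
    by (simp add: fact_numeral power_divide)
  moreover have "(5 / 6) ^ 5 * (?a n 2 * ?b n 3 + ?a n 3 * ?b n 2) / (real (n choose 5) / real n ^ 5) =
     (5 / 6) ^ 5 * real ((n div 2 choose 2) * ((n - n div 2) choose 3) + (n div 2 choose 3) * ((n - n div 2) choose 2))
     / real (n choose 5)" if "n > 0" for n
  proof -
    have "?a n 2 * ?b n 3 + ?a n 3 * ?b n 2 =
      real ((n div 2 choose 2) * ((n - n div 2) choose 3) + (n div 2 choose 3) * ((n - n div 2) choose 2)) / real n ^ 5"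
      by (simp add: add_divide_distrib flip: power_add)
    then show ?thesis using that by (simp del: of_nat_add of_nat_mult)
  qed
  ultimately have low: "(\<lambda>n. (5 / 6) ^ 5 * real ((n div 2 choose 2) * ((n - n div 2) choose 3)
      + (n div 2 choose 3) * ((n - n div 2) choose 2)) / real (n choose 5)) \<longlonglongrightarrow> 15625 / 62208"
    by (rule Lim_transform_eventually[OF _ eventually_sequentiallyI[of 1]]) simp
  have "max_induced_density C4_pendant \<longlonglongrightarrow> 15625 / 62208"
    by (rule tendsto_sandwich[OF _ _ low up]) (simp_all only: max_induced_density_bounds eventually_True)
  then show ?thesis unfolding inducibility_def by (rule limI)
qed

section \<open>Homomorphism densities from the cut norm\<close>

lemma part_maps_upd:
  assumes "f \<in> part_maps X Y A B" "x \<in> X" "y \<in> Y" "X \<inter> Y = {}" "a \<in> A" "b \<in> B"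
  shows "f(x := a, y := b) \<in> part_maps X Y A B"
  using assms by (auto simp: part_maps_def PiE_iff extensional_def image_subset_iff)

lemma part_mapsD:
  assumes "f \<in> part_maps X Y A B"
  shows "x \<in> X \<Longrightarrow> f x \<in> A" "y \<in> Y \<Longrightarrow> f y \<in> B"
  using assms by (auto simp: part_maps_def)

text \<open>Resampling the images of \<open>x\<close> and \<open>y\<close> keeps the map uniform:
  exchanging (f x, f y) with (a, b) is an involution on the triples (f, a, b).\<close>

lemma sum_part_maps_upd:
  fixes g :: "('b \<Rightarrow> 'a) \<Rightarrow> real"
  assumes "x \<in> X" "y \<in> Y" "X \<inter> Y = {}"
  shows "(\<Sum>f\<in>part_maps X Y A B. \<Sum>a\<in>A. \<Sum>b\<in>B. g (f(x := a, y := b))) =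
    real (card A) * real (card B) * (\<Sum>f\<in>part_maps X Y A B. g f)"
proof -
  let ?M = "part_maps X Y A B"
  have xy: "x \<noteq> y" using assms by auto
  have "(\<Sum>f\<in>?M. \<Sum>a\<in>A. \<Sum>b\<in>B. g (f(x := a, y := b))) = (\<Sum>(f, a, b)\<in>?M \<times> A \<times> B. g (f(x := a, y := b)))"
    by (simp add: sum.cartesian_product)
  also have "\<dots> = (\<Sum>(f, a, b)\<in>?M \<times> A \<times> B. g f)"
    by (rule sum.reindex_bij_witness[where i = "\<lambda>(f, a, b). (f(x := a, y := b), f x, f y)"
          and j = "\<lambda>(f, a, b). (f(x := a, y := b), f x, f y)"])
      (use assms xy part_maps_upd[OF _ assms] in \<open>auto simp: fun_upd_twist part_mapsD\<close>)
  also have "\<dots> = real (card A) * real (card B) * (\<Sum>f\<in>?M. g f)"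
    by (simp add: sum.cartesian_product[symmetric] sum_distrib_left mult.assoc card_cartesian_product)
  finally show ?thesis .
qed

text \<open>Fix \<open>f\<close> outside the ends \<open>x\<close>, \<open>y\<close> of the current
  edge. No remaining edge joins \<open>x\<close> and \<open>y\<close>, so the product over the
  remaining edges splits into a factor in \<open>a\<close>, a factor in \<open>b\<close> and a
  constant, all within [0, 1]. This is exactly a test against the cut norm, and replacing the
  current factor by \<open>p\<close> costs at most delta.\<close>

lemma counting_lemma:
  fixes W :: "'a \<Rightarrow> 'a \<Rightarrow> real"
  assumes W: "\<And>a b. 0 \<le> W a b" "\<And>a b. W a b \<le> 1" and p: "0 \<le> p" "p \<le> 1"
    and ne: "card A > 0" "card B > 0" and XY: "X \<inter> Y = {}"
    and cut: "\<And>f g. (\<And>a. 0 \<le> f a \<and> f a \<le> 1) \<Longrightarrow> (\<And>b. 0 \<le> g b \<and> g b \<le> 1) \<Longrightarrow>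
      \<bar>\<Sum>a\<in>A. \<Sum>b\<in>B. f a * g b * (W a b - p)\<bar> \<le> \<delta> * (real (card A) * real (card B))"
    and E: "finite E" "E \<subseteq> X \<times> Y"
  shows "\<bar>(\<Sum>f\<in>part_maps X Y A B. \<Prod>e\<in>E. W (f (fst e)) (f (snd e))) - p ^ card E * real (card (part_maps X Y A B))\<bar>
     \<le> real (card E) * \<delta> * real (card (part_maps X Y A B))"
  using E
proof (induction E)
  case (insert e E)
  obtain x y where e: "e = (x, y)" "x \<in> X" "y \<in> Y" using insert.prems by auto
  let ?M = "part_maps X Y A B" and ?AB = "real (card A) * real (card B)"
  let ?t = "\<lambda>E f. \<Prod>e\<in>E. W (f (fst e)) (f (snd e))"
  have AB: "?AB > 0" using ne by simp
  have d0: "\<delta> \<ge> 0"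
  proof -
    have "0 \<le> \<delta> * ?AB" using cut[of "\<lambda>_. 0" "\<lambda>_. 0"] by simp
    then show ?thesis using AB by (simp add: zero_le_mult_iff)
  qed
  have E': "E \<subseteq> X \<times> Y" using insert.prems by simp
  have step: "\<bar>\<Sum>a\<in>A. \<Sum>b\<in>B. ?t E (f(x := a, y := b)) * (W a b - p)\<bar> \<le> \<delta> * ?AB" if f: "f \<in> ?M" for f
  proof -
    define P where "P a = (\<Prod>e\<in>E. if fst e = x then W a (f (snd e)) else 1)" for a
    define Q where "Q b = (\<Prod>e\<in>E. if snd e = y then W (f (fst e)) b else 1)" for b
    define R where "R = (\<Prod>e\<in>E. if fst e \<noteq> x \<and> snd e \<noteq> y then W (f (fst e)) (f (snd e)) else 1)"
    have t: "?t E (f(x := a, y := b)) = P a * R * Q b" for a b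
      unfolding P_def Q_def R_def prod.distrib[symmetric]
    proof (rule prod.cong[OF refl])
      fix e' assume e': "e' \<in> E"
      then have "fst e' \<in> X" "snd e' \<in> Y" "\<not> (fst e' = x \<and> snd e' = y)"
        using E' insert.hyps e by auto
      then show "W ((f(x := a, y := b)) (fst e')) ((f(x := a, y := b)) (snd e')) =
          (if fst e' = x then W a (f (snd e')) else 1) *
          (if fst e' \<noteq> x \<and> snd e' \<noteq> y then W (f (fst e')) (f (snd e')) else 1) *
          (if snd e' = y then W (f (fst e')) b else 1)"
        using e XY by auto
    qed
    have b: "0 \<le> P a" "P a \<le> 1" "0 \<le> Q a" "Q a \<le> 1" "0 \<le> R" "R \<le> 1" for a
      unfolding P_def Q_def R_def by (auto intro!: prod_nonneg prod_le_1 W)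
    have "\<bar>\<Sum>a\<in>A. \<Sum>b\<in>B. (P a * R) * Q b * (W a b - p)\<bar> \<le> \<delta> * ?AB"
      by (rule cut) (auto intro!: mult_nonneg_nonneg mult_le_one b)
    then show ?thesis by (simp only: t)
  qed
  have "?AB * \<bar>\<Sum>f\<in>?M. ?t E f * (W (f x) (f y) - p)\<bar> = \<bar>?AB * (\<Sum>f\<in>?M. ?t E f * (W (f x) (f y) - p))\<bar>"
    using AB by (simp add: abs_mult)
  also have "\<dots> = \<bar>\<Sum>f\<in>?M. \<Sum>a\<in>A. \<Sum>b\<in>B. ?t E (f(x := a, y := b)) * (W a b - p)\<bar>"
    unfolding sum_part_maps_upd[OF e(2,3) XY, symmetric] using e XY by (intro arg_cong[where f = abs] sum.cong) auto
  also have "\<dots> \<le> (\<Sum>f\<in>?M. \<delta> * ?AB)"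
    by (rule order.trans[OF sum_abs sum_mono]) (rule step)
  also have "\<dots> = ?AB * (\<delta> * real (card ?M))" by simp
  finally have "\<bar>\<Sum>f\<in>?M. ?t E f * (W (f x) (f y) - p)\<bar> \<le> \<delta> * real (card ?M)"
    using AB by (simp only: mult_le_cancel_left_pos)
  moreover have "(\<Sum>f\<in>?M. ?t E f * (W (f x) (f y) - p)) = (\<Sum>f\<in>?M. ?t (insert e E) f) - p * (\<Sum>f\<in>?M. ?t E f)"
    using insert.hyps e by (simp add: algebra_simps sum_subtractf sum_distrib_left)
  moreover have "\<bar>p * (\<Sum>f\<in>?M. ?t E f) - p * (p ^ card E * real (card ?M))\<bar> \<le> real (card E) * \<delta> * real (card ?M)"
  proof -
    have "\<bar>p * (\<Sum>f\<in>?M. ?t E f) - p * (p ^ card E * real (card ?M))\<bar> = p * \<bar>(\<Sum>f\<in>?M. ?t E f) - p ^ card E * real (card ?M)\<bar>"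
      using p by (simp add: abs_mult flip: right_diff_distrib)
    also have "\<dots> \<le> 1 * (real (card E) * \<delta> * real (card ?M))"
      by (rule mult_mono) (use p insert.IH[OF E'] d0 in auto)
    finally show ?thesis by simp
  qed
  ultimately show ?case
    using insert.hyps by (simp add: algebra_simps)
qed simp

text \<open>Cauchy-Schwarz over \<open>B\<close> removes \<open>g\<close>, and expanding the inner
  square turns \<open>f\<close> into weights on pairs of rows. One bound on the correlations of the
  rows of \<open>D\<close> thus serves all weight functions at once.\<close>

lemma cut_norm_le:
  fixes W :: "'a \<Rightarrow> 'a \<Rightarrow> real"
  assumes f: "\<And>a. 0 \<le> f a \<and> f a \<le> 1" and g: "\<And>b. 0 \<le> g b \<and> g b \<le> (1::real)"
  shows "(\<Sum>a\<in>A. \<Sum>b\<in>B. f a * g b * D a b)\<^sup>2 \<le> real (card B) * (\<Sum>a\<in>A. \<Sum>a'\<in>A. \<bar>\<Sum>b\<in>B. D a b * D a' b\<bar>)"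
proof -
  have "(\<Sum>a\<in>A. \<Sum>b\<in>B. f a * g b * D a b) = (\<Sum>b\<in>B. g b * (\<Sum>a\<in>A. f a * D a b))"
    by (subst sum.swap) (simp add: sum_distrib_left mult_ac)
  also have "\<dots>\<^sup>2 \<le> (\<Sum>b\<in>B. (g b)\<^sup>2) * (\<Sum>b\<in>B. (\<Sum>a\<in>A. f a * D a b)\<^sup>2)"
    by (rule Cauchy_Schwarz_ineq_sum)
  also have "\<dots> \<le> real (card B) * (\<Sum>b\<in>B. (\<Sum>a\<in>A. f a * D a b)\<^sup>2)"
  proof (rule mult_right_mono)
    have "(\<Sum>b\<in>B. (g b)\<^sup>2) \<le> (\<Sum>b\<in>B. 1)" by (rule sum_mono) (simp add: power_le_one g)
    then show "(\<Sum>b\<in>B. (g b)\<^sup>2) \<le> real (card B)" by simp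
  qed (auto intro: sum_nonneg)
  also have "(\<Sum>b\<in>B. (\<Sum>a\<in>A. f a * D a b)\<^sup>2) = (\<Sum>a\<in>A. \<Sum>a'\<in>A. f a * f a' * (\<Sum>b\<in>B. D a b * D a' b))"
  proof -
    have "(\<Sum>b\<in>B. (\<Sum>a\<in>A. f a * D a b)\<^sup>2) = (\<Sum>b\<in>B. \<Sum>a\<in>A. \<Sum>a'\<in>A. f a * f a' * (D a b * D a' b))"
      by (simp add: power2_eq_square sum_product mult_ac)
    also have "\<dots> = (\<Sum>a\<in>A. \<Sum>a'\<in>A. \<Sum>b\<in>B. f a * f a' * (D a b * D a' b))"
      by (rule trans[OF sum.swap sum.cong[OF refl sum.swap]])
    finally show ?thesis by (simp only: sum_distrib_left)
  qed
  also have "\<dots> \<le> (\<Sum>a\<in>A. \<Sum>a'\<in>A. \<bar>\<Sum>b\<in>B. D a b * D a' b\<bar>)"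
  proof (intro sum_mono)
    fix a a'
    have "f a * f a' * (\<Sum>b\<in>B. D a b * D a' b) \<le> \<bar>f a * f a' * (\<Sum>b\<in>B. D a b * D a' b)\<bar>" by simp
    also have "\<dots> = f a * f a' * \<bar>\<Sum>b\<in>B. D a b * D a' b\<bar>" using f by (simp add: abs_mult)
    also have "\<dots> \<le> 1 * \<bar>\<Sum>b\<in>B. D a b * D a' b\<bar>" by (intro mult_right_mono mult_le_one) (auto simp: f)
    finally show "f a * f a' * (\<Sum>b\<in>B. D a b * D a' b) \<le> \<bar>\<Sum>b\<in>B. D a b * D a' b\<bar>" by simp
  qed
  finally show ?thesis by (simp add: mult_left_mono)
qed

section \<open>The structure around a typical vertex\<close>

text \<open>\<open>eta\<close> measures every error relative to the natural power of n. The weights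
  deg and codeg in the sums stay, because the certificate gives no information where they vanish.
  The bound 1/1000 leaves room for the absolute estimates, such as n/36 - eta n/12 \<ge> n/72 for
  common neighbours.\<close>

locale near_extremal =
  fixes G :: "'a graph" and u :: 'a and eta :: real
  assumes simple: "simple_graph G" and eta: "eta \<le> 1 / 1000" and nonempty: "num_verts G > 0"
    and u_deg: "\<bar>12 * deg G u - 5 * real (num_verts G)\<bar> \<le> eta * real (num_verts G)"
    and u_nbrs: "(\<Sum>w\<in>vertex_set G. of_bool (adj G w u) * \<bar>12 * deg G w - 5 * real (num_verts G)\<bar>) \<le> eta * real (num_verts G) ^ 2"
    and u_codeg: "(\<Sum>v\<in>vertex_set G. codeg G u v * \<bar>72 * codeg G u v - 25 * real (num_verts G)\<bar>) \<le> eta * real (num_verts G) ^ 3"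
    and tri: "triangles G \<le> eta * real (num_verts G) ^ 3"
    and degs: "(\<Sum>x\<in>vertex_set G. deg G x * \<bar>12 * deg G x - 5 * real (num_verts G)\<bar>) \<le> eta * real (num_verts G) ^ 3"
    and codegs: "(\<Sum>x\<in>vertex_set G. \<Sum>y\<in>vertex_set G. codeg G x y * \<bar>72 * codeg G x y - 25 * real (num_verts G)\<bar>)
      \<le> eta * real (num_verts G) ^ 4"
begin

abbreviation "V \<equiv> vertex_set G"
abbreviation "n \<equiv> real (num_verts G)"
abbreviation "E x y \<equiv> of_bool (adj G x y) :: real"

text \<open>The threshold 2n/9 = 16n/72 lies below the typical positive codegree 25n/72, so little
  codegree is lost outside \<open>A\<close>; and it exceeds half the degree of \<open>u\<close>,
  about 15n/72, so the neighbourhoods of two members must overlap inside that of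
  \<open>u\<close>.\<close>

definition "A = {v \<in> V. 2 * n \<le> 9 * codeg G u v}"
definition "B = V - A"
definition "dA y = (\<Sum>w\<in>A. E w y)"
definition "dB y = (\<Sum>w\<in>B. E w y)"

lemma n_pos: "n > 0" using nonempty by simp

lemma eta_nonneg: "eta \<ge> 0"
proof -
  have "0 \<le> eta * n" using u_deg by linarith
  then show ?thesis using n_pos by (simp add: zero_le_mult_iff)
qed

lemma fin: "finite V" "finite A" "finite B"
  using simple by (auto simp: simple_graph_def A_def B_def)

lemma AB: "A \<subseteq> V" "B \<subseteq> V" "A \<inter> B = {}" "A \<union> B = V"
  by (auto simp: A_def B_def)

lemma sum_AB: "sum f V = sum f A + sum f (B :: 'a set)" for f :: "'a \<Rightarrow> real"
  using sum.union_disjoint[OF fin(2,3) AB(3), of f] by (simp only: AB(4))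

lemma card_AB: "real (card A) + real (card B) = n"
  using card_Un_disjoint[OF fin(2,3) AB(3)] by (simp only: AB(4) of_nat_add)

lemma deg_split: "deg G x = dA x + dB x"
  by (simp only: deg_def dA_def dB_def sum_AB)

lemma dA_nonneg: "dA x \<ge> 0" and dB_nonneg: "dB x \<ge> 0" and dA_le: "dA x \<le> n"
proof -
  show A: "dA x \<ge> 0" and B: "dB x \<ge> 0" by (simp_all add: dA_def dB_def sum_nonneg)
  show "dA x \<le> n" using B deg_split[of x] sum_of_bool_bounds(2)[of "\<lambda>w. adj G w x" V] by (simp add: deg_def)
qed

lemma codeg_nonneg: "codeg G x y \<ge> 0" and deg_nonneg: "deg G x \<ge> 0"
  by (simp_all add: codeg_def deg_def sum_nonneg)

lemma codeg_le_deg: "codeg G x y \<le> deg G x" "codeg G x y \<le> deg G y"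
  unfolding codeg_def deg_def by (auto intro!: sum_mono)

lemma codeg_E: "codeg G x y = (\<Sum>w\<in>V. E w x * E w y)"
  by (simp add: codeg_def of_bool_conj)

section \<open>Sizes and inner edges of the two parts\<close>

lemma sum_codeg_u: "(\<Sum>v\<in>V. codeg G u v) = (\<Sum>w\<in>V. E w u * deg G w)"
proof -
  have "(\<Sum>v\<in>V. codeg G u v) = (\<Sum>w\<in>V. \<Sum>v\<in>V. E w u * E w v)"
    unfolding codeg_E by (rule sum.swap)
  also have "\<dots> = (\<Sum>w\<in>V. E w u * deg G w)"
    by (simp only: sum_distrib_left deg_def insert_commute)
  finally show ?thesis .
qed

text \<open>Counting walks of length two from \<open>u\<close> by their middle vertex gives about
  (5n/12)^2. The error 17 consists of 12 for the degrees of the neighbours and 5 for the degree of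
  \<open>u\<close>.\<close>

lemma sum_codeg_u_approx: "\<bar>144 * (\<Sum>v\<in>V. codeg G u v) - 25 * n\<^sup>2\<bar> \<le> 17 * (eta * n\<^sup>2)"
proof -
  have "12 * (\<Sum>v\<in>V. codeg G u v) - 5 * n * deg G u = (\<Sum>w\<in>V. E w u * (12 * deg G w - 5 * n))"
  proof -
    have "(\<Sum>w\<in>V. E w u * (12 * deg G w - 5 * n)) = (\<Sum>w\<in>V. 12 * (E w u * deg G w) - 5 * n * E w u)"
      by (intro sum.cong) (auto simp: algebra_simps)
    also have "\<dots> = 12 * (\<Sum>w\<in>V. E w u * deg G w) - 5 * n * deg G u"
      by (simp only: sum_subtractf sum_distrib_left[symmetric] deg_def)
    finally show ?thesis by (simp only: sum_codeg_u)
  qed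
  also have "\<bar>\<dots>\<bar> \<le> (\<Sum>w\<in>V. \<bar>E w u * (12 * deg G w - 5 * n)\<bar>)" by (rule sum_abs)
  also have "\<dots> = (\<Sum>w\<in>V. E w u * \<bar>12 * deg G w - 5 * n\<bar>)" by (simp add: abs_mult)
  also have "\<dots> \<le> eta * n\<^sup>2" by (rule u_nbrs)
  finally have 1: "\<bar>12 * (\<Sum>v\<in>V. codeg G u v) - 5 * n * deg G u\<bar> \<le> eta * n\<^sup>2" .
  have "5 * n * \<bar>12 * deg G u - 5 * n\<bar> \<le> 5 * n * (eta * n)"
    by (rule mult_left_mono[OF u_deg]) simp
  then have 2: "\<bar>5 * n * (12 * deg G u - 5 * n)\<bar> \<le> 5 * n * (eta * n)"
    by (simp add: abs_mult)
  have "144 * (\<Sum>v\<in>V. codeg G u v) - 25 * n\<^sup>2 =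
      12 * (12 * (\<Sum>v\<in>V. codeg G u v) - 5 * n * deg G u) + 5 * n * (12 * deg G u - 5 * n)"
    by (simp add: algebra_simps power2_eq_square)
  moreover have "5 * n * (eta * n) = 5 * (eta * n\<^sup>2)" by (simp add: power2_eq_square)
  ultimately show ?thesis using 1 2 unfolding ring_distribs by linarith
qed

text \<open>On \<open>A\<close> the weight codeg is at least 2n/9 and can be divided out.\<close>

lemma A_codeg: "(\<Sum>v\<in>A. \<bar>72 * codeg G u v - 25 * n\<bar>) \<le> 9 / 2 * (eta * n\<^sup>2)"
proof -
  have "2 * n * (\<Sum>v\<in>A. \<bar>72 * codeg G u v - 25 * n\<bar>) = (\<Sum>v\<in>A. 2 * n * \<bar>72 * codeg G u v - 25 * n\<bar>)"
    by (rule sum_distrib_left)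
  also have "\<dots> \<le> (\<Sum>v\<in>A. 9 * codeg G u v * \<bar>72 * codeg G u v - 25 * n\<bar>)"
    by (intro sum_mono mult_right_mono) (auto simp: A_def)
  also have "\<dots> = 9 * (\<Sum>v\<in>A. codeg G u v * \<bar>72 * codeg G u v - 25 * n\<bar>)"
    by (simp only: sum_distrib_left mult.assoc)
  also have "\<dots> \<le> 9 * (\<Sum>v\<in>V. codeg G u v * \<bar>72 * codeg G u v - 25 * n\<bar>)"
    by (intro mult_left_mono sum_mono2 fin AB mult_nonneg_nonneg codeg_nonneg) auto
  also have "\<dots> \<le> 9 * (eta * n ^ 3)" using u_codeg by simp
  also have "\<dots> = 2 * n * (9 / 2 * (eta * n\<^sup>2))" by (simp add: eval_nat_numeral)
  finally show ?thesis by (rule mult_left_le_imp_le) (use n_pos in simp)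
qed

text \<open>Below the threshold 16n/72 the deviation 25n - 72 codeg is at least 9n, so the codegree
  itself is paid for.\<close>

lemma B_codeg: "(\<Sum>v\<in>B. codeg G u v) \<le> eta * n\<^sup>2 / 9"
proof -
  have "9 * n * (\<Sum>v\<in>B. codeg G u v) = (\<Sum>v\<in>B. codeg G u v * (9 * n))"
    by (simp add: sum_distrib_left mult_ac)
  also have "\<dots> \<le> (\<Sum>v\<in>B. codeg G u v * \<bar>72 * codeg G u v - 25 * n\<bar>)"
    by (intro sum_mono mult_left_mono codeg_nonneg) (auto simp: A_def B_def)
  also have "\<dots> \<le> (\<Sum>v\<in>V. codeg G u v * \<bar>72 * codeg G u v - 25 * n\<bar>)"
    by (intro sum_mono2 fin AB mult_nonneg_nonneg codeg_nonneg) auto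
  also have "\<dots> \<le> eta * n ^ 3" by (rule u_codeg)
  also have "\<dots> = 9 * n * (eta * n\<^sup>2 / 9)" by (simp add: eval_nat_numeral)
  finally show ?thesis by (rule mult_left_le_imp_le) (use n_pos in simp)
qed

text \<open>Nearly all of the total codegree 25 n^2 / 144 falls on \<open>A\<close>, where a term is
  about 25n/72, so there are about n/2 terms. The errors 9/2 + 8 + 17/2 = 21 are rounded up to 25 so
  that the factor 25n cancels.\<close>

lemma card_A_approx: "\<bar>real (card A) - n / 2\<bar> \<le> eta * n"
proof -
  have "\<bar>72 * (\<Sum>v\<in>A. codeg G u v) - 25 * n * real (card A)\<bar> = \<bar>\<Sum>v\<in>A. 72 * codeg G u v - 25 * n\<bar>"
    unfolding sum_subtractf sum_distrib_left[symmetric] by (simp add: mult_ac)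
  also have "\<dots> \<le> 9 / 2 * (eta * n\<^sup>2)" by (rule order.trans[OF sum_abs A_codeg])
  finally have 1: "\<bar>72 * (\<Sum>v\<in>A. codeg G u v) - 25 * n * real (card A)\<bar> \<le> 9 / 2 * (eta * n\<^sup>2)" .
  have 2: "0 \<le> (\<Sum>v\<in>B. codeg G u v)" by (intro sum_nonneg codeg_nonneg)
  have 3: "0 \<le> eta * n\<^sup>2" using eta_nonneg by simp
  have "\<bar>25 * n * real (card A) - 25 / 2 * n\<^sup>2\<bar> \<le> 25 * (eta * n\<^sup>2)"
    using 1 2 3 sum_codeg_u_approx B_codeg unfolding sum_AB ring_distribs by linarith
  moreover have "25 * n * real (card A) - 25 / 2 * n\<^sup>2 = 25 * n * (real (card A) - n / 2)"
    by (simp add: power2_eq_square algebra_simps)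
  ultimately have "\<bar>25 * n * (real (card A) - n / 2)\<bar> \<le> 25 * (eta * n\<^sup>2)" by (simp only:)
  moreover have "\<bar>25 * n * (real (card A) - n / 2)\<bar> = 25 * n * \<bar>real (card A) - n / 2\<bar>"
    unfolding abs_mult by simp
  moreover have "25 * (eta * n\<^sup>2) = 25 * n * (eta * n)" by (simp add: power2_eq_square)
  ultimately have "25 * n * \<bar>real (card A) - n / 2\<bar> \<le> 25 * n * (eta * n)" by (simp only:)
  then show ?thesis by (rule mult_left_le_imp_le) (use n_pos in simp)
qed

lemma edges_A: "(\<Sum>y\<in>A. dA y) \<le> 72 * (eta * n\<^sup>2)"
proof -
  \<comment> \<open>Inclusion-exclusion inside the neighbourhood of \<open>u\<close>: 2n/9 + 2n/9 -
    (5 + eta) n/12 = n/36 - eta n/12.\<close>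
  have c: "n / 72 \<le> codeg G x y" if "x \<in> A" "y \<in> A" for x y
  proof -
    have "codeg G u x + codeg G u y - deg G u \<le> codeg G x y"
        unfolding codeg_def deg_def sum.distrib[symmetric] sum_subtractf[symmetric] by (intro sum_mono) auto
    moreover have "2 * n \<le> 9 * codeg G u x" "2 * n \<le> 9 * codeg G u y" using that by (auto simp: A_def)
    moreover have "12 * deg G u \<le> 5 * n + eta * n" using u_deg by linarith
    moreover have "eta * n \<le> 1 / 1000 * n" by (rule mult_right_mono[OF eta]) simp
    ultimately show ?thesis using n_pos by linarith
  qed
  have "n / 72 * (\<Sum>y\<in>A. dA y) = (\<Sum>y\<in>A. \<Sum>x\<in>A. E x y * (n / 72))"
    by (simp only: dA_def sum_distrib_left mult.commute)
  also have "\<dots> \<le> (\<Sum>y\<in>A. \<Sum>x\<in>A. E x y * codeg G x y)"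
    by (intro sum_mono mult_left_mono c) auto
  also have "\<dots> \<le> (\<Sum>y\<in>V. \<Sum>x\<in>V. E x y * codeg G x y)"
    by (intro order.trans[OF sum_mono[OF sum_mono2] sum_mono2] fin AB sum_nonneg mult_nonneg_nonneg codeg_nonneg) auto
  also have "\<dots> = (\<Sum>y\<in>V. \<Sum>x\<in>V. \<Sum>z\<in>V. of_bool (adj G y x \<and> adj G y z \<and> adj G x z))"
    by (simp only: codeg_def sum_distrib_left of_bool_conj[symmetric] conj_ac insert_commute)
  also have "\<dots> = triangles G" by (simp only: triangles_def)
  also have "\<dots> \<le> eta * n ^ 3" by (rule tri)
  also have "\<dots> = n / 72 * (72 * (eta * n\<^sup>2))" by (simp add: eval_nat_numeral)
  finally show ?thesis by (rule mult_left_le_imp_le) (use n_pos in simp)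
qed

lemma A_deg: "(\<Sum>a\<in>A. \<bar>12 * deg G a - 5 * n\<bar>) \<le> 9 / 2 * (eta * n\<^sup>2)"
proof -
  have d: "2 * n \<le> 9 * deg G a" if "a \<in> A" for a
    using that codeg_le_deg(2)[of u a] by (simp add: A_def)
  have "2 * n * (\<Sum>a\<in>A. \<bar>12 * deg G a - 5 * n\<bar>) = (\<Sum>a\<in>A. 2 * n * \<bar>12 * deg G a - 5 * n\<bar>)"
    by (rule sum_distrib_left)
  also have "\<dots> \<le> (\<Sum>a\<in>A. 9 * deg G a * \<bar>12 * deg G a - 5 * n\<bar>)"
    by (intro sum_mono mult_right_mono d) auto
  also have "\<dots> = 9 * (\<Sum>a\<in>A. deg G a * \<bar>12 * deg G a - 5 * n\<bar>)"
    by (simp only: sum_distrib_left mult.assoc)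
  also have "\<dots> \<le> 9 * (\<Sum>a\<in>V. deg G a * \<bar>12 * deg G a - 5 * n\<bar>)"
    by (intro mult_left_mono sum_mono2 fin AB mult_nonneg_nonneg deg_nonneg) auto
  also have "\<dots> \<le> 9 * (eta * n ^ 3)" using degs by simp
  also have "\<dots> = 2 * n * (9 / 2 * (eta * n\<^sup>2))" by (simp add: eval_nat_numeral)
  finally show ?thesis by (rule mult_left_le_imp_le) (use n_pos in simp)
qed

text \<open>Few edges stay inside \<open>A\<close>, so almost the whole degree 5n/12 of a typical
  vertex of \<open>A\<close> goes to \<open>B\<close>, which has about n/2 vertices: it meets 5/6 of
  them.\<close>

lemma A_dB: "(\<Sum>a\<in>A. \<bar>6 * dB a - 5 * real (card B)\<bar>) \<le> 440 * (eta * n\<^sup>2)"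
proof -
  have "(\<Sum>a\<in>A. \<bar>12 * dB a - 10 * real (card B)\<bar>) \<le>
      (\<Sum>a\<in>A. \<bar>12 * deg G a - 5 * n\<bar> + 12 * dA a + 10 * (eta * n))"
  proof (rule sum_mono)
    fix a assume "a \<in> A"
    have "\<bar>5 * n - 10 * real (card B)\<bar> \<le> 10 * (eta * n)" using card_A_approx card_AB by linarith
    then show "\<bar>12 * dB a - 10 * real (card B)\<bar> \<le> \<bar>12 * deg G a - 5 * n\<bar> + 12 * dA a + 10 * (eta * n)"
      using deg_split[of a] dA_nonneg[of a] by linarith
  qed
  also have "\<dots> = (\<Sum>a\<in>A. \<bar>12 * deg G a - 5 * n\<bar>) + 12 * (\<Sum>a\<in>A. dA a) + real (card A) * (10 * (eta * n))"
    by (simp only: sum.distrib sum_distrib_left sum_constant)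
  also have "real (card A) * (10 * (eta * n)) \<le> n * (10 * (eta * n))"
    by (rule mult_right_mono) (use card_AB eta_nonneg in auto)
  also have "n * (10 * (eta * n)) = 10 * (eta * n\<^sup>2)" by (simp add: power2_eq_square)
  also have "(\<Sum>a\<in>A. \<bar>12 * dB a - 10 * real (card B)\<bar>) = 2 * (\<Sum>a\<in>A. \<bar>6 * dB a - 5 * real (card B)\<bar>)"
  proof -
    have "\<bar>12 * dB a - 10 * real (card B)\<bar> = 2 * \<bar>6 * dB a - 5 * real (card B)\<bar>" for a by (simp add: abs_if)
    then show ?thesis by (simp only: sum_distrib_left)
  qed
  finally show ?thesis using A_deg edges_A eta_nonneg zero_le_power2[of n] mult_nonneg_nonneg[OF eta_nonneg zero_le_power2[of n]] by linarith
qed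

definition "cB a b = (\<Sum>w\<in>B. E w a * E w b)"

lemma sum_dA_B: "(\<Sum>y\<in>B. dA y) = (\<Sum>a\<in>A. dB a)"
  unfolding dA_def dB_def by (subst sum.swap) (simp only: insert_commute)

lemma edges_AB: "5 / 2 * n\<^sup>2 - 874 * (eta * n\<^sup>2) \<le> 12 * (\<Sum>a\<in>A. dB a)"
proof -
  have "\<bar>\<Sum>a\<in>A. 12 * deg G a - 5 * n\<bar> \<le> 9 / 2 * (eta * n\<^sup>2)"
    by (rule order.trans[OF sum_abs A_deg])
  also have "(\<Sum>a\<in>A. 12 * deg G a - 5 * n) = 12 * ((\<Sum>a\<in>A. dA a) + (\<Sum>a\<in>A. dB a)) - 5 * (n * real (card A))"
    unfolding sum_subtractf sum_distrib_left[symmetric] deg_split sum.distrib by simp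
  finally have "5 * (n * real (card A)) - 12 * ((\<Sum>a\<in>A. dA a) + (\<Sum>a\<in>A. dB a)) \<le> 9 / 2 * (eta * n\<^sup>2)" by linarith
  moreover have "n * (n / 2 - eta * n) \<le> n * real (card A)"
    by (rule mult_left_mono) (use card_A_approx in auto)
  then have "n\<^sup>2 / 2 - eta * n\<^sup>2 \<le> n * real (card A)" by (simp add: power2_eq_square algebra_simps)
  ultimately show ?thesis using edges_A mult_nonneg_nonneg[OF eta_nonneg zero_le_power2[of n]] unfolding ring_distribs by linarith
qed

text \<open>Vertices of \<open>B\<close> have no lower bound on their degree, so only the upper
  bound 5n/12 on the average is available. It suffices: the edges to \<open>A\<close> already use
  about 5 n^2 / 24, which is all of (n/2)(5n/12).\<close>

lemma edges_B: "(\<Sum>y\<in>B. dB y) \<le> 74 * (eta * n\<^sup>2)"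
proof -
  \<comment> \<open>The one-sided form of the degree estimate: if 12 deg \<ge> 5n, the weight deg
    can be replaced by 5n/12; otherwise the left side is not positive.\<close>
  have d: "5 * n * (12 * deg G y - 5 * n) \<le> 12 * (deg G y * \<bar>12 * deg G y - 5 * n\<bar>)" for y
  proof (cases "5 * n \<le> 12 * deg G y")
    case True
    then have "5 * n * (12 * deg G y - 5 * n) \<le> 12 * deg G y * (12 * deg G y - 5 * n)"
      by (intro mult_right_mono) auto
    with True show ?thesis by (simp add: mult.assoc)
  next
    case False
    then have "5 * n * (12 * deg G y - 5 * n) \<le> 0" using n_pos by (simp add: mult_le_0_iff)
    also have "0 \<le> 12 * (deg G y * \<bar>12 * deg G y - 5 * n\<bar>)" using deg_nonneg by simp
    finally show ?thesis .
  qed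
  have "5 * n * (\<Sum>y\<in>B. 12 * deg G y - 5 * n) = (\<Sum>y\<in>B. 5 * n * (12 * deg G y - 5 * n))"
    by (rule sum_distrib_left)
  also have "\<dots> \<le> (\<Sum>y\<in>B. 12 * (deg G y * \<bar>12 * deg G y - 5 * n\<bar>))" by (rule sum_mono[OF d])
  also have "\<dots> \<le> (\<Sum>y\<in>V. 12 * (deg G y * \<bar>12 * deg G y - 5 * n\<bar>))"
    by (intro sum_mono2 fin AB mult_nonneg_nonneg deg_nonneg) auto
  also have "\<dots> \<le> 12 * (eta * n ^ 3)" unfolding sum_distrib_left[symmetric] using degs by simp
  also have "\<dots> = 5 * n * (12 / 5 * (eta * n\<^sup>2))" by (simp add: eval_nat_numeral)
  finally have "(\<Sum>y\<in>B. 12 * deg G y - 5 * n) \<le> 12 / 5 * (eta * n\<^sup>2)"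
    by (rule mult_left_le_imp_le) (use n_pos in simp)
  also have "(\<Sum>y\<in>B. 12 * deg G y - 5 * n) = 12 * ((\<Sum>a\<in>A. dB a) + (\<Sum>y\<in>B. dB y)) - 5 * (n * real (card B))"
    unfolding sum_subtractf sum_distrib_left[symmetric] deg_split sum.distrib sum_dA_B by simp
  finally have "12 * ((\<Sum>a\<in>A. dB a) + (\<Sum>y\<in>B. dB y)) \<le> 5 * (n * real (card B)) + 12 / 5 * (eta * n\<^sup>2)" by linarith
  moreover have "n * real (card B) \<le> n * (n / 2 + eta * n)"
    by (rule mult_left_mono) (use card_A_approx card_AB in linarith)+
  then have "n * real (card B) \<le> n\<^sup>2 / 2 + eta * n\<^sup>2" by (simp add: power2_eq_square algebra_simps)
  ultimately show ?thesis using edges_AB mult_nonneg_nonneg[OF eta_nonneg zero_le_power2[of n]] unfolding ring_distribs by linarith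
qed

section \<open>Second moment of the codegrees inside A\<close>

lemma sum_sq: "(\<Sum>a\<in>A. \<Sum>b\<in>A. \<Sum>w\<in>S. E w a * E w b) = (\<Sum>w\<in>S. (dA w)\<^sup>2)"
proof -
  have "(\<Sum>a\<in>A. \<Sum>b\<in>A. \<Sum>w\<in>S. E w a * E w b) = (\<Sum>w\<in>S. \<Sum>a\<in>A. \<Sum>b\<in>A. E w a * E w b)"
    by (rule sym, rule trans[OF sum.swap sum.cong[OF refl sum.swap]])
  also have "\<dots> = (\<Sum>w\<in>S. (dA w)\<^sup>2)"
    by (simp only: power2_eq_square dA_def sum_product insert_commute)
  finally show ?thesis .
qed

lemma codeg_split: "codeg G a b = (\<Sum>w\<in>A. E w a * E w b) + cB a b"
  unfolding codeg_E cB_def by (rule sum_AB)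

lemma sum_cA: "(\<Sum>a\<in>A. \<Sum>b\<in>A. \<Sum>w\<in>A. E w a * E w b) \<le> 72 * (eta * n ^ 3)"
proof -
  have "(\<Sum>w\<in>A. (dA w)\<^sup>2) \<le> (\<Sum>w\<in>A. n * dA w)"
    unfolding power2_eq_square by (intro sum_mono mult_right_mono dA_le dA_nonneg)
  also have "\<dots> \<le> n * (72 * (eta * n\<^sup>2))"
    unfolding sum_distrib_left[symmetric] by (rule mult_left_mono[OF edges_A]) simp
  finally show ?thesis by (simp add: sum_sq eval_nat_numeral mult_ac)
qed

lemma card_bounds: "n / 3 \<le> real (card A)" "n / 3 \<le> real (card B)" "real (card A) \<le> n" "real (card B) \<le> n"
    "real (card B) \<le> n / 2 + eta * n" "real (card A) \<le> n / 2 + eta * n"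
proof -
  have "eta * n \<le> 1 / 1000 * n" by (rule mult_right_mono[OF eta]) simp
  then show "n / 3 \<le> real (card A)" "n / 3 \<le> real (card B)" "real (card A) \<le> n" "real (card B) \<le> n"
    "real (card B) \<le> n / 2 + eta * n" "real (card A) \<le> n / 2 + eta * n"
    using card_A_approx card_AB n_pos by linarith+
qed

text \<open>By convexity the number of walks from \<open>A\<close> through \<open>B\<close> back to
  \<open>A\<close> is least when the edges are spread evenly over \<open>B\<close>: about (5/24)^2 /
  (1/2) = 25/288 in units of n^3.\<close>

lemma sum_cB: "25 / 288 * n ^ 3 - 62 * (eta * n ^ 3) \<le> (\<Sum>a\<in>A. \<Sum>b\<in>A. cB a b)"
proof -
  define S where "S = (\<Sum>a\<in>A. \<Sum>b\<in>A. cB a b) / n ^ 3"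
  define e where "e = (\<Sum>a\<in>A. dB a) / n\<^sup>2"
  define b where "b = real (card B) / n"
  have S0: "S \<ge> 0" unfolding S_def cB_def by (intro divide_nonneg_nonneg sum_nonneg) auto
  have "(\<Sum>a\<in>A. dB a)\<^sup>2 \<le> (\<Sum>y\<in>B. (dA y)\<^sup>2) * real (card B)"
    unfolding sum_dA_B[symmetric] by (rule sum_squared_le_sum_of_squares)
  then have "(\<Sum>a\<in>A. dB a)\<^sup>2 \<le> (\<Sum>a\<in>A. \<Sum>b\<in>A. cB a b) * real (card B)"
    by (simp only: cB_def sum_sq)
  then have "(\<Sum>a\<in>A. dB a)\<^sup>2 / n ^ 4 \<le> (\<Sum>a\<in>A. \<Sum>b\<in>A. cB a b) * real (card B) / n ^ 4"
    by (rule divide_right_mono) simp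
  then have eb: "e\<^sup>2 \<le> S * b"
    by (simp add: e_def S_def b_def power_divide eval_nat_numeral)
  have "(5 / 24 - 73 * eta) * n\<^sup>2 \<le> (\<Sum>a\<in>A. dB a)"
    using edges_AB mult_nonneg_nonneg[OF eta_nonneg zero_le_power2[of n]] by (simp add: algebra_simps)
  then have e: "5 / 24 - 73 * eta \<le> e" using n_pos by (simp add: e_def le_divide_eq)
  have b: "b \<le> 1 / 2 + eta" using card_bounds(5) n_pos by (simp add: b_def divide_le_eq algebra_simps)
  \<comment> \<open>With 62 the linear coefficient of the comparison below is 143/288; with 61 it
    would be negative.\<close>
  have "25 / 288 - 62 * eta \<le> S"
  proof (rule ccontr)
    assume "\<not> ?thesis"
    then have S: "S < 25 / 288 - 62 * eta" by simp
    have "(5 / 24 - 73 * eta)\<^sup>2 \<le> e\<^sup>2" using e eta by (intro power_mono) auto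
    also note eb
    also have "S * b \<le> S * (1 / 2 + eta)" by (rule mult_left_mono[OF b S0])
    also have "\<dots> < (25 / 288 - 62 * eta) * (1 / 2 + eta)"
      by (rule mult_strict_right_mono[OF S]) (use eta_nonneg in linarith)
    finally have "(5 / 24 - 73 * eta)\<^sup>2 < (25 / 288 - 62 * eta) * (1 / 2 + eta)" .
    moreover have "(5 / 24 - 73 * eta)\<^sup>2 - (25 / 288 - 62 * eta) * (1 / 2 + eta) = 5391 * eta\<^sup>2 + (143 / 288) * eta"
      by (simp add: power2_eq_square field_simps)
    ultimately show False using eta_nonneg zero_le_power2[of eta] by linarith
  qed
  then have "(25 / 288 - 62 * eta) * n ^ 3 \<le> S * n ^ 3" by (rule mult_right_mono) simp
  then show ?thesis using n_pos by (simp add: S_def left_diff_distrib)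
qed

text \<open>The weighted estimate allows codegrees near 25n/72 and near 0; an average that is almost
  25n/72 excludes 0 on most pairs. With c the codegree, (72c - 25n)^2 = 72 c (72c - 25n) - 25n (72c
  - 25n): the sum of the first term is small by \<open>codegs\<close>, and that of 72c - 25n is
  bounded below through \<open>sum_cB\<close>. Cauchy-Schwarz then costs the square root of
  eta.\<close>

lemma AA_codeg: "(\<Sum>a\<in>A. \<Sum>b\<in>A. \<bar>72 * codeg G a b - 25 * n\<bar>) \<le> 337 * (sqrt eta * n ^ 3)"
proof -
  define S where "S = (\<Sum>a\<in>A. \<Sum>b\<in>A. codeg G a b)"
  define Q where "Q = (\<Sum>a\<in>A. \<Sum>b\<in>A. (72 * codeg G a b - 25 * n)\<^sup>2)"
  have S: "25 / 288 * n ^ 3 - 62 * (eta * n ^ 3) \<le> S"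
    unfolding S_def by (rule order.trans[OF sum_cB]) (intro sum_mono, simp add: codeg_split sum_nonneg)
  have "real (card A) ^ 2 \<le> (n / 2 + eta * n)\<^sup>2" by (rule power_mono[OF card_bounds(6)]) simp
  also have "\<dots> = n\<^sup>2 * (1 / 4 + eta * (1 + eta))" by (simp add: power2_eq_square algebra_simps)
  also have "\<dots> \<le> n\<^sup>2 * (1 / 4 + eta * (1 + 1))"
    by (intro mult_left_mono add_left_mono) (use eta eta_nonneg in auto)
  finally have "25 * n * real (card A) ^ 2 \<le> 25 * n * (n\<^sup>2 * (1 / 4 + eta * (1 + 1)))" by (rule mult_left_mono) simp
  then have A2: "25 * n * real (card A) ^ 2 \<le> 25 / 4 * n ^ 3 + 50 * (eta * n ^ 3)"
    by (simp add: eval_nat_numeral algebra_simps)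
  have "Q = (\<Sum>a\<in>A. \<Sum>b\<in>A. 72 * (codeg G a b * (72 * codeg G a b - 25 * n)) - 25 * n * (72 * codeg G a b - 25 * n))"
    unfolding Q_def by (intro sum.cong refl) (simp add: power2_eq_square algebra_simps)
  also have "\<dots> = 72 * (\<Sum>a\<in>A. \<Sum>b\<in>A. codeg G a b * (72 * codeg G a b - 25 * n)) - 25 * n * (\<Sum>a\<in>A. \<Sum>b\<in>A. 72 * codeg G a b - 25 * n)"
    by (subst sum_subtractf, subst sum_subtractf) (simp only: sum_distrib_left[symmetric])
  also have "(\<Sum>a\<in>A. \<Sum>b\<in>A. 72 * codeg G a b - 25 * n) = 72 * S - 25 * n * real (card A) ^ 2"
    by (simp add: S_def sum_subtractf sum_distrib_left power2_eq_square)
  also have "(\<Sum>a\<in>A. \<Sum>b\<in>A. codeg G a b * (72 * codeg G a b - 25 * n)) \<le> (\<Sum>a\<in>A. \<Sum>b\<in>A. codeg G a b * \<bar>72 * codeg G a b - 25 * n\<bar>)"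
    by (intro sum_mono mult_left_mono codeg_nonneg) auto
  also have "\<dots> \<le> (\<Sum>a\<in>V. \<Sum>b\<in>V. codeg G a b * \<bar>72 * codeg G a b - 25 * n\<bar>)"
    by (intro order.trans[OF sum_mono[OF sum_mono2] sum_mono2] fin AB sum_nonneg mult_nonneg_nonneg codeg_nonneg) auto
  also have "\<dots> \<le> eta * n ^ 4" by (rule codegs)
  finally have "Q \<le> 72 * (eta * n ^ 4) - 25 * n * (72 * S - 25 * n * real (card A) ^ 2)" by simp
  moreover have "25 * n * (- 4536 * (eta * n ^ 3)) \<le> 25 * n * (72 * S - 25 * n * real (card A) ^ 2)"
    by (rule mult_left_mono) (use A2 S mult_nonneg_nonneg[OF eta_nonneg zero_le_power[of n 3]] in \<open>simp, linarith\<close>)+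
  then have "- 113400 * (eta * n ^ 4) \<le> 25 * n * (72 * S - 25 * n * real (card A) ^ 2)"
    by (simp add: eval_nat_numeral mult_ac)
  ultimately have Q: "Q \<le> 113472 * (eta * n ^ 4)" by linarith
  have Q0: "Q \<ge> 0" unfolding Q_def by (intro sum_nonneg) simp
  have "(\<Sum>a\<in>A. \<Sum>b\<in>A. \<bar>72 * codeg G a b - 25 * n\<bar>)\<^sup>2 = (\<Sum>p\<in>A \<times> A. \<bar>72 * codeg G (fst p) (snd p) - 25 * n\<bar>)\<^sup>2"
    by (simp add: sum.cartesian_product case_prod_unfold)
  also have "\<dots> \<le> (\<Sum>p\<in>A \<times> A. \<bar>72 * codeg G (fst p) (snd p) - 25 * n\<bar>\<^sup>2) * real (card (A \<times> A))"
    by (rule sum_squared_le_sum_of_squares)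
  also have "\<dots> = Q * real (card A) ^ 2"
    by (simp add: Q_def sum.cartesian_product case_prod_unfold card_cartesian_product power2_eq_square)
  also have "\<dots> \<le> (113472 * (eta * n ^ 4)) * n\<^sup>2"
    by (intro mult_mono Q power_mono card_bounds) (use eta_nonneg in auto)
  also have "\<dots> = 113472 * (eta * n ^ 6)" by (simp add: eval_nat_numeral)
  \<comment> \<open>113569 = 337^2 is the first square above 113472.\<close>
  also have "\<dots> \<le> 113569 * (eta * n ^ 6)" by (rule mult_right_mono) (use eta_nonneg in auto)
  also have "\<dots> = (337 * (sqrt eta * n ^ 3))\<^sup>2"
    using eta_nonneg by (simp add: power_mult_distrib flip: power_mult)
  finally show ?thesis
    by (rule power2_le_imp_le) (use eta_nonneg in simp)
qed

text \<open>Expanding the row correlation leaves the deviation of the common neighbours in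
  \<open>B\<close> from 25/36 |B| and the deviations of the two degrees from 5/6 |B|. Each has
  already been bounded in sum over \<open>A\<close>.\<close>

lemma sum_K: "(\<Sum>a\<in>A. \<Sum>b\<in>A. \<bar>\<Sum>w\<in>B. (E w a - 5 / 6) * (E w b - 5 / 6)\<bar>) \<le> 200 * (sqrt eta * n ^ 3)"
proof -
  let ?K = "\<lambda>a b. \<Sum>w\<in>B. (E w a - 5 / 6) * (E w b - 5 / 6)"
  let ?h = "\<lambda>a. \<bar>6 * dB a - 5 * real (card B)\<bar>"
  have K: "72 * ?K a b = (72 * cB a b - 50 * real (card B)) - 10 * (6 * dB a - 5 * real (card B)) - 10 * (6 * dB b - 5 * real (card B))" for a b
  proof -
    have "?K a b = (\<Sum>w\<in>B. E w a * E w b - 5 / 6 * E w a - 5 / 6 * E w b + 25 / 36)"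
      by (intro sum.cong refl) (simp add: algebra_simps)
    also have "\<dots> = cB a b - 5 / 6 * dB a - 5 / 6 * dB b + 25 / 36 * real (card B)"
      by (simp only: sum.distrib sum_subtractf sum_distrib_left[symmetric] cB_def dB_def sum_constant mult.commute)
    finally show ?thesis by simp
  qed
  have "72 * \<bar>?K a b\<bar> \<le> \<bar>72 * codeg G a b - 25 * n\<bar> + 72 * (\<Sum>w\<in>A. E w a * E w b) + 50 * (eta * n) + 10 * ?h a + 10 * ?h b" for a b
  proof -
    have "0 \<le> (\<Sum>w\<in>A. E w a * E w b)" by (simp add: sum_nonneg)
    moreover have "\<bar>25 * n - 50 * real (card B)\<bar> \<le> 50 * (eta * n)" using card_A_approx card_AB by linarith
    ultimately have "\<bar>72 * cB a b - 50 * real (card B)\<bar> \<le> \<bar>72 * codeg G a b - 25 * n\<bar> + 72 * (\<Sum>w\<in>A. E w a * E w b) + 50 * (eta * n)"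
      using codeg_split[of a b] by linarith
    then show ?thesis using K[of a b] by (simp add: abs_if split: if_splits)
  qed
  then have "(\<Sum>a\<in>A. \<Sum>b\<in>A. 72 * \<bar>?K a b\<bar>) \<le>
    (\<Sum>a\<in>A. \<Sum>b\<in>A. \<bar>72 * codeg G a b - 25 * n\<bar> + 72 * (\<Sum>w\<in>A. E w a * E w b) + 50 * (eta * n) + 10 * ?h a + 10 * ?h b)"
    by (intro sum_mono)
  also have "\<dots> = (\<Sum>a\<in>A. \<Sum>b\<in>A. \<bar>72 * codeg G a b - 25 * n\<bar>) + 72 * (\<Sum>a\<in>A. \<Sum>b\<in>A. \<Sum>w\<in>A. E w a * E w b)
      + real (card A) ^ 2 * (50 * (eta * n)) + 20 * (real (card A) * (\<Sum>a\<in>A. ?h a))"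
    by (simp add: sum.distrib sum_distrib_left[symmetric] power2_eq_square)
  also have "\<dots> \<le> 337 * (sqrt eta * n ^ 3) + 72 * (72 * (eta * n ^ 3)) + n\<^sup>2 * (50 * (eta * n)) + 20 * (n * (440 * (eta * n\<^sup>2)))"
    by (intro add_mono AA_codeg mult_left_mono sum_cA mult_right_mono power_mono card_bounds mult_mono A_dB)
      (use eta_nonneg in auto)
  also have "\<dots> = 337 * (sqrt eta * n ^ 3) + 14034 * (eta * n ^ 3)" by (simp add: eval_nat_numeral)
  also have "eta * n ^ 3 \<le> sqrt eta * n ^ 3"
  proof (rule mult_right_mono)
    have "eta * eta \<le> 1 * eta" by (rule mult_right_mono) (use eta eta_nonneg in auto)
    then show "eta \<le> sqrt eta" by (intro real_le_rsqrt) (simp add: power2_eq_square)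
  qed simp
  finally have "72 * (\<Sum>a\<in>A. \<Sum>b\<in>A. \<bar>?K a b\<bar>) \<le> 14371 * (sqrt eta * n ^ 3)"
    by (simp add: sum_distrib_left)
  moreover have "0 \<le> sqrt eta * n ^ 3" using eta_nonneg by simp
  ultimately show ?thesis by linarith
qed

text \<open>16200 = 200 * 81: the factor 81 arises when n^4 is replaced by (|A| |B|)^2, both parts
  having at least n/3 vertices.\<close>

lemma cut_bound:
  assumes f: "\<And>a. 0 \<le> f a \<and> f a \<le> 1" and g: "\<And>b. 0 \<le> g b \<and> g b \<le> (1::real)"
  shows "\<bar>\<Sum>a\<in>A. \<Sum>b\<in>B. f a * g b * (E a b - 5 / 6)\<bar> \<le> sqrt (16200 * sqrt eta) * (real (card A) * real (card B))"
proof -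
  have "(\<Sum>a\<in>A. \<Sum>b\<in>B. f a * g b * (E a b - 5 / 6))\<^sup>2 \<le>
      real (card B) * (\<Sum>a\<in>A. \<Sum>a'\<in>A. \<bar>\<Sum>b\<in>B. (E a b - 5 / 6) * (E a' b - 5 / 6)\<bar>)"
    by (rule cut_norm_le[OF f g])
  also have "(\<Sum>a\<in>A. \<Sum>a'\<in>A. \<bar>\<Sum>b\<in>B. (E a b - 5 / 6) * (E a' b - 5 / 6)\<bar>) =
      (\<Sum>a\<in>A. \<Sum>a'\<in>A. \<bar>\<Sum>b\<in>B. (E b a - 5 / 6) * (E b a' - 5 / 6)\<bar>)"
    by (simp only: insert_commute)
  also have "real (card B) * \<dots> \<le> n * (200 * (sqrt eta * n ^ 3))"
    by (intro mult_mono card_bounds sum_K sum_nonneg) auto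
  also have "\<dots> = 16200 * sqrt eta * ((n / 3) * (n / 3))\<^sup>2" by (simp add: eval_nat_numeral)
  also have "\<dots> \<le> 16200 * sqrt eta * (real (card A) * real (card B))\<^sup>2"
    by (intro mult_left_mono power_mono mult_mono card_bounds) (use eta_nonneg in auto)
  also have "\<dots> = (sqrt (16200 * sqrt eta) * (real (card A) * real (card B)))\<^sup>2"
    using eta_nonneg by (simp add: power_mult_distrib)
  finally have "\<bar>\<Sum>a\<in>A. \<Sum>b\<in>B. f a * g b * (E a b - 5 / 6)\<bar>\<^sup>2 \<le> (sqrt (16200 * sqrt eta) * (real (card A) * real (card B)))\<^sup>2"
    by simp
  then show ?thesis by (rule power2_le_imp_le) (use eta_nonneg in simp)
qed

section \<open>Passing to the bipartite graph\<close>

definition "H = (V, {e \<in> edge_set G. \<exists>a\<in>A. \<exists>b\<in>B. e = {a, b}})"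

lemma adj_H: "a \<in> A \<Longrightarrow> b \<in> B \<Longrightarrow> adj H a b \<longleftrightarrow> adj G a b"
  by (auto simp: H_def)

lemma bipartite_H: "bipartite_with H A B"
  using simple AB by (auto simp: bipartite_with_def simple_graph_def H_def)

lemma card_B_approx: "\<bar>real (card B) - n / 2\<bar> \<le> eta * n"
  using card_A_approx card_AB by linarith

lemma card_inner_edges:
  assumes "finite S"
  shows "real (card {e \<in> edge_set G. e \<subseteq> S}) \<le> (\<Sum>y\<in>S. \<Sum>x\<in>S. E x y)"
proof -
  let ?P = "{(y, x). y \<in> S \<and> x \<in> S \<and> adj G x y}"
  have P: "?P = {p \<in> S \<times> S. adj G (snd p) (fst p)}" by auto
  have "finite ?P" using assms unfolding P by simp
  have "{e \<in> edge_set G. e \<subseteq> S} \<subseteq> (\<lambda>(y, x). {x, y}) ` ?P"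
  proof (rule subsetI)
    fix e assume e: "e \<in> {e \<in> edge_set G. e \<subseteq> S}"
    then have "card e = 2" using simple by (auto simp: simple_graph_def)
    then obtain x y where "e = {x, y}" by (auto simp: card_2_iff)
    then show "e \<in> (\<lambda>(y, x). {x, y}) ` ?P" using e by (intro rev_image_eqI[of "(y, x)"]) auto
  qed
  then have "card {e \<in> edge_set G. e \<subseteq> S} \<le> card ?P"
    using \<open>finite ?P\<close> by (meson card_image_le card_mono finite_imageI order.trans)
  also have "real (card ?P) = (\<Sum>p\<in>S \<times> S. E (snd p) (fst p))"
    unfolding P using assms by (simp add: of_bool_def sum.If_cases Int_def)
  also have "\<dots> = (\<Sum>y\<in>S. \<Sum>x\<in>S. E x y)"
    by (simp add: sum.cartesian_product case_prod_unfold)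
  finally show ?thesis by simp
qed

text \<open>Edges are only deleted, namely those inside a part; 146 = 72 + 74.\<close>

lemma edits_le: "real (edits G H) \<le> 146 * (eta * n\<^sup>2)"
proof -
  have fE: "finite (edge_set G)"
    using simple by (auto simp: simple_graph_def intro: finite_subset[of _ "Pow (vertex_set G)"])
  have "(edge_set G - edge_set H) \<union> (edge_set H - edge_set G) \<subseteq> {e \<in> edge_set G. e \<subseteq> A} \<union> {e \<in> edge_set G. e \<subseteq> B}"
  proof (rule subsetI)
    fix e assume e: "e \<in> (edge_set G - edge_set H) \<union> (edge_set H - edge_set G)"
    then have eG: "e \<in> edge_set G" "\<not> (\<exists>a\<in>A. \<exists>b\<in>B. e = {a, b})" by (auto simp: H_def)
    then have "card e = 2" "e \<subseteq> V" using simple by (auto simp: simple_graph_def)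
    then obtain x y where "e = {x, y}" "x \<in> V" "y \<in> V" by (auto simp: card_2_iff)
    then show "e \<in> {e \<in> edge_set G. e \<subseteq> A} \<union> {e \<in> edge_set G. e \<subseteq> B}"
      using eG AB(4) by (auto simp: insert_commute)
  qed
  then have "edits G H \<le> card ({e \<in> edge_set G. e \<subseteq> A} \<union> {e \<in> edge_set G. e \<subseteq> B})"
    unfolding edits_def by (rule card_mono[rotated]) (simp add: fE)
  also have "\<dots> \<le> card {e \<in> edge_set G. e \<subseteq> A} + card {e \<in> edge_set G. e \<subseteq> B}" by (rule card_Un_le)
  finally have "real (edits G H) \<le> real (card {e \<in> edge_set G. e \<subseteq> A}) + real (card {e \<in> edge_set G. e \<subseteq> B})" by linarith
  then show ?thesis
    using card_inner_edges[OF fin(2)] card_inner_edges[OF fin(3)] edges_A edges_B unfolding dA_def dB_def by linarith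
qed

lemma hom_density_H:
  fixes F :: "'b graph"
  assumes F: "bipartite_with F X Y"
  shows "\<bar>bip_hom_density F X Y H A B - (5 / 6) ^ card (edge_set F)\<bar> \<le> real (card (edge_set F)) * sqrt (16200 * sqrt eta)"
proof -
  let ?d = "sqrt (16200 * sqrt eta)"
  let ?M = "part_maps X Y A B"
  have XY: "X \<inter> Y = {}" "finite X" "finite Y"
    and Fe: "\<forall>e\<in>edge_set F. \<exists>a\<in>X. \<exists>b\<in>Y. e = {a, b}"
    using F finite_subset[of X "vertex_set F"] finite_subset[of Y "vertex_set F"] by (auto simp: bipartite_with_def simple_graph_def)
  \<comment> \<open>The edges of \<open>F\<close> are oriented from \<open>X\<close> to
    \<open>Y\<close> to fit the counting lemma; disjointness of the parts makes this a bijection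
    with the edge set.\<close>
  define E' where "E' = {p \<in> X \<times> Y. {fst p, snd p} \<in> edge_set F}"
  have finE': "finite E'" and E'XY: "E' \<subseteq> X \<times> Y" using XY by (auto simp: E'_def)
  have img: "(\<lambda>p. {fst p, snd p}) ` E' = edge_set F"
    using Fe by (force simp: E'_def image_iff)
  have "inj_on (\<lambda>p. {fst p, snd p}) E'"
    using XY(1) by (auto simp: inj_on_def E'_def doubleton_eq_iff)
  then have cE: "card E' = card (edge_set F)" using img card_image by metis
  have ne: "card A > 0" "card B > 0" using card_bounds(1,2) n_pos by (auto intro: Nat.gr0I)
  have finM: "finite ?M"
    unfolding part_maps_def by (rule finite_subset[OF _ finite_PiE[of "X \<union> Y" "\<lambda>_. A \<union> B"]]) (use XY fin in auto)
  have M_ne: "?M \<noteq> {}"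
  proof -
    have "A \<noteq> {}" "B \<noteq> {}" using ne by auto
    then obtain a b where "a \<in> A" "b \<in> B" by blast
    then have "(\<lambda>v. if v \<in> X then a else if v \<in> Y then b else undefined) \<in> ?M"
      using XY(1) by (auto simp: part_maps_def)
    then show ?thesis by blast
  qed
  have M_pos: "real (card ?M) > 0" using finM M_ne by (simp add: card_gt_0_iff)
  define W where "W a b = (of_bool (adj H a b) :: real)" for a b
  have cut: "\<bar>\<Sum>a\<in>A. \<Sum>b\<in>B. f a * g b * (W a b - 5 / 6)\<bar> \<le> ?d * (real (card A) * real (card B))"
    if "\<And>a. 0 \<le> f a \<and> f a \<le> 1" "\<And>b. 0 \<le> g b \<and> g b \<le> 1" for f g
  proof -
    have "(\<Sum>a\<in>A. \<Sum>b\<in>B. f a * g b * (W a b - 5 / 6)) = (\<Sum>a\<in>A. \<Sum>b\<in>B. f a * g b * (E a b - 5 / 6))"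
      by (intro sum.cong refl) (simp add: W_def adj_H)
    then show ?thesis using cut_bound[of f g] that by simp
  qed
  have "\<bar>(\<Sum>f\<in>?M. \<Prod>e\<in>E'. W (f (fst e)) (f (snd e))) - (5 / 6) ^ card E' * real (card ?M)\<bar> \<le> real (card E') * ?d * real (card ?M)"
    by (rule counting_lemma[OF _ _ _ _ ne XY(1) cut finE' E'XY]) (auto simp: W_def)
  moreover have "(\<Sum>f\<in>?M. \<Prod>e\<in>E'. W (f (fst e)) (f (snd e))) = real (card {f \<in> ?M. \<forall>e\<in>edge_set F. f ` e \<in> edge_set H})"
  proof -
    have "(\<Prod>e\<in>E'. W (f (fst e)) (f (snd e))) = of_bool (\<forall>e\<in>edge_set F. f ` e \<in> edge_set H)" for f
    proof -
      have "(\<forall>e\<in>edge_set F. f ` e \<in> edge_set H) \<longleftrightarrow> (\<forall>p\<in>E'. adj H (f (fst p)) (f (snd p)))"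
        unfolding img[symmetric] by simp
      moreover have "(\<Prod>e\<in>E'. W (f (fst e)) (f (snd e))) = of_bool (\<forall>p\<in>E'. adj H (f (fst p)) (f (snd p)))"
        unfolding W_def using finE' by (induction E') auto
      ultimately show ?thesis by simp
    qed
    then show ?thesis using finM by (simp add: of_bool_def sum.If_cases Int_def)
  qed
  ultimately have "\<bar>real (card {f \<in> ?M. \<forall>e\<in>edge_set F. f ` e \<in> edge_set H}) - (5 / 6) ^ card (edge_set F) * real (card ?M)\<bar>
      \<le> real (card (edge_set F)) * ?d * real (card ?M)"
    by (simp only: cE)
  then have "\<bar>real (card {f \<in> ?M. \<forall>e\<in>edge_set F. f ` e \<in> edge_set H}) - (5 / 6) ^ card (edge_set F) * real (card ?M)\<bar> / real (card ?M)
      \<le> real (card (edge_set F)) * ?d"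
    using M_pos by (simp only: pos_divide_le_eq)
  moreover have "\<bar>real (card {f \<in> ?M. \<forall>e\<in>edge_set F. f ` e \<in> edge_set H}) - (5 / 6) ^ card (edge_set F) * real (card ?M)\<bar> / real (card ?M)
      = \<bar>bip_hom_density F X Y H A B - (5 / 6) ^ card (edge_set F)\<bar>"
  proof -
    have "\<bar>r - q * m\<bar> / m = \<bar>r / m - q\<bar>" if "m > 0" for r q m :: real
      using that abs_divide[of "r - q * m" m] by (simp add: diff_divide_distrib)
    from this[OF M_pos] show ?thesis unfolding bip_hom_density_def .
  qed
  ultimately show ?thesis by simp
qed

end

section \<open>Stability\<close>

text \<open>A copy is determined by one of its edges, here the one between 0 and 1, and its three
  other vertices. This forces many edges and so rules out nearly empty graphs, for which the
  degree-weighted estimates are void.\<close>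

lemma copies_le_sum_deg:
  fixes G :: "'a graph"
  assumes "simple_graph G"
  shows "real (copies G) \<le> real (num_verts G) ^ 3 * (\<Sum>x\<in>vertex_set G. deg G x)"
proof -
  let ?V = "vertex_set G"
  let ?C = "{S. S \<subseteq> ?V \<and> card S = num_verts C4_pendant \<and> isomorphic (induced G S) C4_pendant}"
  let ?P = "{p \<in> ?V \<times> ?V. adj G (snd p) (fst p)}"
  have fin: "finite ?V" using assms by (simp add: simple_graph_def)
  define h where "h = (\<lambda>((a, b), c, d, e). {a, b, c, d, e :: 'a})"
  have "\<forall>S\<in>?C. \<exists>t. t \<in> ?P \<times> ?V \<times> ?V \<times> ?V \<and> S = h t"
  proof
    fix S assume S: "S \<in> ?C"
    then have "isomorphic (induced G S) C4_pendant" by blast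
    from isomorphic_induced_C4_pendantE[OF this] obtain f where f: "bij_betw f S {0..<5}"
      and iso: "\<forall>a\<in>S. \<forall>b\<in>S. adj G a b \<longleftrightarrow> {f a, f b} \<in> edge_set C4_pendant"
      by blast
    define g where "g = inv_into S f"
    have g: "g i \<in> S" "f (g i) = i" if "i < 5" for i
      using f that by (auto simp: g_def bij_betw_def inv_into_into f_inv_into_f)
    have "{0..<5} = {0, 1, 2, 3, 4 :: nat}" by auto
    moreover have "S = g ` {0..<5}"
      unfolding g_def using bij_betw_imp_surj_on[OF bij_betw_inv_into[OF f]] by simp
    ultimately have S': "S = {g 0, g 1, g 2, g 3, g 4}" by simp
    have "adj G (g 1) (g 0)"
      using iso[rule_format, of "g 1" "g 0"] g[of 0] g[of 1] by (simp add: C4_pendant_edge)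
    moreover have "g i \<in> ?V" if "i < 5" for i using g(1)[OF that] S by blast
    ultimately have "((g 0, g 1), g 2, g 3, g 4) \<in> ?P \<times> ?V \<times> ?V \<times> ?V" by simp
    with S' show "\<exists>t. t \<in> ?P \<times> ?V \<times> ?V \<times> ?V \<and> S = h t" unfolding h_def by force
  qed
  then obtain t where t: "\<forall>S\<in>?C. t S \<in> ?P \<times> ?V \<times> ?V \<times> ?V \<and> S = h (t S)"
    using bchoice[of ?C "\<lambda>S t. t \<in> ?P \<times> ?V \<times> ?V \<times> ?V \<and> S = h t"] by blast
  have "inj_on t ?C" using t by (intro inj_on_inverseI[of _ h]) simp
  then have "copies G \<le> card (?P \<times> ?V \<times> ?V \<times> ?V)"
  proof (rule card_inj_on_le)
    show "t ` ?C \<subseteq> ?P \<times> ?V \<times> ?V \<times> ?V" using t by blast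
    show "finite (?P \<times> ?V \<times> ?V \<times> ?V)" using fin by simp
  qed
  then have "real (copies G) \<le> real (card ?P) * real (num_verts G) ^ 3"
    by (simp add: card_cartesian_product eval_nat_numeral flip: of_nat_mult)
  moreover have "real (card ?P) = (\<Sum>p\<in>?V \<times> ?V. of_bool (adj G (snd p) (fst p)))"
    using fin by (simp add: of_bool_def sum.If_cases Int_def)
  moreover have "\<dots> = (\<Sum>x\<in>?V. deg G x)"
    by (simp add: sum.cartesian_product case_prod_unfold deg_def)
  ultimately show ?thesis by (simp add: mult.commute)
qed

lemma weighted_Cauchy_Schwarz:
  fixes w x :: "'a \<Rightarrow> real"
  assumes "\<And>i. w i \<ge> 0"
  shows "(\<Sum>i\<in>I. w i * \<bar>x i\<bar>)\<^sup>2 \<le> (\<Sum>i\<in>I. w i) * (\<Sum>i\<in>I. w i * (x i)\<^sup>2)"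
  using Cauchy_Schwarz_ineq_sum[of "\<lambda>i. sqrt (w i)" "\<lambda>i. sqrt (w i) * \<bar>x i\<bar>" I] assms
  by (simp add: power_mult_distrib mult.assoc[symmetric])

text \<open>From squared to absolute deviations. The degree weight is squared in the defect bound,
  so plain Cauchy-Schwarz applies; the codegree weight occurs only once, so half of it goes to each
  factor and the total weight n^3 appears.\<close>

lemma sum_deg_le:
  fixes G :: "'a graph"
  assumes "simple_graph G"
  defines "n \<equiv> real (num_verts G)"
  shows "(\<Sum>x\<in>vertex_set G. deg G x * \<bar>12 * deg G x - 5 * n\<bar>)\<^sup>2 \<le> n * (2259 * defect G)"
    and "(\<Sum>x\<in>vertex_set G. \<Sum>y\<in>vertex_set G. codeg G x y * \<bar>72 * codeg G x y - 25 * n\<bar>)\<^sup>2 \<le> n ^ 3 * (2259 * defect G)"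
proof -
  let ?V = "vertex_set G"
  have c: "0 \<le> codeg G x y" "codeg G x y \<le> n" for x y
    using sum_of_bool_bounds[of "\<lambda>w. adj G w x \<and> adj G w y" ?V] by (simp_all add: codeg_def n_def)
  have nonneg: "0 \<le> (\<Sum>x\<in>?V. (deg G x)\<^sup>2 * (12 * deg G x - 5 * n)\<^sup>2)"
    "0 \<le> (\<Sum>x\<in>?V. \<Sum>y\<in>?V. codeg G x y * (72 * codeg G x y - 25 * n)\<^sup>2)"
    by (intro sum_nonneg mult_nonneg_nonneg c; simp)+
  have D: "(\<Sum>x\<in>?V. (deg G x)\<^sup>2 * (12 * deg G x - 5 * n)\<^sup>2) \<le> 2259 * defect G"
    "(\<Sum>x\<in>?V. \<Sum>y\<in>?V. codeg G x y * (72 * codeg G x y - 25 * n)\<^sup>2) \<le> 2259 * defect G"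
    using defect_ge(2)[OF assms(1)] nonneg unfolding n_def by linarith+
  have "(\<Sum>x\<in>?V. deg G x * \<bar>12 * deg G x - 5 * n\<bar>)\<^sup>2 \<le> (\<Sum>x\<in>?V. (deg G x * \<bar>12 * deg G x - 5 * n\<bar>)\<^sup>2) * real (card ?V)"
    by (rule sum_squared_le_sum_of_squares)
  also have "\<dots> = n * (\<Sum>x\<in>?V. (deg G x)\<^sup>2 * (12 * deg G x - 5 * n)\<^sup>2)"
    by (simp add: power_mult_distrib n_def mult.commute)
  also have "\<dots> \<le> n * (2259 * defect G)" by (rule mult_left_mono[OF D(1)]) (simp add: n_def)
  finally show "(\<Sum>x\<in>?V. deg G x * \<bar>12 * deg G x - 5 * n\<bar>)\<^sup>2 \<le> n * (2259 * defect G)" .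
  have "(\<Sum>x\<in>?V. \<Sum>y\<in>?V. codeg G x y * \<bar>72 * codeg G x y - 25 * n\<bar>)\<^sup>2
      = (\<Sum>p\<in>?V \<times> ?V. codeg G (fst p) (snd p) * \<bar>72 * codeg G (fst p) (snd p) - 25 * n\<bar>)\<^sup>2"
    by (simp add: sum.cartesian_product case_prod_unfold)
  also have "\<dots> \<le> (\<Sum>p\<in>?V \<times> ?V. codeg G (fst p) (snd p)) *
      (\<Sum>p\<in>?V \<times> ?V. codeg G (fst p) (snd p) * (72 * codeg G (fst p) (snd p) - 25 * n)\<^sup>2)"
    by (rule weighted_Cauchy_Schwarz) (rule c)
  also have "\<dots> = (\<Sum>x\<in>?V. \<Sum>y\<in>?V. codeg G x y) * (\<Sum>x\<in>?V. \<Sum>y\<in>?V. codeg G x y * (72 * codeg G x y - 25 * n)\<^sup>2)"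
    by (simp add: sum.cartesian_product case_prod_unfold)
  also have "\<dots> \<le> n ^ 3 * (2259 * defect G)"
  proof (rule mult_mono[OF _ D(2)])
    have "(\<Sum>x\<in>?V. \<Sum>y\<in>?V. codeg G x y) \<le> (\<Sum>x\<in>?V. \<Sum>y\<in>?V. n)" by (intro sum_mono c)
    then show "(\<Sum>x\<in>?V. \<Sum>y\<in>?V. codeg G x y) \<le> n ^ 3" by (simp add: n_def eval_nat_numeral)
  qed (use nonneg in \<open>auto simp: n_def\<close>)
  finally show "(\<Sum>x\<in>?V. \<Sum>y\<in>?V. codeg G x y * \<bar>72 * codeg G x y - 25 * n\<bar>)\<^sup>2 \<le> n ^ 3 * (2259 * defect G)" .
qed

text \<open>\<open>u\<close> is drawn with probability proportional to its degree, the only weight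
  under which the deviation of deg \<open>u\<close> is controlled. Scaled to order n^3, the three
  errors have weighted sum at most 3 r n^5 against a total weight of at least s n^2. For
  \<open>e2\<close> and \<open>e3\<close> the weight is bounded by n, and exchanging the sums in
  \<open>e2\<close> restores a degree weight.\<close>

lemma exists_typical_vertex:
  fixes G :: "'a graph"
  assumes G: "simple_graph G"
  defines "n \<equiv> real (num_verts G)"
  defines "V \<equiv> vertex_set G"
  assumes R: "(\<Sum>x\<in>V. deg G x * \<bar>12 * deg G x - 5 * n\<bar>) \<le> r * n ^ 3"
    and C: "(\<Sum>x\<in>V. \<Sum>y\<in>V. codeg G x y * \<bar>72 * codeg G x y - 25 * n\<bar>) \<le> r * n ^ 4"
    and S: "s * n\<^sup>2 \<le> (\<Sum>x\<in>V. deg G x)" "s > 0" and n: "n > 0" and r: "r \<ge> 0"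
  shows "\<exists>u\<in>V. \<bar>12 * deg G u - 5 * n\<bar> \<le> 3 * r / s * n \<and>
    (\<Sum>w\<in>V. of_bool (adj G w u) * \<bar>12 * deg G w - 5 * n\<bar>) \<le> 3 * r / s * n\<^sup>2 \<and>
    (\<Sum>v\<in>V. codeg G u v * \<bar>72 * codeg G u v - 25 * n\<bar>) \<le> 3 * r / s * n ^ 3"
proof -
  have fin: "finite V" using G by (simp add: simple_graph_def V_def)
  have d: "0 \<le> deg G x" "deg G x \<le> n" for x
    using sum_of_bool_bounds[of "\<lambda>w. adj G w x" V] by (simp_all add: deg_def n_def V_def)
  have c: "0 \<le> codeg G x y" for x y
    using sum_of_bool_bounds[of "\<lambda>w. adj G w x \<and> adj G w y" V] by (simp add: codeg_def V_def)
  define e1 where "e1 u = n\<^sup>2 * \<bar>12 * deg G u - 5 * n\<bar>" for u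
  define e2 where "e2 u = n * (\<Sum>w\<in>V. of_bool (adj G w u) * \<bar>12 * deg G w - 5 * n\<bar>)" for u
  define e3 where "e3 u = (\<Sum>v\<in>V. codeg G u v * \<bar>72 * codeg G u v - 25 * n\<bar>)" for u
  have e: "0 \<le> e1 u" "0 \<le> e2 u" "0 \<le> e3 u" for u
    unfolding e1_def e2_def e3_def using n c by (simp_all add: sum_nonneg)
  have "(\<Sum>u\<in>V. deg G u * e1 u) = n\<^sup>2 * (\<Sum>u\<in>V. deg G u * \<bar>12 * deg G u - 5 * n\<bar>)"
    by (simp add: e1_def sum_distrib_left mult.left_commute)
  also have "\<dots> \<le> n\<^sup>2 * (r * n ^ 3)" by (rule mult_left_mono[OF R]) simp
  finally have 1: "(\<Sum>u\<in>V. deg G u * e1 u) \<le> r * n ^ 5" by (simp add: eval_nat_numeral mult_ac)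
  have "(\<Sum>u\<in>V. deg G u * e2 u) \<le> (\<Sum>u\<in>V. n * e2 u)"
    by (intro sum_mono mult_right_mono d e)
  also have "\<dots> = n\<^sup>2 * (\<Sum>u\<in>V. \<Sum>w\<in>V. of_bool (adj G w u) * \<bar>12 * deg G w - 5 * n\<bar>)"
    by (simp add: e2_def sum_distrib_left power2_eq_square mult.assoc)
  also have "(\<Sum>u\<in>V. \<Sum>w\<in>V. of_bool (adj G w u) * \<bar>12 * deg G w - 5 * n\<bar>) = (\<Sum>w\<in>V. \<Sum>u\<in>V. of_bool (adj G w u) * \<bar>12 * deg G w - 5 * n\<bar>)"
    by (rule sum.swap)
  also have "\<dots> = (\<Sum>w\<in>V. deg G w * \<bar>12 * deg G w - 5 * n\<bar>)"
    by (simp only: deg_def V_def sum_distrib_right insert_commute)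
  also have "n\<^sup>2 * \<dots> \<le> n\<^sup>2 * (r * n ^ 3)" by (rule mult_left_mono[OF R]) simp
  finally have 2: "(\<Sum>u\<in>V. deg G u * e2 u) \<le> r * n ^ 5" by (simp add: eval_nat_numeral mult_ac)
  have "(\<Sum>u\<in>V. deg G u * e3 u) \<le> (\<Sum>u\<in>V. n * e3 u)"
    by (intro sum_mono mult_right_mono d e)
  also have "\<dots> \<le> n * (r * n ^ 4)"
    unfolding sum_distrib_left[symmetric] e3_def by (rule mult_left_mono[OF C]) (use n in simp)
  finally have 3: "(\<Sum>u\<in>V. deg G u * e3 u) \<le> r * n ^ 5" by (simp add: eval_nat_numeral mult_ac)
  define q where "q = 3 * r / s * n ^ 3"
  have q: "q \<ge> 0" using r S(2) n by (simp add: q_def)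
  have "3 * r * n ^ 5 = q * (s * n\<^sup>2)" using S(2) by (simp add: q_def eval_nat_numeral)
  also have "\<dots> \<le> q * (\<Sum>u\<in>V. deg G u)" by (rule mult_left_mono[OF S(1) q])
  finally have tot: "(\<Sum>u\<in>V. deg G u * (e1 u + e2 u + e3 u - q)) \<le> 0"
    using 1 2 3 by (simp add: distrib_left right_diff_distrib sum.distrib sum_subtractf sum_distrib_left mult.commute)
  have "\<exists>u\<in>V. e1 u + e2 u + e3 u \<le> q"
  proof (rule ccontr)
    assume "\<not> ?thesis"
    then have gt: "q < e1 u + e2 u + e3 u" if "u \<in> V" for u using that by (simp add: not_le)
    then have nn: "0 \<le> deg G u * (e1 u + e2 u + e3 u - q)" if "u \<in> V" for u
      using that by (intro mult_nonneg_nonneg d) force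
    then have "(\<Sum>u\<in>V. deg G u * (e1 u + e2 u + e3 u - q)) = 0"
      using tot sum_nonneg[of V "\<lambda>u. deg G u * (e1 u + e2 u + e3 u - q)"] by force
    then have "\<forall>u\<in>V. deg G u * (e1 u + e2 u + e3 u - q) = 0"
      using sum_nonneg_eq_0_iff[OF fin nn] by simp
    then have "deg G u = 0" if "u \<in> V" for u using gt[OF that] that by fastforce
    then have "(\<Sum>u\<in>V. deg G u) = 0" by simp
    moreover have "0 < s * n\<^sup>2" using S(2) n by simp
    ultimately show False using S(1) by linarith
  qed
  then obtain u where u: "u \<in> V" "e1 u + e2 u + e3 u \<le> q" by blast
  have "n\<^sup>2 * \<bar>12 * deg G u - 5 * n\<bar> \<le> n\<^sup>2 * (3 * r / s * n)"
    using u(2) e[of u] by (simp add: e1_def q_def eval_nat_numeral mult_ac)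
  then have "\<bar>12 * deg G u - 5 * n\<bar> \<le> 3 * r / s * n"
    by (rule mult_left_le_imp_le) (use n in simp)
  moreover have "n * (\<Sum>w\<in>V. of_bool (adj G w u) * \<bar>12 * deg G w - 5 * n\<bar>) \<le> n * (3 * r / s * n\<^sup>2)"
    using u(2) e[of u] by (simp add: e2_def q_def eval_nat_numeral mult_ac)
  then have "(\<Sum>w\<in>V. of_bool (adj G w u) * \<bar>12 * deg G w - 5 * n\<bar>) \<le> 3 * r / s * n\<^sup>2"
    by (rule mult_left_le_imp_le) (use n in simp)
  moreover have "e3 u \<le> q" using u(2) e[of u] by linarith
  ultimately show ?thesis
    using u(1) unfolding e3_def q_def by blast
qed

text \<open>A sum in place of a maximum: \<open>a\<close> serves the triangles, sqrt(2259 a) the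
  global degree and codegree sums, and the last term the three conditions at \<open>u\<close>. It
  vanishes in the limit once \<open>a\<close> does and \<open>s\<close> stays away from
  zero.\<close>

definition stability_error :: "'a graph \<Rightarrow> real" where
  "stability_error G = (let a = defect G / real (num_verts G) ^ 5; s = real (copies G) / real (num_verts G) ^ 5
     in a + sqrt (2259 * a) + 3 * sqrt (2259 * a) / s)"

lemma near_extremal_stability_error:
  assumes G: "simple_graph G" and n: "num_verts G > 0" and copies: "copies G > 0" and small: "stability_error G \<le> 1 / 1000"
  shows "\<exists>u. near_extremal G u (stability_error G)"
proof -
  define n where "n = real (num_verts G)"
  define a where "a = defect G / n ^ 5"
  define s where "s = real (copies G) / n ^ 5"
  define r where "r = sqrt (2259 * a)"
  have n0: "n > 0" using n by (simp add: n_def)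
  have e: "stability_error G = a + r + 3 * r / s" by (simp add: stability_error_def Let_def a_def s_def r_def n_def)
  have "0 \<le> defect G" using defect_ge(1)[OF G] triangles_nonneg[of G]
    by (meson mult_nonneg_nonneg order.trans zero_le_power of_nat_0_le_iff)
  then have a0: "a \<ge> 0" using n0 by (simp add: a_def)
  have defect: "defect G = a * n ^ 5" using n0 by (simp add: a_def)
  have s0: "s > 0" using copies n0 by (simp add: s_def)
  have r0: "r \<ge> 0" and r2: "r\<^sup>2 = 2259 * a" using a0 by (simp_all add: r_def)
  have R: "(\<Sum>x\<in>vertex_set G. deg G x * \<bar>12 * deg G x - 5 * n\<bar>) \<le> r * n ^ 3"
  proof (rule power2_le_imp_le)
    have "(\<Sum>x\<in>vertex_set G. deg G x * \<bar>12 * deg G x - 5 * n\<bar>)\<^sup>2 \<le> n * (2259 * defect G)"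
      using sum_deg_le(1)[OF G] by (simp add: n_def)
    also have "\<dots> = r\<^sup>2 * n ^ 6" unfolding r2 defect by (simp add: eval_nat_numeral)
    also have "\<dots> = (r * n ^ 3)\<^sup>2" by (simp add: power_mult_distrib flip: power_mult)
    finally show "(\<Sum>x\<in>vertex_set G. deg G x * \<bar>12 * deg G x - 5 * n\<bar>)\<^sup>2 \<le> (r * n ^ 3)\<^sup>2" .
  qed (use r0 n0 in simp)
  have C: "(\<Sum>x\<in>vertex_set G. \<Sum>y\<in>vertex_set G. codeg G x y * \<bar>72 * codeg G x y - 25 * n\<bar>) \<le> r * n ^ 4"
  proof (rule power2_le_imp_le)
    have "(\<Sum>x\<in>vertex_set G. \<Sum>y\<in>vertex_set G. codeg G x y * \<bar>72 * codeg G x y - 25 * n\<bar>)\<^sup>2 \<le> n ^ 3 * (2259 * defect G)"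
      using sum_deg_le(2)[OF G] by (simp add: n_def)
    also have "\<dots> = r\<^sup>2 * n ^ 8" unfolding r2 defect by (simp add: eval_nat_numeral)
    also have "\<dots> = (r * n ^ 4)\<^sup>2" by (simp add: power_mult_distrib flip: power_mult)
    finally show "(\<Sum>x\<in>vertex_set G. \<Sum>y\<in>vertex_set G. codeg G x y * \<bar>72 * codeg G x y - 25 * n\<bar>)\<^sup>2 \<le> (r * n ^ 4)\<^sup>2" .
  qed (use r0 n0 in simp)
  have "n ^ 3 * (s * n\<^sup>2) = real (copies G)" using n0 by (simp add: s_def eval_nat_numeral)
  also have "\<dots> \<le> n ^ 3 * (\<Sum>x\<in>vertex_set G. deg G x)" unfolding n_def by (rule copies_le_sum_deg[OF G])
  finally have S: "s * n\<^sup>2 \<le> (\<Sum>x\<in>vertex_set G. deg G x)" by (rule mult_left_le_imp_le) (use n0 in simp)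
  from exists_typical_vertex[OF G, folded n_def, OF R C S s0 n0 r0]
  obtain u where u: "\<bar>12 * deg G u - 5 * n\<bar> \<le> 3 * r / s * n"
    "(\<Sum>w\<in>vertex_set G. of_bool (adj G w u) * \<bar>12 * deg G w - 5 * n\<bar>) \<le> 3 * r / s * n\<^sup>2"
    "(\<Sum>v\<in>vertex_set G. codeg G u v * \<bar>72 * codeg G u v - 25 * n\<bar>) \<le> 3 * r / s * n ^ 3"
    by blast
  have le: "a \<le> stability_error G" "r \<le> stability_error G" "3 * r / s \<le> stability_error G"
    using a0 r0 s0 by (simp_all add: e)
  have T: "triangles G \<le> a * n ^ 3"
  proof -
    have "n\<^sup>2 * triangles G \<le> n\<^sup>2 * (a * n ^ 3)"
      using defect_ge(1)[OF G] by (simp add: defect n_def eval_nat_numeral mult_ac)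
    then show ?thesis by (rule mult_left_le_imp_le) (use n0 in simp)
  qed
  have mono: "x \<le> stability_error G * n ^ k" if "x \<le> y * n ^ k" "y \<le> stability_error G" for x y k
    using that mult_right_mono[OF that(2), of "n ^ k"] n0 by (simp add: order.trans)
  have u1: "\<bar>12 * deg G u - 5 * n\<bar> \<le> stability_error G * n"
    by (rule mono[of _ _ 1, unfolded power_one_right, OF u(1) le(3)])
  show ?thesis
    unfolding near_extremal_def n_def[symmetric]
    by (intro exI[of _ u] conjI G small n u1 mono[OF u(2) le(3)] mono[OF u(3) le(3)] mono[OF T le(1)]
      mono[OF R le(2)] mono[OF C le(2)])
qed

definition quasirandom_up_to :: "real \<Rightarrow> 'a graph \<Rightarrow> 'a graph \<Rightarrow> 'a set \<Rightarrow> 'a set \<Rightarrow> bool" where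
  "quasirandom_up_to e G H A B \<longleftrightarrow>
    real (edits G H) \<le> 146 * (e * (real (num_verts G))\<^sup>2) \<and>
    \<bar>real (card A) - real (num_verts G) / 2\<bar> \<le> e * real (num_verts G) \<and>
    \<bar>real (card B) - real (num_verts G) / 2\<bar> \<le> e * real (num_verts G) \<and>
    (\<forall>(F :: nat graph) X Y. bipartite_with F X Y \<longrightarrow>
      \<bar>bip_hom_density F X Y H A B - (5 / 6) ^ card (edge_set F)\<bar> \<le> real (card (edge_set F)) * sqrt (16200 * sqrt e))"

lemma exists_quasirandom_up_to:
  fixes G :: "'a graph"
  assumes G: "simple_graph G"
  defines "e \<equiv> stability_error G"
  shows "\<exists>H A B. vertex_set H = vertex_set G \<and> bipartite_with H A B \<and>
    (num_verts G > 0 \<and> copies G > 0 \<and> e \<le> 1 / 1000 \<longrightarrow> quasirandom_up_to e G H A B)"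
proof (cases "num_verts G > 0 \<and> copies G > 0 \<and> e \<le> 1 / 1000")
  case True
  then obtain u where "near_extremal G u e"
    using near_extremal_stability_error[OF G] by (auto simp: e_def)
  then interpret near_extremal G u e .
  show ?thesis
    by (rule exI[of _ H], rule exI[of _ A], rule exI[of _ B])
      (use bipartite_H edits_le card_A_approx card_B_approx hom_density_H in \<open>auto simp: quasirandom_up_to_def H_def\<close>)
next
  case False
  \<comment> \<open>A default for graphs outside the range of the estimates: bipartiteness is
    demanded at every index, not only for large ones.\<close>
  have "bipartite_with (vertex_set G, {}) (vertex_set G) {}"
    using G by (simp add: bipartite_with_def simple_graph_def)
  with False show ?thesis
    by (intro exI[of _ "(vertex_set G, {})"] exI[of _ "vertex_set G"] exI[of _ "{}"]) auto
qed

section \<open>Passage to the limit\<close>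

theorem theorem5p1:
  fixes G :: "nat \<Rightarrow> 'a graph"
  assumes "\<And>n. simple_graph (G n)"
    and "strict_mono (\<lambda>n. num_verts (G n))"
    and "(\<lambda>n. induced_density C4_pendant (G n)) \<longlonglongrightarrow> inducibility C4_pendant"
  shows "\<exists>(H :: nat \<Rightarrow> 'a graph) A B.
    (\<forall>n. vertex_set (H n) = vertex_set (G n)) \<and>
    (\<lambda>n. real (edits (G n) (H n))) \<in> o(\<lambda>n. real (num_verts (G n)) ^ 2) \<and>
    quasirandom (5 / 6) H A B"
proof -
  let ?N = "\<lambda>n. num_verts (G n)"
  have N: "filterlim ?N at_top sequentially" by (rule filterlim_subseq[OF assms(2)])
  have "(\<lambda>m. real (m choose 5) / real m ^ 5) \<longlonglongrightarrow> 1 ^ 5 / fact 5"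
    by (rule binomial_over_power_tendsto) real_asymp
  from filterlim_compose[OF this N]
  have ch: "(\<lambda>n. real (?N n choose 5) / real (?N n) ^ 5) \<longlonglongrightarrow> 1 / 120" by (simp add: fact_numeral)
  let ?s = "\<lambda>n. real (copies (G n)) / real (?N n) ^ 5"
  \<comment> \<open>From five vertices on the binomial coefficient is nonzero and the density is a
    genuine quotient.\<close>
  have pos: "\<forall>\<^sub>F n in sequentially. ?N n > 4"
    using eventually_compose_filterlim[OF eventually_gt_at_top N] .
  have "(\<lambda>n. induced_density C4_pendant (G n) * (real (?N n choose 5) / real (?N n) ^ 5)) \<longlonglongrightarrow> 15625 / 62208 * (1 / 120)"
    using assms(3) unfolding inducibility_C4_pendant by (rule tendsto_mult[OF _ ch])
  moreover have "\<forall>\<^sub>F n in sequentially. induced_density C4_pendant (G n) * (real (?N n choose 5) / real (?N n) ^ 5) = ?s n"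
    using pos by eventually_elim (simp add: induced_density_def binomial_eq_0_iff)
  ultimately have "?s \<longlonglongrightarrow> 15625 / 62208 * (1 / 120)"
    by (rule Lim_transform_eventually)
  then have s: "?s \<longlonglongrightarrow> 15625 / 62208 / 120" by simp
  let ?a = "\<lambda>n. defect (G n) / real (?N n) ^ 5"
  \<comment> \<open>The limit is exactly zero: 18289152000 / 120 = 152409600 and 152409600 * 15625 /
    62208 = 38281250.\<close>
  have "(\<lambda>n. 38281250 - 18289152000 * ?s n) \<longlonglongrightarrow> 38281250 - 18289152000 * (15625 / 62208 / 120)"
    by (intro tendsto_intros s)
  then have "(\<lambda>n. 38281250 - 18289152000 * ?s n) \<longlonglongrightarrow> 0" by simp
  moreover have "\<forall>\<^sub>F n in sequentially. 38281250 - 18289152000 * ?s n = ?a n"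
    using pos by eventually_elim (simp add: defect_def diff_divide_distrib)
  ultimately have a: "?a \<longlonglongrightarrow> 0" by (rule Lim_transform_eventually)
  define e where "e n = stability_error (G n)" for n
  have "(\<lambda>n. ?a n + sqrt (2259 * ?a n) + 3 * sqrt (2259 * ?a n) / ?s n) \<longlonglongrightarrow>
      0 + sqrt (2259 * 0) + 3 * sqrt (2259 * 0) / (15625 / 62208 / 120)"
    by (intro tendsto_intros a s) simp
  moreover have "e = (\<lambda>n. ?a n + sqrt (2259 * ?a n) + 3 * sqrt (2259 * ?a n) / ?s n)"
    by (rule ext) (simp only: e_def stability_error_def Let_def)
  ultimately have e: "e \<longlonglongrightarrow> 0"
    by (simp only: mult_zero_right real_sqrt_zero div_0 add_0_right)
  have "\<forall>\<^sub>F n in sequentially. e n < 1 / 1000" by (rule order_tendstoD(2)[OF e]) simp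
  moreover have "\<forall>\<^sub>F n in sequentially. ?s n > 0" by (rule order_tendstoD(1)[OF s]) simp
  ultimately have good: "\<forall>\<^sub>F n in sequentially. ?N n > 0 \<and> copies (G n) > 0 \<and> e n \<le> 1 / 1000"
    using pos by eventually_elim (auto intro!: Nat.gr0I)
  define P where "P n H A B \<longleftrightarrow> vertex_set H = vertex_set (G n) \<and> bipartite_with H A B \<and>
    (?N n > 0 \<and> copies (G n) > 0 \<and> e n \<le> 1 / 1000 \<longrightarrow> quasirandom_up_to (e n) (G n) H A B)" for n H A B
  have "\<exists>H A B. P n H A B" for n
    unfolding P_def e_def by (rule exists_quasirandom_up_to[OF assms(1)])
  then obtain H A B where P: "\<And>n. P n (H n) (A n) (B n)" by metis
  then have V: "\<And>n. vertex_set (H n) = vertex_set (G n)" and bip: "\<And>n. bipartite_with (H n) (A n) (B n)"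
    by (simp_all only: P_def)
  have H: "?N n > 0 \<and> copies (G n) > 0 \<and> e n \<le> 1 / 1000 \<Longrightarrow> quasirandom_up_to (e n) (G n) (H n) (A n) (B n)" for n
    using P by (simp only: P_def)
  note H = H[unfolded quasirandom_up_to_def]
  have "(\<lambda>n. real (edits (G n) (H n))) \<in> o(\<lambda>n. real (?N n) ^ 2)"
  proof (rule smalloI_tendsto)
    show "(\<lambda>n. real (edits (G n) (H n)) / real (?N n) ^ 2) \<longlonglongrightarrow> 0"
    proof (rule tendsto_sandwich[OF _ _ tendsto_const])
      show "(\<lambda>n. 146 * e n) \<longlonglongrightarrow> 0" using tendsto_mult_left[OF e, of 146] by simp
      show "\<forall>\<^sub>F n in sequentially. real (edits (G n) (H n)) / real (?N n) ^ 2 \<le> 146 * e n"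
        using good by eventually_elim (use H in \<open>simp add: divide_le_eq mult.assoc\<close>)
    qed auto
    show "\<forall>\<^sub>F n in sequentially. real (?N n) ^ 2 \<noteq> 0" using pos by eventually_elim simp
  qed
  moreover have half: "(\<lambda>n. real (card (P n)) / real (?N n)) \<longlonglongrightarrow> 1 / 2"
    if "\<And>n. ?N n > 0 \<and> copies (G n) > 0 \<and> e n \<le> 1 / 1000 \<Longrightarrow> \<bar>real (card (P n)) - real (?N n) / 2\<bar> \<le> e n * real (?N n)" for P :: "nat \<Rightarrow> 'a set"
  proof (rule LIM_zero_cancel, rule tendsto_rabs_zero_cancel, rule tendsto_sandwich[OF _ _ tendsto_const e])
    show "\<forall>\<^sub>F n in sequentially. \<bar>real (card (P n)) / real (?N n) - 1 / 2\<bar> \<le> e n"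
      using good
    proof eventually_elim
      case (elim n)
      then have "\<bar>real (card (P n)) - real (?N n) / 2\<bar> / real (?N n) \<le> e n"
        using that[OF elim] by (simp add: divide_le_eq)
      moreover have "(real (card (P n)) - real (?N n) / 2) / real (?N n) = real (card (P n)) / real (?N n) - 1 / 2"
        using elim by (simp add: diff_divide_distrib)
      ultimately show ?case by (metis abs_divide abs_of_nat)
    qed
  qed auto
  have "balanced_bipartite_seq H A B"
    unfolding balanced_bipartite_seq_def V using assms(2) bip H by (auto intro!: half)
  moreover have "(\<lambda>n. bip_hom_density F X Y (H n) (A n) (B n)) \<longlonglongrightarrow> (5 / 6) ^ card (edge_set F)"
    if F: "bipartite_with F X Y" for F :: "nat graph" and X Y
  proof (rule LIM_zero_cancel, rule tendsto_rabs_zero_cancel, rule tendsto_sandwich[OF _ _ tendsto_const])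
    have "(\<lambda>n. real (card (edge_set F)) * sqrt (16200 * sqrt (e n))) \<longlonglongrightarrow> real (card (edge_set F)) * sqrt (16200 * sqrt 0)"
      by (intro tendsto_intros e)
    then show "(\<lambda>n. real (card (edge_set F)) * sqrt (16200 * sqrt (e n))) \<longlonglongrightarrow> 0" by simp
    show "\<forall>\<^sub>F n in sequentially. \<bar>bip_hom_density F X Y (H n) (A n) (B n) - (5 / 6) ^ card (edge_set F)\<bar>
        \<le> real (card (edge_set F)) * sqrt (16200 * sqrt (e n))"
      using good by eventually_elim (use H F in blast)
  qed auto
  ultimately show ?thesis
    unfolding quasirandom_def using V by blast
qed

end
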